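(* Let $k$ be an algebraically closed field of characteristic zero and let $G$ be a finite group of odd order. Any twisted automorphism $(f,F)$ of the group algebra $k[G]$ is gauge isomorphic to a unique twisted automorphism of the form $(f',F_{(S,\beta)})$, where $f'$ is an automorphism of $k[G]$ induced by a group automorphism of $G$, where $S\subset G$ is a normal abelian subgroup, and where $\beta:S\times S\to k^\times$ is a non-degenerate alternative $G$-invariant bi-multiplicative form.
   Context: $k[G]$ is a Hopf algebra with coproduct $\Delta(g)=g\otimes g$ and counit $\varepsilon(g)=1$ for $g\in G$. A twisted automorphism of $k[G]$ is a pair $(f,F)$, where $f:k[G]\to k[G]$ is an automorphism of algebras and $F\in k[G]\otimes k[G]$ is invertible such that $F\,\Delta(f(x))=(f\otimes f)(\Delta(x))\,F$ for all $x\in k[G]$, $(F\otimes 1)(\Delta\otimes I)(F)=(1\otimes F)(I\otimes\Delta)(F)$, and $(\varepsilon\otimes I)(F)=1=(I\otimes\varepsilon)(F)$. A gauge transformation $a:(f,F)\to(f',F')$ is an invertible $a\in k[G]$ with $\varepsilon(a)=1$, $f'(x)=af(x)a^{-1}$ for all $x$, and $F'\Delta(a)=(a\otimes a)F$. Two twisted automorphisms connected by a gauge transformation are called gauge isomorphic. For an abelian group $S$, a form $\beta:S\times S\to k^\times$ is bi-multiplicative if it is a homomorphism in each variable; alternative if moreover $\beta(s,s)=1$ for all $s\in S$; non-degenerate if it induces an isomorphism $S\to\hat S=\mathrm{Hom}(S,k^\times)$. For $S$ normal in $G$, it is $G$-invariant if $\beta(gsg^{-1},gtg^{-1})=\beta(s,t)$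 for all $g\in G$, $s,t\in S$. For such $\beta$, $$F_{(S,\beta)}=\frac1{|S|}\sum_{s,t\in S}\beta(s,t)\,s\otimes t\in k[G]\otimes k[G].$$
   Formalization: Uniqueness is stated as: S and β are unique, and the group automorphism inducing f' is unique up to inner automorphisms of G; literal uniqueness of f' fails for nonabelian G, since g in G is a gauge transformation from (f', F_(S,β)) to (Ad_g f', F_(S,β)). *)

theory Defs
  imports
    "HOL-Algebra.Algebra"
    "HOL-Computational_Algebra.Polynomial"
begin

text \<open>
  For a finite group \<open>G\<close> the group algebra \<open>k[G]\<close> is realised as the functions \<open>'a \<Rightarrow> 'k\<close> that vanish
  outside \<open>carrier G\<close>; the function \<open>x\<close> stands for the formal sum of the \<open>x g \<cdot> g\<close>.
  The ground field is the type \<open>'k\<close>.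
\<close>

definition group_algebra :: "('a, 'm) monoid_scheme \<Rightarrow> ('k::field, 'a \<Rightarrow> 'k) module" where
  "group_algebra G =
     \<lparr>carrier = {x. \<forall>g. g \<notin> carrier G \<longrightarrow> x g = 0},
      monoid.mult = (\<lambda>x y g.
        \<Sum>(h, h')\<in>{(h, h'). h \<in> carrier G \<and> h' \<in> carrier G \<and> h \<otimes>\<^bsub>G\<^esub> h' = g}. x h * y h'),
      one = (\<lambda>g. if g = \<one>\<^bsub>G\<^esub> then 1 else 0),
      ring.zero = (\<lambda>g. 0),
      add = (\<lambda>x y g. x g + y g),
      module.smult = (\<lambda>c x g. c * x g)\<rparr>"

definition basis_elem :: "'a \<Rightarrow> 'a \<Rightarrow> 'k::field" where
  "basis_elem g = (\<lambda>h. if h = g then 1 else 0)"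

definition lin_ext :: "('a, 'm) monoid_scheme \<Rightarrow> ('a \<Rightarrow> 'b \<Rightarrow> 'k) \<Rightarrow> ('a \<Rightarrow> 'k::field) \<Rightarrow> 'b \<Rightarrow> 'k" where
  "lin_ext G v x = (\<lambda>b. \<Sum>g\<in>carrier G. x g * v g b)"

definition algebra_automorphisms ::
    "('a, 'm) monoid_scheme \<Rightarrow> (('a \<Rightarrow> 'k::field) \<Rightarrow> 'a \<Rightarrow> 'k) set" where
  "algebra_automorphisms G =
     {f \<in> ring_iso (group_algebra G) (group_algebra G).
        \<forall>c. \<forall>x\<in>carrier (group_algebra G).
          f (c \<odot>\<^bsub>group_algebra G\<^esub> x) = c \<odot>\<^bsub>group_algebra G\<^esub> f x}"

text \<open>
  The algebra \<open>k[G] \<otimes> k[H]\<close> is \<open>k[G \<times> H]\<close>, with \<open>g \<otimes> h\<close> corresponding to the basis element \<open>(g, h)\<close>.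
\<close>

definition tensor :: "('a \<Rightarrow> 'k::field) \<Rightarrow> ('b \<Rightarrow> 'k) \<Rightarrow> 'a \<times> 'b \<Rightarrow> 'k" where
  "tensor x y = (\<lambda>(a, b). x a * y b)"

text \<open>The linear map \<open>f \<otimes> f'\<close> on \<open>k[G] \<otimes> k[H]\<close>, for linear maps \<open>f\<close> on \<open>k[G]\<close> and \<open>f'\<close> on \<open>k[H]\<close>.\<close>

definition tensor_map ::
    "('a, 'm) monoid_scheme \<Rightarrow> ('b, 'n) monoid_scheme \<Rightarrow> (('a \<Rightarrow> 'k::field) \<Rightarrow> 'c \<Rightarrow> 'k) \<Rightarrow>
     (('b \<Rightarrow> 'k) \<Rightarrow> 'd \<Rightarrow> 'k) \<Rightarrow> ('a \<times> 'b \<Rightarrow> 'k) \<Rightarrow> 'c \<times> 'd \<Rightarrow> 'k" where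
  "tensor_map G H f f' =
     lin_ext (G \<times>\<times> H) (\<lambda>(g, h). tensor (f (basis_elem g)) (f' (basis_elem h)))"

text \<open>The identification of \<open>(U \<otimes> V) \<otimes> W\<close> with \<open>U \<otimes> (V \<otimes> W)\<close>.\<close>

definition tensor_assoc :: "(('a \<times> 'b) \<times> 'c \<Rightarrow> 'k) \<Rightarrow> 'a \<times> 'b \<times> 'c \<Rightarrow> 'k" where
  "tensor_assoc u = (\<lambda>(a, b, c). u ((a, b), c))"

definition coproduct :: "('a, 'm) monoid_scheme \<Rightarrow> ('a \<Rightarrow> 'k::field) \<Rightarrow> 'a \<times> 'a \<Rightarrow> 'k" where
  "coproduct G = lin_ext G (\<lambda>g. tensor (basis_elem g) (basis_elem g))"

definition counit :: "('a, 'm) monoid_scheme \<Rightarrow> ('a \<Rightarrow> 'k::field) \<Rightarrow> 'k" where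
  "counit G x = (\<Sum>g\<in>carrier G. x g)"

text \<open>\<open>\<epsilon> \<otimes> I\<close> and \<open>I \<otimes> \<epsilon>\<close>, with values in \<open>k \<otimes> k[G] = k[G] = k[G] \<otimes> k\<close>.\<close>

definition counit_left :: "('a, 'm) monoid_scheme \<Rightarrow> ('a \<times> 'a \<Rightarrow> 'k::field) \<Rightarrow> 'a \<Rightarrow> 'k" where
  "counit_left G =
     lin_ext (G \<times>\<times> G) (\<lambda>(g, h). counit G (basis_elem g) \<odot>\<^bsub>group_algebra G\<^esub> basis_elem h)"

definition counit_right :: "('a, 'm) monoid_scheme \<Rightarrow> ('a \<times> 'a \<Rightarrow> 'k::field) \<Rightarrow> 'a \<Rightarrow> 'k" where
  "counit_right G =
     lin_ext (G \<times>\<times> G) (\<lambda>(g, h). counit G (basis_elem h) \<odot>\<^bsub>group_algebra G\<^esub> basis_elem g)"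

definition twisted_automorphism ::
    "('a, 'm) monoid_scheme \<Rightarrow> (('a \<Rightarrow> 'k::field) \<Rightarrow> 'a \<Rightarrow> 'k) \<Rightarrow> ('a \<times> 'a \<Rightarrow> 'k) \<Rightarrow> bool" where
  "twisted_automorphism G f F \<longleftrightarrow>
     f \<in> algebra_automorphisms G \<and>
     F \<in> Units (group_algebra (G \<times>\<times> G)) \<and>
     (\<forall>x\<in>carrier (group_algebra G).
        F \<otimes>\<^bsub>group_algebra (G \<times>\<times> G)\<^esub> coproduct G (f x) =
        tensor_map G G f f (coproduct G x) \<otimes>\<^bsub>group_algebra (G \<times>\<times> G)\<^esub> F) \<and>
     tensor_assoc
       (tensor F \<one>\<^bsub>group_algebra G\<^esub> \<otimes>\<^bsub>group_algebra ((G \<times>\<times> G) \<times>\<times> G)\<^esub>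
        tensor_map G G (coproduct G) id F) =
     tensor \<one>\<^bsub>group_algebra G\<^esub> F \<otimes>\<^bsub>group_algebra (G \<times>\<times> (G \<times>\<times> G))\<^esub>
        tensor_map G G id (coproduct G) F \<and>
     counit_left G F = \<one>\<^bsub>group_algebra G\<^esub> \<and>
     counit_right G F = \<one>\<^bsub>group_algebra G\<^esub>"

definition gauge_transformation ::
    "('a, 'm) monoid_scheme \<Rightarrow> ('a \<Rightarrow> 'k::field) \<Rightarrow>
     (('a \<Rightarrow> 'k) \<Rightarrow> 'a \<Rightarrow> 'k) \<Rightarrow> ('a \<times> 'a \<Rightarrow> 'k) \<Rightarrow>
     (('a \<Rightarrow> 'k) \<Rightarrow> 'a \<Rightarrow> 'k) \<Rightarrow> ('a \<times> 'a \<Rightarrow> 'k) \<Rightarrow> bool" where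
  "gauge_transformation G a f F f' F' \<longleftrightarrow>
     a \<in> Units (group_algebra G) \<and>
     counit G a = 1 \<and>
     (\<forall>x\<in>carrier (group_algebra G).
        f' x = a \<otimes>\<^bsub>group_algebra G\<^esub> f x \<otimes>\<^bsub>group_algebra G\<^esub> inv\<^bsub>group_algebra G\<^esub> a) \<and>
     F' \<otimes>\<^bsub>group_algebra (G \<times>\<times> G)\<^esub> coproduct G a =
       tensor a a \<otimes>\<^bsub>group_algebra (G \<times>\<times> G)\<^esub> F"

definition gauge_isomorphic ::
    "('a, 'm) monoid_scheme \<Rightarrow>
     (('a \<Rightarrow> 'k::field) \<Rightarrow> 'a \<Rightarrow> 'k) \<Rightarrow> ('a \<times> 'a \<Rightarrow> 'k) \<Rightarrow>
     (('a \<Rightarrow> 'k) \<Rightarrow> 'a \<Rightarrow> 'k) \<Rightarrow> ('a \<times> 'a \<Rightarrow> 'k) \<Rightarrow> bool" where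
  "gauge_isomorphic G f F f' F' \<longleftrightarrow>
     twisted_automorphism G f F \<and> twisted_automorphism G f' F' \<and>
     (\<exists>a. gauge_transformation G a f F f' F')"

definition induced_automorphism ::
    "('a, 'm) monoid_scheme \<Rightarrow> ('a \<Rightarrow> 'a) \<Rightarrow> ('a \<Rightarrow> 'k::field) \<Rightarrow> 'a \<Rightarrow> 'k" where
  "induced_automorphism G \<phi> = lin_ext G (\<lambda>g. basis_elem (\<phi> g))"

definition field_units :: "'k::field monoid" where
  "field_units = \<lparr>carrier = UNIV - {0}, monoid.mult = (*), one = 1\<rparr>"

definition character_group :: "('a, 'm) monoid_scheme \<Rightarrow> ('a \<Rightarrow> 'k::field) monoid" where
  "character_group S =
     \<lparr>carrier = hom S field_units \<inter> extensional (carrier S),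
      monoid.mult = (\<lambda>\<chi> \<psi>. \<lambda>s\<in>carrier S. \<chi> s * \<psi> s),
      one = (\<lambda>s\<in>carrier S. 1)\<rparr>"

definition bimultiplicative :: "('a, 'm) monoid_scheme \<Rightarrow> ('a \<Rightarrow> 'a \<Rightarrow> 'k::field) \<Rightarrow> bool" where
  "bimultiplicative S \<beta> \<longleftrightarrow>
     (\<forall>s\<in>carrier S. (\<lambda>t. \<beta> s t) \<in> hom S field_units) \<and>
     (\<forall>t\<in>carrier S. (\<lambda>s. \<beta> s t) \<in> hom S field_units)"

definition alternative_form :: "('a, 'm) monoid_scheme \<Rightarrow> ('a \<Rightarrow> 'a \<Rightarrow> 'k::field) \<Rightarrow> bool" where
  "alternative_form S \<beta> \<longleftrightarrow> bimultiplicative S \<beta> \<and> (\<forall>s\<in>carrier S. \<beta> s s = 1)"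

definition nondegenerate_form :: "('a, 'm) monoid_scheme \<Rightarrow> ('a \<Rightarrow> 'a \<Rightarrow> 'k::field) \<Rightarrow> bool" where
  "nondegenerate_form S \<beta> \<longleftrightarrow> (\<lambda>s. \<lambda>t\<in>carrier S. \<beta> s t) \<in> iso S (character_group S)"

definition invariant_form ::
    "('a, 'm) monoid_scheme \<Rightarrow> 'a set \<Rightarrow> ('a \<Rightarrow> 'a \<Rightarrow> 'k::field) \<Rightarrow> bool" where
  "invariant_form G S \<beta> \<longleftrightarrow>
     (\<forall>g\<in>carrier G. \<forall>s\<in>S. \<forall>t\<in>S.
        \<beta> (g \<otimes>\<^bsub>G\<^esub> s \<otimes>\<^bsub>G\<^esub> inv\<^bsub>G\<^esub> g) (g \<otimes>\<^bsub>G\<^esub> t \<otimes>\<^bsub>G\<^esub> inv\<^bsub>G\<^esub> g) = \<beta> s t)"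

definition form_twist :: "'a set \<Rightarrow> ('a \<Rightarrow> 'a \<Rightarrow> 'k::field) \<Rightarrow> 'a \<times> 'a \<Rightarrow> 'k" where
  "form_twist S \<beta> = (\<lambda>p. 1 / of_nat (card S) *
     (\<Sum>s\<in>S. \<Sum>t\<in>S. \<beta> s t * tensor (basis_elem s) (basis_elem t) p))"

definition normal_form_data ::
    "('a, 'm) monoid_scheme \<Rightarrow> ('a \<Rightarrow> 'a) \<Rightarrow> 'a set \<Rightarrow> ('a \<Rightarrow> 'a \<Rightarrow> 'k::field) \<Rightarrow> bool" where
  "normal_form_data G \<phi> S \<beta> \<longleftrightarrow>
     \<phi> \<in> iso G G \<and>
     S \<lhd> G \<and> comm_group (G\<lparr>carrier := S\<rparr>) \<and>
     bimultiplicative (G\<lparr>carrier := S\<rparr>) \<beta> \<and>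
     alternative_form (G\<lparr>carrier := S\<rparr>) \<beta> \<and>
     nondegenerate_form (G\<lparr>carrier := S\<rparr>) \<beta> \<and>
     invariant_form G S \<beta>"

text \<open>
  The subgroup and the form of a normal form are gauge invariants, but its automorphism is one only up
  to inner automorphisms of \<open>G\<close>: for \<open>g\<close> in \<open>G\<close>, the basis element \<open>g\<close> is a gauge transformation from
  the twisted automorphism given by \<open>(\<phi>, S, \<beta>)\<close> to that given by \<open>(g \<phi>(-) g\<^sup>-\<^sup>1, S, \<beta>)\<close>, since
  \<open>F \<Delta>(g) = (g \<otimes> g) F\<close> for \<open>F = form_twist S \<beta>\<close> with \<open>\<beta>\<close> invariant. Uniqueness of normal forms is
  therefore uniqueness of \<open>S\<close>, of \<open>\<beta>\<close> on \<open>S \<times> S\<close> and of the class of \<open>\<phi>\<close> modulo inner automorphisms.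
\<close>

end

theory Submission
  imports Defs
begin

text \<open>
  The pair \<open>(f, F)\<close> identifies the twisted coproduct \<open>F \<Delta> F\<^sup>-\<^sup>1\<close> with \<open>\<Delta>\<close>, so \<open>F\<^sub>2\<^sub>1 F\<^sup>-\<^sup>1\<close>, transported
  along \<open>f\<close>, is a triangular structure \<open>R = \<Sum>\<^sub>g g \<otimes> r\<^sub>g\<close> on the cocommutative Hopf algebra \<open>k[G]\<close>.
  The \<open>r\<^sub>g\<close> are orthogonal idempotents with sum 1. The \<open>g\<close> with \<open>r\<^sub>g \<noteq> 0\<close> form an abelian normal
  subgroup \<open>S\<close> whose elements act on each \<open>r\<^sub>h\<close> by scalars, and \<open>R\<close> is the twist of the resulting
  form on \<open>S\<close>. In particular \<open>R\<close> has odd order, hence \<open>R = P\<^sup>2\<close> for a power \<open>P\<close> of \<open>R\<close>. The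
  twist \<open>J = (f \<otimes> f)(P) F\<close> is then symmetric, and a symmetric twist is trivial: it makes the dual
  of \<open>k[G]\<close> a commutative algebra, and a character of this algebra, found here as a common
  eigenvector of commuting operators on \<open>k[G]\<close>, is an element \<open>a\<close> with \<open>\<Delta>(a) = (a \<otimes> a) J\<close>. The
  gauge transformation \<open>a\<close> turns \<open>f\<close> into an automorphism of Hopf algebras and \<open>F\<close> into a
  triangular structure. For uniqueness, a twist in normal form is a power of its own square
  \<open>F F\<^sub>2\<^sub>1\<^sup>-\<^sup>1\<close>, which a gauge transformation \<open>c\<close> conjugates by \<open>c \<otimes> c\<close>; hence \<open>\<Delta>(c) = c \<otimes> c\<close>, and \<open>c\<close>
  is an element of \<open>G\<close>.
\<close>

text \<open>A twisted automorphism is a monoidal structure on the autoequivalence of Rep(G) given by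
  pullback along f, and F_21 F^-1 is its defect from respecting the symmetry. A gauge transformation
  a changes this defect only by conjugation with a \<otimes> a, so the defect is split evenly: one
  half, P, is absorbed into F to make it symmetric; the other half survives as the normal form, the
  image of P^-1. For J and the image of P^-1 to be twists, the root P and its inverse have to be
  triangular themselves; a power of R has this property, and odd order makes a root of that kind
  available. Oddness returns twice: it settles the sign of \<gamma>(x,x), and it lets a normal form
  be recovered from its square. The other obstacle is that f commutes with leg embeddings but with
  coproducts only up to conjugation by F. Therefore the defect is taken back along f before it is
  analysed, and computations that mix f with \<Delta> carry factors F_12 or F_23.\<close>

abbreviation GA where "GA \<equiv> group_algebra"

section \<open>The group algebra of a finite group as a ring\<close>

locale finite_group = group G for G (structure) +
  assumes finite_carrier [simp, intro]: "finite (carrier G)"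

lemma finite_group_DirProd [intro]:
  assumes "finite_group G" "finite_group H"
  shows "finite_group (G \<times>\<times> H)"
proof -
  interpret G: finite_group G by fact
  interpret H: finite_group H by fact
  interpret group "G \<times>\<times> H" by (intro DirProd_group G.is_group H.is_group)
  show ?thesis by unfold_locales auto
qed

lemma group_algebra_carrier: "x \<in> carrier (GA G) \<longleftrightarrow> (\<forall>g. g \<notin> carrier G \<longrightarrow> x g = 0)"
  by (simp add: group_algebra_def)

lemma group_algebra_one: "\<one>\<^bsub>GA G\<^esub> = basis_elem \<one>\<^bsub>G\<^esub>"
  by (auto simp: group_algebra_def basis_elem_def)

lemma group_algebra_zero: "\<zero>\<^bsub>GA G\<^esub> = (\<lambda>g. 0)"
  by (simp add: group_algebra_def)

lemma group_algebra_add: "x \<oplus>\<^bsub>GA G\<^esub> y = (\<lambda>g. x g + y g)"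
  by (simp add: group_algebra_def)

lemma group_algebra_smult: "c \<odot>\<^bsub>GA G\<^esub> x = (\<lambda>g. c * x g)"
  by (simp add: group_algebra_def)

lemma basis_elem_eq_iff [simp]: "(basis_elem g :: 'a \<Rightarrow> 'k::field) = basis_elem h \<longleftrightarrow> g = h"
  by (auto simp: basis_elem_def fun_eq_iff split: if_splits)

lemma basis_elem_nonzero: "(basis_elem g :: 'a \<Rightarrow> 'k::field) \<noteq> (\<lambda>_. 0)"
proof
  assume "basis_elem g = (\<lambda>_. 0 :: 'k)"
  then have "basis_elem g g = (0 :: 'k)" by (rule fun_cong)
  then show False by (simp add: basis_elem_def)
qed

lemma basis_elem_in [simp, intro]: "g \<in> carrier G \<Longrightarrow> basis_elem g \<in> carrier (GA G)"
  by (auto simp: group_algebra_carrier basis_elem_def)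

lemma group_algebra_carrierD: "x \<in> carrier (GA G) \<Longrightarrow> g \<notin> carrier G \<Longrightarrow> x g = 0"
  by (simp add: group_algebra_carrier)

lemma group_algebra_eqI:
  assumes "x \<in> carrier (GA G)" "y \<in> carrier (GA G)" "\<And>g. g \<in> carrier G \<Longrightarrow> x g = y g"
  shows "x = y"
proof
  fix g show "x g = y g"
    using assms by (cases "g \<in> carrier G") (auto simp: group_algebra_carrier)
qed

lemma (in finite_group) mult_double_sum:
  "(x \<otimes>\<^bsub>GA G\<^esub> y) c =
     (\<Sum>h\<in>carrier G. \<Sum>h'\<in>carrier G. if h \<otimes> h' = c then x h * y h' else 0)"
proof -
  have "(x \<otimes>\<^bsub>GA G\<^esub> y) c = (\<Sum>(h, h')\<in>{p \<in> carrier G \<times> carrier G. fst p \<otimes> snd p = c}. x h * y h')"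
    unfolding group_algebra_def by (auto intro!: sum.cong)
  also have "\<dots> = (\<Sum>p\<in>carrier G \<times> carrier G. if fst p \<otimes> snd p = c then x (fst p) * y (snd p) else 0)"
    by (subst sum.inter_filter [symmetric]) (auto intro!: sum.cong)
  also have "\<dots> = (\<Sum>h\<in>carrier G. \<Sum>h'\<in>carrier G. if h \<otimes> h' = c then x h * y h' else 0)"
    by (simp add: sum.cartesian_product case_prod_beta)
  finally show ?thesis .
qed

lemma (in finite_group) mult_apply:
  assumes "c \<in> carrier G"
  shows "(x \<otimes>\<^bsub>GA G\<^esub> y) c = (\<Sum>h\<in>carrier G. x h * y (inv h \<otimes> c))"
  unfolding mult_double_sum
proof (intro sum.cong refl)
  fix h assume h: "h \<in> carrier G"
  have "(\<Sum>h'\<in>carrier G. if h \<otimes> h' = c then x h * y h' else 0) =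
     (\<Sum>h'\<in>carrier G. if h' = inv h \<otimes> c then x h * y h' else 0)"
    using h assms by (intro sum.cong) (auto simp: inv_solve_left)
  then show "(\<Sum>h'\<in>carrier G. if h \<otimes> h' = c then x h * y h' else 0) = x h * y (inv h \<otimes> c)"
    using h assms by (simp add: sum.delta)
qed

lemma (in finite_group) mult_outside:
  assumes "c \<notin> carrier G"
  shows "(x \<otimes>\<^bsub>GA G\<^esub> y) c = 0"
  unfolding mult_double_sum using assms by (auto intro!: sum.neutral)

text \<open>A linear functional on a product sees only the values
  \<open>\<phi> (h \<otimes> h')\<close>. With \<open>\<phi>\<close> testing one coefficient,
  associativity reduces to that of \<open>G\<close>; with \<open>\<phi>\<close> a coefficient of
  \<open>v\<close>, it gives multiplicativity of \<open>lin_ext G v\<close>.\<close>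

lemma (in finite_group) sum_mult:
  "(\<Sum>c\<in>carrier G. (x \<otimes>\<^bsub>GA G\<^esub> y) c * \<phi> c) =
     (\<Sum>h\<in>carrier G. \<Sum>h'\<in>carrier G. x h * y h' * \<phi> (h \<otimes> h'))"
proof -
  have "(\<Sum>c\<in>carrier G. (x \<otimes>\<^bsub>GA G\<^esub> y) c * \<phi> c) =
     (\<Sum>c\<in>carrier G. \<Sum>h\<in>carrier G. \<Sum>h'\<in>carrier G. if h \<otimes> h' = c then x h * y h' * \<phi> c else 0)"
    unfolding mult_double_sum sum_distrib_right by (auto intro!: sum.cong)
  also have "\<dots> = (\<Sum>h\<in>carrier G. \<Sum>c\<in>carrier G. \<Sum>h'\<in>carrier G. if h \<otimes> h' = c then x h * y h' * \<phi> c else 0)"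
    by (rule sum.swap)
  also have "\<dots> = (\<Sum>h\<in>carrier G. \<Sum>h'\<in>carrier G. \<Sum>c\<in>carrier G. if h \<otimes> h' = c then x h * y h' * \<phi> c else 0)"
    by (intro sum.cong refl sum.swap)
  also have "\<dots> = (\<Sum>h\<in>carrier G. \<Sum>h'\<in>carrier G. x h * y h' * \<phi> (h \<otimes> h'))"
    by (intro sum.cong refl) (simp add: sum.delta)
  finally show ?thesis .
qed

lemma (in finite_group) group_algebra_assoc:
  "(x \<otimes>\<^bsub>GA G\<^esub> y) \<otimes>\<^bsub>GA G\<^esub> z = x \<otimes>\<^bsub>GA G\<^esub> (y \<otimes>\<^bsub>GA G\<^esub> z)"
proof
  fix d
  have "((x \<otimes>\<^bsub>GA G\<^esub> y) \<otimes>\<^bsub>GA G\<^esub> z) d =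
      (\<Sum>c\<in>carrier G. (x \<otimes>\<^bsub>GA G\<^esub> y) c * (\<Sum>k\<in>carrier G. if c \<otimes> k = d then z k else 0))"
    by (subst mult_double_sum) (auto simp: sum_distrib_left intro!: sum.cong)
  also have "\<dots> = (\<Sum>h\<in>carrier G. \<Sum>h'\<in>carrier G. x h * y h' *
                   (\<Sum>k\<in>carrier G. if h \<otimes> h' \<otimes> k = d then z k else 0))"
    by (rule sum_mult)
  also have "\<dots> = (\<Sum>h\<in>carrier G. x h * (\<Sum>h'\<in>carrier G. \<Sum>k\<in>carrier G. y h' * z k *
                   (if h \<otimes> (h' \<otimes> k) = d then 1 else 0)))"
    by (auto simp: sum_distrib_left m_assoc intro!: sum.cong)
  also have "\<dots> = (\<Sum>h\<in>carrier G. x h * (\<Sum>c\<in>carrier G. (y \<otimes>\<^bsub>GA G\<^esub> z) c * (if h \<otimes> c = d then 1 else 0)))"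
    by (subst sum_mult) (rule refl)
  also have "\<dots> = (x \<otimes>\<^bsub>GA G\<^esub> (y \<otimes>\<^bsub>GA G\<^esub> z)) d"
    by (subst (2) mult_double_sum) (auto simp: sum_distrib_left intro!: sum.cong)
  finally show "((x \<otimes>\<^bsub>GA G\<^esub> y) \<otimes>\<^bsub>GA G\<^esub> z) d = (x \<otimes>\<^bsub>GA G\<^esub> (y \<otimes>\<^bsub>GA G\<^esub> z)) d" .
qed

lemma (in finite_group) basis_mult_left:
  assumes "g \<in> carrier G" "c \<in> carrier G"
  shows "(basis_elem g \<otimes>\<^bsub>GA G\<^esub> x) c = x (inv g \<otimes> c)"
proof -
  have "(basis_elem g \<otimes>\<^bsub>GA G\<^esub> x) c = (\<Sum>h\<in>carrier G. if h = g then x (inv h \<otimes> c) else 0)"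
    unfolding mult_apply [OF assms(2)] by (intro sum.cong) (auto simp: basis_elem_def)
  then show ?thesis using assms by (simp add: sum.delta)
qed

lemma (in finite_group) basis_mult_right:
  assumes "g \<in> carrier G" "c \<in> carrier G"
  shows "(x \<otimes>\<^bsub>GA G\<^esub> basis_elem g) c = x (c \<otimes> inv g)"
proof -
  have "(x \<otimes>\<^bsub>GA G\<^esub> basis_elem g) c = (\<Sum>h\<in>carrier G. if h = c \<otimes> inv g then x h else 0)"
    unfolding mult_apply [OF assms(2)] using assms
    by (intro sum.cong) (auto simp: basis_elem_def inv_solve_right inv_solve_left inv_solve_left' m_assoc)
  then show ?thesis using assms by (simp add: sum.delta)
qed

lemma (in finite_group) basis_mult_basis:
  assumes "g \<in> carrier G" "h \<in> carrier G"
  shows "basis_elem g \<otimes>\<^bsub>GA G\<^esub> basis_elem h = basis_elem (g \<otimes> h)"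
proof
  fix c show "(basis_elem g \<otimes>\<^bsub>GA G\<^esub> basis_elem h) c = (basis_elem (g \<otimes> h) c :: 'k::field)"
  proof (cases "c \<in> carrier G")
    case True
    then have "inv g \<otimes> c = h \<longleftrightarrow> c = g \<otimes> h"
      using assms by (metis inv_solve_left)
    then show ?thesis using assms True
      by (simp only: basis_mult_left) (simp add: basis_elem_def)
  next
    case False
    then show ?thesis using assms by (auto simp: mult_outside basis_elem_def)
  qed
qed

lemma (in finite_group) ring_group_algebra: "ring (GA G :: ('k::field, 'a \<Rightarrow> 'k) module)"
proof (rule ringI)
  show "abelian_group (GA G :: ('k, 'a \<Rightarrow> 'k) module)"
  proof (rule abelian_groupI)
    fix x :: "'a \<Rightarrow> 'k" assume "x \<in> carrier (GA G)"
    then show "\<exists>y\<in>carrier (GA G). y \<oplus>\<^bsub>GA G\<^esub> x = \<zero>\<^bsub>GA G\<^esub>"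
      by (intro bexI [of _ "\<lambda>g. - x g"])
         (auto simp: group_algebra_add group_algebra_zero group_algebra_carrier)
  qed (auto simp: group_algebra_add group_algebra_zero group_algebra_carrier algebra_simps)
  show "Group.monoid (GA G :: ('k, 'a \<Rightarrow> 'k) module)"
  proof (rule monoidI)
    fix x :: "'a \<Rightarrow> 'k" assume x: "x \<in> carrier (GA G)"
    show "\<one>\<^bsub>GA G\<^esub> \<otimes>\<^bsub>GA G\<^esub> x = x" "x \<otimes>\<^bsub>GA G\<^esub> \<one>\<^bsub>GA G\<^esub> = x"
      by (intro group_algebra_eqI [where G = G]; use x in
          \<open>auto simp: group_algebra_one basis_mult_left basis_mult_right group_algebra_carrier mult_outside\<close>)+
  qed (auto simp: group_algebra_assoc group_algebra_carrier mult_outside group_algebra_one basis_elem_def)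
qed (auto simp: group_algebra_add mult_double_sum algebra_simps sum.distrib [symmetric] if_distrib
          cong: if_cong intro!: sum.cong ext)

sublocale finite_group \<subseteq> A: ring "GA G :: ('k::field, 'a \<Rightarrow> 'k) module"
  by (rule ring_group_algebra)

lemma (in finite_group) smult_mult_left:
  "(\<lambda>g. c * x g) \<otimes>\<^bsub>GA G\<^esub> y = (\<lambda>g. c * (x \<otimes>\<^bsub>GA G\<^esub> y) g)"
  by (rule ext) (auto simp: mult_double_sum sum_distrib_left algebra_simps intro!: sum.cong)

lemma (in finite_group) smult_mult_right:
  "x \<otimes>\<^bsub>GA G\<^esub> (\<lambda>g. c * y g) = (\<lambda>g. c * (x \<otimes>\<^bsub>GA G\<^esub> y) g)"
  by (rule ext) (auto simp: mult_double_sum sum_distrib_left algebra_simps intro!: sum.cong)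

lemma (in finite_group) sum_mult_left:
  "(\<lambda>g. \<Sum>i\<in>I. x i g) \<otimes>\<^bsub>GA G\<^esub> y = (\<lambda>g. \<Sum>i\<in>I. (x i \<otimes>\<^bsub>GA G\<^esub> y) g)"
proof
  fix g show "((\<lambda>g. \<Sum>i\<in>I. x i g) \<otimes>\<^bsub>GA G\<^esub> y) g = (\<Sum>i\<in>I. (x i \<otimes>\<^bsub>GA G\<^esub> y) g)"
  proof (cases "g \<in> carrier G")
    case True
    then show ?thesis by (simp add: mult_apply sum_distrib_right sum.swap [of _ _ I])
  qed (simp add: mult_outside)
qed

lemma (in finite_group) sum_mult_right:
  "x \<otimes>\<^bsub>GA G\<^esub> (\<lambda>g. \<Sum>i\<in>I. y i g) = (\<lambda>g. \<Sum>i\<in>I. (x \<otimes>\<^bsub>GA G\<^esub> y i) g)"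
proof
  fix g show "(x \<otimes>\<^bsub>GA G\<^esub> (\<lambda>g. \<Sum>i\<in>I. y i g)) g = (\<Sum>i\<in>I. (x \<otimes>\<^bsub>GA G\<^esub> y i) g)"
  proof (cases "g \<in> carrier G")
    case True
    then show ?thesis by (simp add: mult_apply sum_distrib_left sum.swap [of _ _ I])
  qed (simp add: mult_outside)
qed

section \<open>Algebra homomorphisms\<close>

text \<open>The two groups may differ, so that coproducts and leg embeddings between tensor powers
  are treated on the same footing as \<open>f\<close>.\<close>

definition alg_hom ::
    "('a, 'm) monoid_scheme \<Rightarrow> ('b, 'n) monoid_scheme \<Rightarrow> (('a \<Rightarrow> 'k::field) \<Rightarrow> 'b \<Rightarrow> 'k) set" where
  "alg_hom G H = {f \<in> ring_hom (GA G) (GA H).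
     \<forall>c. \<forall>x\<in>carrier (GA G). f (\<lambda>g. c * x g) = (\<lambda>h. c * f x h)}"

lemma alg_hom_closed: "f \<in> alg_hom G H \<Longrightarrow> x \<in> carrier (GA G) \<Longrightarrow> f x \<in> carrier (GA H)"
  by (auto simp: alg_hom_def ring_hom_closed)

lemma alg_hom_mult:
  "f \<in> alg_hom G H \<Longrightarrow> x \<in> carrier (GA G) \<Longrightarrow> y \<in> carrier (GA G) \<Longrightarrow>
     f (x \<otimes>\<^bsub>GA G\<^esub> y) = f x \<otimes>\<^bsub>GA H\<^esub> f y"
  by (auto simp: alg_hom_def ring_hom_mult)

lemma alg_hom_one: "f \<in> alg_hom G H \<Longrightarrow> f \<one>\<^bsub>GA G\<^esub> = \<one>\<^bsub>GA H\<^esub>"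
  by (auto simp: alg_hom_def ring_hom_one)

lemma alg_hom_add:
  "f \<in> alg_hom G H \<Longrightarrow> x \<in> carrier (GA G) \<Longrightarrow> y \<in> carrier (GA G) \<Longrightarrow>
     f (\<lambda>g. x g + y g) = (\<lambda>h. f x h + f y h)"
  using ring_hom_add [of f "GA G" "GA H" x y] by (auto simp: alg_hom_def group_algebra_add)

lemma alg_hom_smult:
  "f \<in> alg_hom G H \<Longrightarrow> x \<in> carrier (GA G) \<Longrightarrow> f (\<lambda>g. c * x g) = (\<lambda>h. c * f x h)"
  by (auto simp: alg_hom_def)

lemma alg_hom_zero: "f \<in> alg_hom G H \<Longrightarrow> f (\<lambda>g. 0) = (\<lambda>h. 0)"
  using alg_hom_smult [of f G H "\<lambda>g. 0" 0] by (simp add: group_algebra_carrier)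

lemma alg_hom_sum:
  assumes "f \<in> alg_hom G H" "\<And>i. i \<in> I \<Longrightarrow> x i \<in> carrier (GA G)"
  shows "f (\<lambda>g. \<Sum>i\<in>I. x i g) = (\<lambda>h. \<Sum>i\<in>I. f (x i) h)"
  using assms(2)
proof (induction I rule: infinite_finite_induct)
  case (insert j I)
  then have "(\<lambda>g. \<Sum>i\<in>I. x i g) \<in> carrier (GA G)"
    by (auto simp: group_algebra_carrier intro!: sum.neutral)
  with insert show ?case by (simp add: alg_hom_add [OF assms(1)])
qed (auto simp: alg_hom_zero [OF assms(1)])

lemma (in finite_group) basis_expansion:
  assumes "x \<in> carrier (GA G)"
  shows "x = (\<lambda>h. \<Sum>g\<in>carrier G. x g * basis_elem g h)"
proof
  fix h
  have "(\<Sum>g\<in>carrier G. x g * basis_elem g h) = (\<Sum>g\<in>carrier G. if g = h then x g else 0)"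
    by (intro sum.cong) (auto simp: basis_elem_def)
  then show "x h = (\<Sum>g\<in>carrier G. x g * basis_elem g h)"
    using assms by (simp add: sum.delta group_algebra_carrier)
qed

lemma (in finite_group) alg_hom_eq_lin_ext:
  assumes "f \<in> alg_hom G H" "x \<in> carrier (GA G)"
  shows "f x = lin_ext G (\<lambda>g. f (basis_elem g)) x"
proof -
  have "f x = f (\<lambda>h. \<Sum>g\<in>carrier G. x g * basis_elem g h)"
    using basis_expansion [OF assms(2)] by simp
  also have "\<dots> = (\<lambda>h. \<Sum>g\<in>carrier G. f (\<lambda>h. x g * basis_elem g h) h)"
    by (intro alg_hom_sum [OF assms(1)]) (auto simp: group_algebra_carrier basis_elem_def)
  also have "\<dots> = lin_ext G (\<lambda>g. f (basis_elem g)) x"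
    unfolding lin_ext_def
    by (intro ext sum.cong refl) (simp add: alg_hom_smult [OF assms(1)])
  finally show ?thesis .
qed

text \<open>Group elements span the algebra. Identities that involve an arbitrary \<open>f\<close>
  are reduced in this way to a check on group elements.\<close>

lemma (in finite_group) alg_hom_eqI:
  assumes "f \<in> alg_hom G H" "f' \<in> alg_hom G H" "x \<in> carrier (GA G)"
    "\<And>g. g \<in> carrier G \<Longrightarrow> f (basis_elem g) = f' (basis_elem g)"
  shows "f x = f' x"
  unfolding alg_hom_eq_lin_ext [OF assms(1,3)] alg_hom_eq_lin_ext [OF assms(2,3)]
  using assms(4) by (simp add: lin_ext_def)

lemma lin_ext_basis:
  assumes "finite_group G" "g \<in> carrier G"
  shows "lin_ext G v (basis_elem g) = v g"
proof
  interpret finite_group G by fact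
  fix b
  have "lin_ext G v (basis_elem g) b = (\<Sum>h\<in>carrier G. if h = g then v h b else 0)"
    unfolding lin_ext_def by (intro sum.cong) (auto simp: basis_elem_def)
  then show "lin_ext G v (basis_elem g) b = v g b"
    using assms by (simp add: sum.delta)
qed

text \<open>The universal property of the group algebra, for values in another group
  algebra.\<close>

lemma lin_ext_alg_hom:
  fixes v :: "'a \<Rightarrow> 'b \<Rightarrow> 'k::field"
  assumes "finite_group G" "finite_group H"
    and "\<And>g. g \<in> carrier G \<Longrightarrow> v g \<in> carrier (GA H)"
    and "\<And>g h. g \<in> carrier G \<Longrightarrow> h \<in> carrier G \<Longrightarrow> v (g \<otimes>\<^bsub>G\<^esub> h) = v g \<otimes>\<^bsub>GA H\<^esub> v h"
    and "v \<one>\<^bsub>G\<^esub> = \<one>\<^bsub>GA H\<^esub>"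
  shows "lin_ext G v \<in> alg_hom G H"
proof -
  interpret G: finite_group G by fact
  interpret H: finite_group H by fact
  have "lin_ext G v \<in> ring_hom (GA G) (GA H)"
  proof (rule ring_hom_memI)
    fix x :: "'a \<Rightarrow> 'k" assume "x \<in> carrier (GA G)"
    then show "lin_ext G v x \<in> carrier (GA H)"
      using assms(3) by (auto simp: lin_ext_def group_algebra_carrier intro!: sum.neutral)
  next
    fix x y :: "'a \<Rightarrow> 'k" assume "x \<in> carrier (GA G)" "y \<in> carrier (GA G)"
    show "lin_ext G v (x \<otimes>\<^bsub>GA G\<^esub> y) = lin_ext G v x \<otimes>\<^bsub>GA H\<^esub> lin_ext G v y"
    proof
      fix b
      have "(lin_ext G v x \<otimes>\<^bsub>GA H\<^esub> lin_ext G v y) b =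
          (\<Sum>g\<in>carrier G. ((\<lambda>b. x g * v g b) \<otimes>\<^bsub>GA H\<^esub> lin_ext G v y) b)"
        unfolding lin_ext_def [of _ _ x] H.sum_mult_left ..
      also have "\<dots> = (\<Sum>g\<in>carrier G. \<Sum>h\<in>carrier G. ((\<lambda>b. x g * v g b) \<otimes>\<^bsub>GA H\<^esub> (\<lambda>b. y h * v h b)) b)"
        unfolding lin_ext_def [of _ _ y] H.sum_mult_right ..
      also have "\<dots> = (\<Sum>g\<in>carrier G. \<Sum>h\<in>carrier G. x g * y h * v (g \<otimes>\<^bsub>G\<^esub> h) b)"
        by (intro sum.cong refl) (simp add: H.smult_mult_left H.smult_mult_right assms(4))
      also have "\<dots> = lin_ext G v (x \<otimes>\<^bsub>GA G\<^esub> y) b"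
        unfolding lin_ext_def G.sum_mult ..
      finally show "lin_ext G v (x \<otimes>\<^bsub>GA G\<^esub> y) b = (lin_ext G v x \<otimes>\<^bsub>GA H\<^esub> lin_ext G v y) b" ..
    qed
  next
    fix x y :: "'a \<Rightarrow> 'k" assume "x \<in> carrier (GA G)" "y \<in> carrier (GA G)"
    show "lin_ext G v (x \<oplus>\<^bsub>GA G\<^esub> y) = lin_ext G v x \<oplus>\<^bsub>GA H\<^esub> lin_ext G v y"
      by (simp add: lin_ext_def group_algebra_add algebra_simps sum.distrib)
  next
    show "lin_ext G v \<one>\<^bsub>GA G\<^esub> = \<one>\<^bsub>GA H\<^esub>"
      using assms by (simp add: group_algebra_one lin_ext_basis)
  qed
  moreover have "lin_ext G v (\<lambda>g. c * x g) = (\<lambda>h. c * lin_ext G v x h)" for c x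
    by (simp add: lin_ext_def sum_distrib_left mult.assoc)
  ultimately show ?thesis by (simp add: alg_hom_def)
qed

lemma alg_hom_comp:
  assumes "f \<in> alg_hom G H" "f' \<in> alg_hom H K"
  shows "(\<lambda>x. f' (f x)) \<in> alg_hom G K"
proof -
  have "f' \<circ> f \<in> ring_hom (GA G) (GA K)"
    using assms by (intro ring_hom_trans) (auto simp: alg_hom_def)
  then show ?thesis using assms
    by (auto simp: alg_hom_def comp_def ring_hom_closed)
qed

lemma alg_hom_id: "(\<lambda>x. x) \<in> alg_hom G G"
  by (auto simp: alg_hom_def ring_hom_def)

text \<open>Turns a relation u D(x) = D'(x) u into the equality of two algebra homomorphisms, u D(-)
  u^-1 and D', which can then be verified on group elements.\<close>

lemma alg_hom_conj:
  fixes f :: "('a \<Rightarrow> 'k::field) \<Rightarrow> 'b \<Rightarrow> 'k"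
  assumes "finite_group H" "f \<in> alg_hom G H" "u \<in> Units (GA H)"
  shows "(\<lambda>x. u \<otimes>\<^bsub>GA H\<^esub> f x \<otimes>\<^bsub>GA H\<^esub> inv\<^bsub>GA H\<^esub> u) \<in> alg_hom G H"
proof -
  interpret H: finite_group H by fact
  note u = H.A.Units_closed [OF assms(3)] H.A.Units_inv_closed [OF assms(3)]
  have "(\<lambda>x. u \<otimes>\<^bsub>GA H\<^esub> f x \<otimes>\<^bsub>GA H\<^esub> inv\<^bsub>GA H\<^esub> u) \<in> ring_hom (GA G) (GA H)"
  proof (rule ring_hom_memI)
    fix x y :: "'a \<Rightarrow> 'k" assume xy: "x \<in> carrier (GA G)" "y \<in> carrier (GA G)"
    note fxy = xy [THEN alg_hom_closed [OF assms(2)]]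
    show "u \<otimes>\<^bsub>GA H\<^esub> f x \<otimes>\<^bsub>GA H\<^esub> inv\<^bsub>GA H\<^esub> u \<in> carrier (GA H)"
      using u fxy by simp
    have "u \<otimes>\<^bsub>GA H\<^esub> f x \<otimes>\<^bsub>GA H\<^esub> inv\<^bsub>GA H\<^esub> u \<otimes>\<^bsub>GA H\<^esub> (u \<otimes>\<^bsub>GA H\<^esub> f y \<otimes>\<^bsub>GA H\<^esub> inv\<^bsub>GA H\<^esub> u) =
      u \<otimes>\<^bsub>GA H\<^esub> f x \<otimes>\<^bsub>GA H\<^esub> (inv\<^bsub>GA H\<^esub> u \<otimes>\<^bsub>GA H\<^esub> u) \<otimes>\<^bsub>GA H\<^esub> f y \<otimes>\<^bsub>GA H\<^esub> inv\<^bsub>GA H\<^esub> u"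
      using u fxy by (simp only: H.A.m_assoc H.A.m_closed)
    then show "u \<otimes>\<^bsub>GA H\<^esub> f (x \<otimes>\<^bsub>GA G\<^esub> y) \<otimes>\<^bsub>GA H\<^esub> inv\<^bsub>GA H\<^esub> u =
      u \<otimes>\<^bsub>GA H\<^esub> f x \<otimes>\<^bsub>GA H\<^esub> inv\<^bsub>GA H\<^esub> u \<otimes>\<^bsub>GA H\<^esub> (u \<otimes>\<^bsub>GA H\<^esub> f y \<otimes>\<^bsub>GA H\<^esub> inv\<^bsub>GA H\<^esub> u)"
      using u fxy assms(3) by (simp add: alg_hom_mult [OF assms(2)] xy H.A.m_assoc)
    show "u \<otimes>\<^bsub>GA H\<^esub> f (x \<oplus>\<^bsub>GA G\<^esub> y) \<otimes>\<^bsub>GA H\<^esub> inv\<^bsub>GA H\<^esub> u =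
      u \<otimes>\<^bsub>GA H\<^esub> f x \<otimes>\<^bsub>GA H\<^esub> inv\<^bsub>GA H\<^esub> u \<oplus>\<^bsub>GA H\<^esub> u \<otimes>\<^bsub>GA H\<^esub> f y \<otimes>\<^bsub>GA H\<^esub> inv\<^bsub>GA H\<^esub> u"
      using u fxy assms(2) xy
      by (auto simp: alg_hom_def ring_hom_add H.A.r_distr H.A.l_distr)
  next
    show "u \<otimes>\<^bsub>GA H\<^esub> f \<one>\<^bsub>GA G\<^esub> \<otimes>\<^bsub>GA H\<^esub> inv\<^bsub>GA H\<^esub> u = \<one>\<^bsub>GA H\<^esub>"
      using u assms(3) by (simp add: alg_hom_one [OF assms(2)])
  qed
  then show ?thesis
    using assms(2) by (auto simp: alg_hom_def H.smult_mult_left H.smult_mult_right)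
qed

lemma alg_hom_Units:
  assumes "finite_group G" "finite_group H" "f \<in> alg_hom G H" "u \<in> Units (GA G)"
  shows "f u \<in> Units (GA H)" "f (inv\<^bsub>GA G\<^esub> u) = inv\<^bsub>GA H\<^esub> (f u)"
proof -
  interpret G: finite_group G by fact
  interpret H: finite_group H by fact
  note u = G.A.Units_closed [OF assms(4)] G.A.Units_inv_closed [OF assms(4)]
  have 1: "f u \<otimes>\<^bsub>GA H\<^esub> f (inv\<^bsub>GA G\<^esub> u) = \<one>\<^bsub>GA H\<^esub>" "f (inv\<^bsub>GA G\<^esub> u) \<otimes>\<^bsub>GA H\<^esub> f u = \<one>\<^bsub>GA H\<^esub>"
    using u assms(4) by (simp_all add: alg_hom_mult [OF assms(3), symmetric] alg_hom_one [OF assms(3)])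
  have 2: "f u \<in> carrier (GA H)" "f (inv\<^bsub>GA G\<^esub> u) \<in> carrier (GA H)"
    using u by (simp_all add: alg_hom_closed [OF assms(3)])
  show 3: "f u \<in> Units (GA H)"
    using 1 2 by (auto simp: Units_def)
  show "f (inv\<^bsub>GA G\<^esub> u) = inv\<^bsub>GA H\<^esub> (f u)"
    using H.A.inv_unique' [OF 2 1] by simp
qed

text \<open>Coproduct, counits, leg embeddings and permutations of tensor factors are all of this
  kind. Through \<open>pushforward_pushforward\<close>, an identity between composites of them
  becomes an equality of maps on group elements.\<close>

definition pushforward ::
    "('a, 'm) monoid_scheme \<Rightarrow> ('a \<Rightarrow> 'b) \<Rightarrow> ('a \<Rightarrow> 'k::field) \<Rightarrow> 'b \<Rightarrow> 'k" where
  "pushforward G \<phi> = lin_ext G (\<lambda>g. basis_elem (\<phi> g))"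

lemma pushforward_alg_hom:
  assumes "finite_group G" "finite_group H" "\<phi> \<in> hom G H"
  shows "pushforward G \<phi> \<in> alg_hom G H"
proof -
  interpret G: finite_group G by fact
  interpret H: finite_group H by fact
  interpret \<phi>: group_hom G H \<phi> by unfold_locales (rule assms(3))
  show ?thesis
    unfolding pushforward_def
    by (rule lin_ext_alg_hom [OF assms(1,2)])
       (auto simp: H.basis_mult_basis group_algebra_one)
qed

lemma pushforward_basis:
  "finite_group G \<Longrightarrow> g \<in> carrier G \<Longrightarrow> pushforward G \<phi> (basis_elem g) = basis_elem (\<phi> g)"
  by (simp add: pushforward_def lin_ext_basis)

lemma pushforward_cong:
  "(\<And>g. g \<in> carrier G \<Longrightarrow> \<phi> g = \<psi> g) \<Longrightarrow> pushforward G \<phi> x = pushforward G \<psi> x"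
  by (simp add: pushforward_def lin_ext_def)

lemma pushforward_apply:
  "pushforward G \<phi> x b = (\<Sum>g\<in>carrier G. if \<phi> g = b then x g else 0)"
  unfolding pushforward_def lin_ext_def by (intro sum.cong) (auto simp: basis_elem_def)

lemma pushforward_pushforward:
  assumes "finite_group H" "\<beta> \<in> carrier G \<rightarrow> carrier H"
  shows "pushforward H \<alpha> (pushforward G \<beta> x) = pushforward G (\<lambda>g. \<alpha> (\<beta> g)) x"
proof
  interpret finite_group H by fact
  fix b
  have "pushforward H \<alpha> (pushforward G \<beta> x) b =
     (\<Sum>h\<in>carrier H. \<Sum>g\<in>carrier G. if \<alpha> h = b \<and> \<beta> g = h then x g else 0)"
    unfolding pushforward_apply by (intro sum.cong) auto
  also have "\<dots> = (\<Sum>g\<in>carrier G. \<Sum>h\<in>carrier H. if h = \<beta> g then (if \<alpha> h = b then x g else 0) else 0)"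
    by (subst sum.swap) (auto intro!: sum.cong)
  also have "\<dots> = pushforward G (\<lambda>g. \<alpha> (\<beta> g)) x b"
    unfolding pushforward_apply using assms(2) by (intro sum.cong refl) (auto simp: sum.delta)
  finally show "pushforward H \<alpha> (pushforward G \<beta> x) b = pushforward G (\<lambda>g. \<alpha> (\<beta> g)) x b" .
qed

lemma pushforward_inj_apply:
  assumes "finite_group G" "inj_on \<phi> (carrier G)" "g \<in> carrier G"
  shows "pushforward G \<phi> x (\<phi> g) = x g"
proof -
  interpret finite_group G by fact
  have "pushforward G \<phi> x (\<phi> g) = (\<Sum>h\<in>carrier G. if h = g then x h else 0)"
    unfolding pushforward_apply using assms(2,3) by (intro sum.cong) (auto dest: inj_onD)
  then show ?thesis using assms(3) by simp
qed

lemma pushforward_outside: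
  "b \<notin> \<phi> ` carrier G \<Longrightarrow> pushforward G \<phi> x b = 0"
  unfolding pushforward_apply by (auto intro!: sum.neutral)

lemma (in finite_group) pushforward_id:
  assumes "x \<in> carrier (GA G)"
  shows "pushforward G (\<lambda>g. g) x = x"
proof
  fix b
  show "pushforward G (\<lambda>g. g) x b = x b"
    using pushforward_inj_apply [OF finite_group_axioms, of "\<lambda>g. g" b x]
      pushforward_outside [of b "\<lambda>g. g" G x] assms
    by (cases "b \<in> carrier G") (auto simp: group_algebra_carrier)
qed

section \<open>Tensor products\<close>

lemma tensor_apply [simp]: "tensor x y (a, b) = x a * y b"
  by (simp add: tensor_def)

lemma tensor_closed [simp, intro]:
  "x \<in> carrier (GA G) \<Longrightarrow> y \<in> carrier (GA H) \<Longrightarrow> tensor x y \<in> carrier (GA (G \<times>\<times> H))"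
  by (auto simp: group_algebra_carrier)

lemma tensor_basis: "tensor (basis_elem a) (basis_elem b) = basis_elem (a, b)"
  by (auto simp: basis_elem_def tensor_def)

lemma tensor_one: "tensor \<one>\<^bsub>GA G\<^esub> \<one>\<^bsub>GA H\<^esub> = \<one>\<^bsub>GA (G \<times>\<times> H)\<^esub>"
  by (simp add: group_algebra_one tensor_basis)

lemma tensor_mult:
  fixes x x' :: "'a \<Rightarrow> 'k::field" and y y' :: "'b \<Rightarrow> 'k"
  assumes "finite_group G" "finite_group H"
  shows "tensor x y \<otimes>\<^bsub>GA (G \<times>\<times> H)\<^esub> tensor x' y' = tensor (x \<otimes>\<^bsub>GA G\<^esub> x') (y \<otimes>\<^bsub>GA H\<^esub> y')"
proof
  interpret G: finite_group G by fact
  interpret H: finite_group H by fact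
  interpret GH: finite_group "G \<times>\<times> H" using assms by blast
  fix p :: "'a \<times> 'b"
  obtain a b where p: "p = (a, b)" by (cases p)
  show "(tensor x y \<otimes>\<^bsub>GA (G \<times>\<times> H)\<^esub> tensor x' y') p = tensor (x \<otimes>\<^bsub>GA G\<^esub> x') (y \<otimes>\<^bsub>GA H\<^esub> y') p"
  proof (cases "p \<in> carrier (G \<times>\<times> H)")
    case True
    then have ab: "a \<in> carrier G" "b \<in> carrier H" by (auto simp: p)
    have "(tensor x y \<otimes>\<^bsub>GA (G \<times>\<times> H)\<^esub> tensor x' y') p =
       (\<Sum>(g, h)\<in>carrier G \<times> carrier H. (x g * x' (inv\<^bsub>G\<^esub> g \<otimes>\<^bsub>G\<^esub> a)) * (y h * y' (inv\<^bsub>H\<^esub> h \<otimes>\<^bsub>H\<^esub> b)))"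
      unfolding GH.mult_apply [OF True]
      by (rule sum.cong) (auto simp: p inv_DirProd [OF G.is_group H.is_group])
    also have "\<dots> = tensor (x \<otimes>\<^bsub>GA G\<^esub> x') (y \<otimes>\<^bsub>GA H\<^esub> y') p"
      by (simp add: p G.mult_apply H.mult_apply ab sum_product sum.cartesian_product)
    finally show ?thesis .
  qed (auto simp: GH.mult_outside p G.mult_outside H.mult_outside)
qed

lemma tensor_map_alg_hom:
  assumes "finite_group G" "finite_group H" "finite_group G'" "finite_group H'"
    and "f \<in> alg_hom G G'" "f' \<in> alg_hom H H'"
  shows "tensor_map G H f f' \<in> alg_hom (G \<times>\<times> H) (G' \<times>\<times> H')"
proof -
  interpret G: finite_group G by fact
  interpret H: finite_group H by fact
  interpret G': finite_group G' by fact
  interpret H': finite_group H' by fact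
  show ?thesis
    unfolding tensor_map_def
  proof (rule lin_ext_alg_hom)
    show "(case \<one>\<^bsub>G \<times>\<times> H\<^esub> of (g, h) \<Rightarrow> tensor (f (basis_elem g)) (f' (basis_elem h))) = \<one>\<^bsub>GA (G' \<times>\<times> H')\<^esub>"
      using alg_hom_one [OF assms(5)] alg_hom_one [OF assms(6)]
      by (simp add: group_algebra_one tensor_basis)
  next
    fix p q assume "p \<in> carrier (G \<times>\<times> H)" "q \<in> carrier (G \<times>\<times> H)"
    then show "(case p \<otimes>\<^bsub>G \<times>\<times> H\<^esub> q of (g, h) \<Rightarrow> tensor (f (basis_elem g)) (f' (basis_elem h))) =
        (case p of (g, h) \<Rightarrow> tensor (f (basis_elem g)) (f' (basis_elem h))) \<otimes>\<^bsub>GA (G' \<times>\<times> H')\<^esub>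
        (case q of (g, h) \<Rightarrow> tensor (f (basis_elem g)) (f' (basis_elem h)))"
      by (auto simp: tensor_mult [OF assms(3,4)] alg_hom_mult [OF assms(5), symmetric]
          alg_hom_mult [OF assms(6), symmetric] G.basis_mult_basis H.basis_mult_basis)
  qed (use assms in \<open>auto simp: alg_hom_closed\<close>)
qed

lemma tensor_map_basis:
  assumes "finite_group G" "finite_group H" "g \<in> carrier G" "h \<in> carrier H"
  shows "tensor_map G H f f' (basis_elem (g, h)) = tensor (f (basis_elem g)) (f' (basis_elem h))"
  unfolding tensor_map_def
  by (subst lin_ext_basis) (use assms in auto)

lemma tensor_map_tensor:
  assumes "finite_group G" "finite_group H" "f \<in> alg_hom G G'" "f' \<in> alg_hom H H'"
    and "x \<in> carrier (GA G)" "y \<in> carrier (GA H)"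
  shows "tensor_map G H f f' (tensor x y) = tensor (f x) (f' y)"
proof -
  interpret G: finite_group G by fact
  interpret H: finite_group H by fact
  show ?thesis
    unfolding G.alg_hom_eq_lin_ext [OF assms(3,5)] H.alg_hom_eq_lin_ext [OF assms(4,6)]
    by (auto simp: tensor_map_def lin_ext_def sum_product sum.cartesian_product tensor_def
        intro!: sum.cong ext)
qed

lemma tensor_map_pushforward:
  assumes "finite_group G" "finite_group H"
  shows "tensor_map G H (pushforward G \<alpha>) (pushforward H \<beta>) x = pushforward (G \<times>\<times> H) (\<lambda>(g, h). (\<alpha> g, \<beta> h)) x"
  unfolding tensor_map_def lin_ext_def pushforward_def [of "G \<times>\<times> H"]
  by (intro ext sum.cong refl) (auto simp: pushforward_basis assms tensor_basis)

lemma coproduct_eq: "coproduct G = pushforward G (\<lambda>g. (g, g))"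
  by (simp add: coproduct_def pushforward_def tensor_basis)

lemma induced_automorphism_eq: "induced_automorphism G \<phi> = pushforward G \<phi>"
  by (simp add: induced_automorphism_def pushforward_def)

lemma (in finite_group) counit_basis [simp]: "g \<in> carrier G \<Longrightarrow> counit G (basis_elem g) = 1"
  by (simp add: counit_def basis_elem_def sum.delta)

lemma (in finite_group) counit_left_eq: "counit_left G = pushforward (G \<times>\<times> G) snd"
  unfolding counit_left_def pushforward_def lin_ext_def
  by (intro ext sum.cong refl) (auto simp: group_algebra_smult)

lemma (in finite_group) counit_right_eq: "counit_right G = pushforward (G \<times>\<times> G) fst"
  unfolding counit_right_def pushforward_def lin_ext_def
  by (intro ext sum.cong refl) (auto simp: group_algebra_smult)

lemma tensor_one_right:
  assumes "finite_group G" "group H" "x \<in> carrier (GA G)"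
  shows "tensor x \<one>\<^bsub>GA H\<^esub> = pushforward G (\<lambda>a. (a, \<one>\<^bsub>H\<^esub>)) x"
proof
  fix p :: "'a \<times> 'c"
  show "tensor x \<one>\<^bsub>GA H\<^esub> p = pushforward G (\<lambda>a. (a, \<one>\<^bsub>H\<^esub>)) x p"
  proof (cases "p \<in> (\<lambda>a. (a, \<one>\<^bsub>H\<^esub>)) ` carrier G")
    case True
    then obtain a where "a \<in> carrier G" "p = (a, \<one>\<^bsub>H\<^esub>)" by blast
    then show ?thesis
      using pushforward_inj_apply [OF assms(1), of "\<lambda>a. (a, \<one>\<^bsub>H\<^esub>)" a x]
      by (simp add: inj_on_def group_algebra_one basis_elem_def)
  next
    case False
    then show ?thesis using assms
      by (cases p) (auto simp: pushforward_outside group_algebra_one basis_elem_def group_algebra_carrier)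
  qed
qed

lemma tensor_one_left:
  assumes "finite_group G" "group H" "x \<in> carrier (GA G)"
  shows "tensor \<one>\<^bsub>GA H\<^esub> x = pushforward G (\<lambda>a. (\<one>\<^bsub>H\<^esub>, a)) x"
proof
  fix p :: "'c \<times> 'a"
  show "tensor \<one>\<^bsub>GA H\<^esub> x p = pushforward G (\<lambda>a. (\<one>\<^bsub>H\<^esub>, a)) x p"
  proof (cases "p \<in> (\<lambda>a. (\<one>\<^bsub>H\<^esub>, a)) ` carrier G")
    case True
    then obtain a where "a \<in> carrier G" "p = (\<one>\<^bsub>H\<^esub>, a)" by blast
    then show ?thesis
      using pushforward_inj_apply [OF assms(1), of "\<lambda>a. (\<one>\<^bsub>H\<^esub>, a)" a x]
      by (simp add: inj_on_def group_algebra_one basis_elem_def)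
  next
    case False
    then show ?thesis using assms
      by (cases p) (auto simp: pushforward_outside group_algebra_one basis_elem_def group_algebra_carrier)
  qed
qed

lemma pushforward_swap_tensor:
  assumes "finite_group G" "finite_group H" "x \<in> carrier (GA G)" "y \<in> carrier (GA H)"
  shows "pushforward (G \<times>\<times> H) (\<lambda>(a, b). (b, a)) (tensor x y) = tensor y x"
proof (rule group_algebra_eqI [where G = "H \<times>\<times> G"])
  have GH: "finite_group (G \<times>\<times> H)" "finite_group (H \<times>\<times> G)" using assms by auto
  show "pushforward (G \<times>\<times> H) (\<lambda>(a, b). (b, a)) (tensor x y) \<in> carrier (GA (H \<times>\<times> G))"
    by (rule alg_hom_closed [OF pushforward_alg_hom [OF GH]]) (use assms in \<open>auto simp: hom_def\<close>)
  fix p assume "p \<in> carrier (H \<times>\<times> G)"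
  then obtain a b where "p = (b, a)" "a \<in> carrier G" "b \<in> carrier H" by auto
  then show "pushforward (G \<times>\<times> H) (\<lambda>(a, b). (b, a)) (tensor x y) p = tensor y x p"
    using pushforward_inj_apply [OF GH(1), of "\<lambda>(a, b). (b, a)" "(a, b)" "tensor x y"]
    by (auto simp: inj_on_def)
qed (use assms in auto)

lemma tensor_assoc_eq:
  assumes "finite_group G" "finite_group H" "finite_group K" "x \<in> carrier (GA ((G \<times>\<times> H) \<times>\<times> K))"
  shows "tensor_assoc x = pushforward ((G \<times>\<times> H) \<times>\<times> K) (\<lambda>((a, b), c). (a, b, c)) x"
proof (rule group_algebra_eqI [where G = "G \<times>\<times> (H \<times>\<times> K)"])
  have GH: "finite_group ((G \<times>\<times> H) \<times>\<times> K)" "finite_group (G \<times>\<times> (H \<times>\<times> K))" using assms by auto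
  show "pushforward ((G \<times>\<times> H) \<times>\<times> K) (\<lambda>((a, b), c). (a, b, c)) x \<in> carrier (GA (G \<times>\<times> (H \<times>\<times> K)))"
    by (rule alg_hom_closed [OF pushforward_alg_hom [OF GH]]) (use assms in \<open>auto simp: hom_def\<close>)
  show "tensor_assoc x \<in> carrier (GA (G \<times>\<times> (H \<times>\<times> K)))"
    using assms(4) by (auto simp: group_algebra_carrier tensor_assoc_def)
  fix p assume "p \<in> carrier (G \<times>\<times> (H \<times>\<times> K))"
  then obtain a b c where "p = (a, b, c)" "a \<in> carrier G" "b \<in> carrier H" "c \<in> carrier K" by auto
  then show "tensor_assoc x p = pushforward ((G \<times>\<times> H) \<times>\<times> K) (\<lambda>((a, b), c). (a, b, c)) x p"
    using pushforward_inj_apply [OF GH(1), of "\<lambda>((a, b), c). (a, b, c)" "((a, b), c)" x]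
    by (auto simp: inj_on_def tensor_assoc_def)
qed

section \<open>Leg notation in the tensor powers of the group algebra\<close>

locale finite_group_powers = finite_group G +
  G2: finite_group "G \<times>\<times> G" + G3: finite_group "G \<times>\<times> (G \<times>\<times> G)" +
  G3': finite_group "(G \<times>\<times> G) \<times>\<times> G"
  for G (structure)
begin

lemmas fg =
  finite_group_axioms G2.finite_group_axioms G3.finite_group_axioms G3'.finite_group_axioms

abbreviation "GG \<equiv> G \<times>\<times> G"
abbreviation "GGG \<equiv> G \<times>\<times> (G \<times>\<times> G)"
abbreviation kG2 :: "('k::field, 'a \<times> 'a \<Rightarrow> 'k) module" where
  "kG2 \<equiv> group_algebra (G \<times>\<times> G)"
abbreviation kG3 :: "('k::field, 'a \<times> 'a \<times> 'a \<Rightarrow> 'k) module" where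
  "kG3 \<equiv> group_algebra (G \<times>\<times> (G \<times>\<times> G))"
abbreviation mult1 :: "('a \<Rightarrow> 'k::field) \<Rightarrow> ('a \<Rightarrow> 'k) \<Rightarrow> 'a \<Rightarrow> 'k" (infixl \<open>\<star>\<close> 70) where
  "x \<star> y \<equiv> x \<otimes>\<^bsub>group_algebra G\<^esub> y"
abbreviation mult2 :: "('a \<times> 'a \<Rightarrow> 'k::field) \<Rightarrow> ('a \<times> 'a \<Rightarrow> 'k) \<Rightarrow> 'a \<times> 'a \<Rightarrow> 'k" (infixl \<open>\<star>\<^sub>2\<close> 70) where
  "x \<star>\<^sub>2 y \<equiv> x \<otimes>\<^bsub>group_algebra (G \<times>\<times> G)\<^esub> y"
abbreviation mult3 :: "('a \<times> 'a \<times> 'a \<Rightarrow> 'k::field) \<Rightarrow> ('a \<times> 'a \<times> 'a \<Rightarrow> 'k) \<Rightarrow> 'a \<times> 'a \<times> 'a \<Rightarrow> 'k" (infixl \<open>\<star>\<^sub>3\<close> 70) where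
  "x \<star>\<^sub>3 y \<equiv> x \<otimes>\<^bsub>group_algebra (G \<times>\<times> (G \<times>\<times> G))\<^esub> y"

text \<open>The elements F_12, F_13, F_23, (\<Delta> \<otimes> I)(F), (I \<otimes> \<Delta>)(F) and
  F_21 of the usual notation, the first five in the right-bracketed cube.\<close>

definition embed12 :: "('a \<times> 'a \<Rightarrow> 'k::field) \<Rightarrow> 'a \<times> 'a \<times> 'a \<Rightarrow> 'k" where
  "embed12 = pushforward GG (\<lambda>(a, b). (a, b, \<one>))"
definition embed13 :: "('a \<times> 'a \<Rightarrow> 'k::field) \<Rightarrow> 'a \<times> 'a \<times> 'a \<Rightarrow> 'k" where
  "embed13 = pushforward GG (\<lambda>(a, b). (a, \<one>, b))"
definition embed23 :: "('a \<times> 'a \<Rightarrow> 'k::field) \<Rightarrow> 'a \<times> 'a \<times> 'a \<Rightarrow> 'k" where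
  "embed23 = pushforward GG (\<lambda>(a, b). (\<one>, a, b))"
definition coproduct1 :: "('a \<times> 'a \<Rightarrow> 'k::field) \<Rightarrow> 'a \<times> 'a \<times> 'a \<Rightarrow> 'k" where
  "coproduct1 = pushforward GG (\<lambda>(a, b). (a, a, b))"
definition coproduct2 :: "('a \<times> 'a \<Rightarrow> 'k::field) \<Rightarrow> 'a \<times> 'a \<times> 'a \<Rightarrow> 'k" where
  "coproduct2 = pushforward GG (\<lambda>(a, b). (a, b, b))"
definition flip :: "('a \<times> 'a \<Rightarrow> 'k::field) \<Rightarrow> 'a \<times> 'a \<Rightarrow> 'k" where
  "flip = pushforward GG (\<lambda>(a, b). (b, a))"

definition twist_cocycle :: "('a \<times> 'a \<Rightarrow> 'k::field) \<Rightarrow> bool" where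
  "twist_cocycle F \<longleftrightarrow>
     embed12 F \<star>\<^sub>3 coproduct1 F =
     embed23 F \<star>\<^sub>3 coproduct2 F"

lemmas leg_defs = embed12_def embed13_def embed23_def coproduct1_def coproduct2_def flip_def

lemma leg_alg_hom:
  "embed12 \<in> alg_hom GG GGG"
  "embed13 \<in> alg_hom GG GGG"
  "embed23 \<in> alg_hom GG GGG"
  "coproduct1 \<in> alg_hom GG GGG"
  "coproduct2 \<in> alg_hom GG GGG"
  "flip \<in> alg_hom GG GG"
  "coproduct G \<in> alg_hom G GG"
  unfolding leg_defs coproduct_eq
  by (rule pushforward_alg_hom;
      auto intro: fg(2,3,1) simp: hom_def)+

lemmas leg_closed [simp, intro] = leg_alg_hom [THEN alg_hom_closed]
lemmas leg_mult = leg_alg_hom [THEN alg_hom_mult]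
lemmas leg_one [simp] = leg_alg_hom [THEN alg_hom_one]

lemma leg_Units [simp, intro]:
  "u \<in> Units kG2 \<Longrightarrow> embed12 u \<in> Units kG3"
  "u \<in> Units kG2 \<Longrightarrow> embed13 u \<in> Units kG3"
  "u \<in> Units kG2 \<Longrightarrow> embed23 u \<in> Units kG3"
  "u \<in> Units kG2 \<Longrightarrow> coproduct1 u \<in> Units kG3"
  "u \<in> Units kG2 \<Longrightarrow> coproduct2 u \<in> Units kG3"
  "u \<in> Units kG2 \<Longrightarrow> flip u \<in> Units kG2"
  "v \<in> Units (GA G) \<Longrightarrow> coproduct G v \<in> Units kG2"
  using leg_alg_hom [THEN alg_hom_Units(1) [rotated 2]]
    fg(2,3,1) by blast+

lemmas leg_inv =
  leg_alg_hom(1-5) [THEN alg_hom_Units(2) [OF fg(2,3)]]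
  leg_alg_hom(6) [THEN alg_hom_Units(2) [OF fg(2,2)]]
  leg_alg_hom(7) [THEN alg_hom_Units(2) [OF fg(1,2)]]

text \<open>Bridges the literal cocycle condition, which multiplies in the left-bracketed cube
  before reassociating, and leg notation. Reassociation is itself an algebra homomorphism and so
  passes through the product.\<close>

lemma cocycle_condition_eq:
  fixes F :: "'a \<times> 'a \<Rightarrow> 'k::field"
  assumes F: "F \<in> carrier kG2"
  shows "tensor_assoc (tensor F \<one>\<^bsub>GA G\<^esub> \<otimes>\<^bsub>GA (GG \<times>\<times> G)\<^esub> tensor_map G G (coproduct G) id F) =
     embed12 F \<star>\<^sub>3 coproduct1 F" (is ?left)
    and "tensor \<one>\<^bsub>GA G\<^esub> F \<star>\<^sub>3 tensor_map G G id (coproduct G) F =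
     embed23 F \<star>\<^sub>3 coproduct2 F" (is ?right)
proof -
  define as where "as = (pushforward (GG \<times>\<times> G) (\<lambda>((a, b), c). (a, b, c)) :: (_ \<Rightarrow> 'k) \<Rightarrow> _)"
  have as: "as \<in> alg_hom (GG \<times>\<times> G) GGG"
    unfolding as_def by (rule pushforward_alg_hom [OF fg(4,3)]) (auto simp: hom_def)
  have id: "tensor_map G G (coproduct G) id F = tensor_map G G (pushforward G (\<lambda>g. (g, g))) (pushforward G (\<lambda>g. g)) F"
    "tensor_map G G id (coproduct G) F = tensor_map G G (pushforward G (\<lambda>g. g)) (pushforward G (\<lambda>g. (g, g))) F"
    unfolding tensor_map_def lin_ext_def coproduct_eq
    by (intro ext sum.cong refl; auto simp: pushforward_id)+
  have 1: "tensor F \<one>\<^bsub>GA G\<^esub> = pushforward GG (\<lambda>p. (p, \<one>)) F"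
    by (rule tensor_one_right [OF fg(2) is_group F])
  have 2: "tensor_map G G (coproduct G) id F = pushforward GG (\<lambda>(a, b). ((a, a), b)) F"
    unfolding id by (rule tensor_map_pushforward [OF fg(1,1)])
  have 12: "pushforward GG (\<lambda>p. (p, \<one>)) F \<in> carrier (GA (GG \<times>\<times> G))"
    "pushforward GG (\<lambda>(a, b). ((a, a), b)) F \<in> carrier (GA (GG \<times>\<times> G))"
    by (rule alg_hom_closed [OF pushforward_alg_hom [OF fg(2,4)] F]; auto simp: hom_def)+
  show ?left
    unfolding 1 2
    apply (subst tensor_assoc_eq [OF fg(1,1,1)])
    subgoal using 12 by simp
    apply (subst as_def [symmetric])
    apply (subst alg_hom_mult [OF as 12])
    unfolding as_def leg_defs
    by (subst (1 2) pushforward_pushforward [OF fg(4)]; auto simp: case_prod_beta')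
  have 3: "tensor \<one>\<^bsub>GA G\<^esub> F = embed23 F"
    unfolding embed23_def by (subst tensor_one_left [OF fg(2) is_group F]) (auto intro: pushforward_cong)
  have 4: "tensor_map G G id (coproduct G) F = coproduct2 F"
    unfolding id coproduct2_def by (rule tensor_map_pushforward [OF fg(1,1)])
  show ?right unfolding 3 4 ..
qed

end

lemma (in finite_group) finite_group_powers: "finite_group_powers G"
proof -
  have *: "finite_group G" by (rule finite_group_axioms)
  have "finite_group (G \<times>\<times> G)" "finite_group (G \<times>\<times> (G \<times>\<times> G))" "finite_group ((G \<times>\<times> G) \<times>\<times> G)"
    using * by auto
  with * show ?thesis by (simp add: finite_group_powers_def)
qed

text \<open>Commutation read off coefficient by coefficient. For g \<otimes> g it becomes invariance
  of the coefficients of \<open>R\<close> under simultaneous conjugation of both legs.\<close>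

lemma (in finite_group) commutes_basis_iff:
  assumes "g \<in> carrier G"
  shows "basis_elem g \<otimes>\<^bsub>GA G\<^esub> x = x \<otimes>\<^bsub>GA G\<^esub> basis_elem g \<longleftrightarrow>
    (\<forall>c\<in>carrier G. x (inv g \<otimes> c) = x (c \<otimes> inv g))"
proof
  assume "\<forall>c\<in>carrier G. x (inv g \<otimes> c) = x (c \<otimes> inv g)"
  then show "basis_elem g \<otimes>\<^bsub>GA G\<^esub> x = x \<otimes>\<^bsub>GA G\<^esub> basis_elem g"
    by (intro group_algebra_eqI [where G = G])
       (auto simp: basis_mult_left basis_mult_right assms group_algebra_carrier mult_outside)
next
  assume *: "basis_elem g \<otimes>\<^bsub>GA G\<^esub> x = x \<otimes>\<^bsub>GA G\<^esub> basis_elem g"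
  show "\<forall>c\<in>carrier G. x (inv g \<otimes> c) = x (c \<otimes> inv g)"
    using fun_cong [OF *] assms by (metis basis_mult_left basis_mult_right)
qed

lemma inv_mult_Units:
  assumes "Group.monoid M" "x \<in> Units M" "y \<in> Units M"
  shows "inv\<^bsub>M\<^esub> (x \<otimes>\<^bsub>M\<^esub> y) = inv\<^bsub>M\<^esub> y \<otimes>\<^bsub>M\<^esub> inv\<^bsub>M\<^esub> x"
proof -
  interpret monoid M by fact
  have "x \<otimes>\<^bsub>M\<^esub> y \<otimes>\<^bsub>M\<^esub> (inv\<^bsub>M\<^esub> y \<otimes>\<^bsub>M\<^esub> inv\<^bsub>M\<^esub> x) = x \<otimes>\<^bsub>M\<^esub> (y \<otimes>\<^bsub>M\<^esub> inv\<^bsub>M\<^esub> y) \<otimes>\<^bsub>M\<^esub> inv\<^bsub>M\<^esub> x"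
    "inv\<^bsub>M\<^esub> y \<otimes>\<^bsub>M\<^esub> inv\<^bsub>M\<^esub> x \<otimes>\<^bsub>M\<^esub> (x \<otimes>\<^bsub>M\<^esub> y) = inv\<^bsub>M\<^esub> y \<otimes>\<^bsub>M\<^esub> (inv\<^bsub>M\<^esub> x \<otimes>\<^bsub>M\<^esub> x) \<otimes>\<^bsub>M\<^esub> y"
    using assms by (simp_all only: m_assoc Units_closed Units_inv_closed m_closed)
  then show ?thesis
    using assms by (intro inv_unique' [symmetric]) (auto simp: Units_closed)
qed

lemma pushforward_left_inverse_apply:
  assumes "finite_group G" "x \<in> carrier (GA G)" "\<And>g. g \<in> carrier G \<Longrightarrow> \<psi> (\<phi> g) = g"
  shows "pushforward G \<phi> x b = (if \<phi> (\<psi> b) = b then x (\<psi> b) else 0)"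
proof (cases "b \<in> \<phi> ` carrier G")
  case True
  then obtain g where g: "g \<in> carrier G" "b = \<phi> g" by blast
  have "inj_on \<phi> (carrier G)" using assms(3) by (metis inj_onI)
  from pushforward_inj_apply [OF assms(1) this g(1)] g assms(3) show ?thesis by simp
next
  case False
  moreover from False have "\<phi> (\<psi> b) = b \<Longrightarrow> \<psi> b \<notin> carrier G" by (metis imageI)
  ultimately show ?thesis using assms(2) by (auto simp: pushforward_outside group_algebra_carrier)
qed

lemma alg_hom_pow:
  assumes "finite_group G" "finite_group H" "f \<in> alg_hom G H" "x \<in> carrier (GA G)"
  shows "f (x [^]\<^bsub>GA G\<^esub> (n::nat)) = f x [^]\<^bsub>GA H\<^esub> n"
proof -
  interpret G: finite_group G by fact
  interpret H: finite_group H by fact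
  show ?thesis
    using assms(3,4) by (induction n) (simp_all add: alg_hom_one alg_hom_mult)
qed

context finite_group_powers
begin

lemma coproduct_apply:
  "x \<in> carrier (GA G) \<Longrightarrow> coproduct G x (a, b) = (if a = b then x a else 0)"
  unfolding coproduct_eq
  by (subst pushforward_left_inverse_apply [OF fg(1), where \<psi> = fst]) auto

lemma leg_apply:
  assumes F: "F \<in> carrier kG2"
  shows "embed12 F (a, b, c) = (if c = \<one> then F (a, b) else 0)"
    and "embed13 F (a, b, c) = (if b = \<one> then F (a, c) else 0)"
    and "embed23 F (a, b, c) = (if a = \<one> then F (b, c) else 0)"
    and "coproduct1 F (a, b, c) = (if a = b then F (b, c) else 0)"
    and "coproduct2 F (a, b, c) = (if b = c then F (a, b) else 0)"
    and "flip F (a, b) = F (b, a)"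
proof -
  note p = pushforward_left_inverse_apply [OF fg(2) F]
  show "embed12 F (a, b, c) = (if c = \<one> then F (a, b) else 0)"
    unfolding leg_defs by (subst p [where \<psi> = "\<lambda>(a, b, c). (a, b)"]) auto
  show "embed13 F (a, b, c) = (if b = \<one> then F (a, c) else 0)"
    unfolding leg_defs by (subst p [where \<psi> = "\<lambda>(a, b, c). (a, c)"]) auto
  show "embed23 F (a, b, c) = (if a = \<one> then F (b, c) else 0)"
    unfolding leg_defs by (subst p [where \<psi> = "\<lambda>(a, b, c). (b, c)"]) auto
  show "coproduct1 F (a, b, c) = (if a = b then F (b, c) else 0)"
    unfolding leg_defs by (subst p [where \<psi> = "\<lambda>(a, b, c). (b, c)"]) auto
  show "coproduct2 F (a, b, c) = (if b = c then F (a, b) else 0)"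
    unfolding leg_defs by (subst p [where \<psi> = "\<lambda>(a, b, c). (a, b)"]) auto
  show "flip F (a, b) = F (b, a)"
    unfolding leg_defs by (subst p [where \<psi> = "\<lambda>(a, b). (b, a)"]) auto
qed

lemma pushforward_leg:
  "pushforward GGG \<pi> (embed12 F) = pushforward GG (\<lambda>(a, b). \<pi> (a, b, \<one>)) F"
  "pushforward GGG \<pi> (embed13 F) = pushforward GG (\<lambda>(a, b). \<pi> (a, \<one>, b)) F"
  "pushforward GGG \<pi> (embed23 F) = pushforward GG (\<lambda>(a, b). \<pi> (\<one>, a, b)) F"
  "pushforward GGG \<pi> (coproduct1 F) = pushforward GG (\<lambda>(a, b). \<pi> (a, a, b)) F"
  "pushforward GGG \<pi> (coproduct2 F) = pushforward GG (\<lambda>(a, b). \<pi> (a, b, b)) F"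
  "pushforward GG \<rho> (flip F) = pushforward GG (\<lambda>(a, b). \<rho> (b, a)) F"
  unfolding leg_defs
  by (subst pushforward_pushforward [OF fg(3)]
        pushforward_pushforward [OF fg(2)];
      force intro!: pushforward_cong)+

definition permute3 ::
    "('a \<times> 'a \<times> 'a \<Rightarrow> 'a \<times> 'a \<times> 'a) \<Rightarrow> ('a \<times> 'a \<times> 'a \<Rightarrow> 'k::field) \<Rightarrow> 'a \<times> 'a \<times> 'a \<Rightarrow> 'k" where
  "permute3 \<pi> = pushforward GGG \<pi>"

abbreviation "rotate_right \<equiv> \<lambda>(a::'a, b::'a, c::'a). (c, a, b)"
abbreviation "rotate_left \<equiv> \<lambda>(a::'a, b::'a, c::'a). (b, c, a)"
abbreviation "swap12 \<equiv> \<lambda>(a::'a, b::'a, c::'a). (b, a, c)"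
abbreviation "swap23 \<equiv> \<lambda>(a::'a, b::'a, c::'a). (a, c, b)"

lemma permute3_alg_hom:
  "permute3 rotate_right \<in> alg_hom GGG GGG"
  "permute3 rotate_left \<in> alg_hom GGG GGG"
  "permute3 swap12 \<in> alg_hom GGG GGG"
  "permute3 swap23 \<in> alg_hom GGG GGG"
  unfolding permute3_def
  by (rule pushforward_alg_hom [OF fg(3,3)]; auto simp: hom_def)+

lemmas permute3_mult = permute3_alg_hom [THEN alg_hom_mult]

lemma pushforward_coproduct:
  "pushforward GG \<rho> (coproduct G x) = pushforward G (\<lambda>g. \<rho> (g, g)) x"
  unfolding coproduct_eq by (subst pushforward_pushforward [OF fg(2)]) auto

text \<open>In the rule for \<open>rotate_left\<close> on \<open>coproduct1\<close> both sides are F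
  with \<Delta> placed in legs 1 and 3, an element without a name of its own. They agree because the
  first two legs of (\<Delta> \<otimes> I)(F) coincide on group elements.\<close>

lemma permute3_leg:
  "permute3 rotate_right (embed13 F) = embed12 (flip F)"
  "permute3 rotate_right (embed23 F) = embed13 (flip F)"
  "permute3 rotate_right (coproduct1 (flip F)) = coproduct2 F"
  "permute3 rotate_left (embed12 F) = embed13 (flip F)"
  "permute3 rotate_left (embed23 F) = embed12 F"
  "permute3 rotate_left (coproduct1 F) = permute3 swap23 (coproduct1 F)"
  "permute3 rotate_left (coproduct2 F) = coproduct1 (flip F)"
  "permute3 swap12 (coproduct1 F) = coproduct1 F"
  "permute3 swap12 (embed12 F) = embed12 (flip F)"
  "permute3 swap12 (embed13 F) = embed23 F"
  "permute3 swap12 (embed23 F) = embed13 F"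
  "permute3 swap23 (coproduct2 F) = coproduct2 F"
  "permute3 swap23 (embed12 F) = embed13 F"
  "permute3 swap23 (embed23 F) = embed23 (flip F)"
  unfolding permute3_def pushforward_leg
  unfolding leg_defs pushforward_leg(6) [unfolded flip_def]
  by (simp_all add: case_prod_beta')

lemma leg_coproduct:
  "permute3 swap12 (coproduct2 (coproduct G x)) = coproduct2 (coproduct G x)"
  "coproduct1 (coproduct G x) = coproduct2 (coproduct G x)"
  "flip (coproduct G x) = coproduct G x"
  unfolding permute3_def pushforward_leg unfolding leg_defs pushforward_coproduct
  by (simp_all add: coproduct_eq)

lemma flip_flip [simp]: "F \<in> carrier kG2 \<Longrightarrow> flip (flip F) = F"
  unfolding flip_def
  by (subst pushforward_pushforward [OF fg(2)])
     (auto simp: G2.pushforward_id case_prod_beta')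

section \<open>Triangular structures\<close>

text \<open>As \<open>k[G]\<close> is cocommutative, the intertwining condition on \<open>R\<close> says that \<open>R\<close> commutes with
  the coproducts; the condition on \<open>(I \<otimes> \<Delta>)(R)\<close> follows from the others since \<open>flip R = R\<^sup>-\<^sup>1\<close>.\<close>

definition triangular :: "('a \<times> 'a \<Rightarrow> 'k::field) \<Rightarrow> bool" where
  "triangular R \<longleftrightarrow>
     R \<in> Units kG2 \<and>
     flip R \<star>\<^sub>2 R = \<one>\<^bsub>kG2\<^esub> \<and>
     coproduct1 R = embed13 R \<star>\<^sub>3 embed23 R \<and>
     (\<forall>g\<in>carrier G. basis_elem (g, g) \<star>\<^sub>2 R = R \<star>\<^sub>2 basis_elem (g, g))"

context
  fixes R :: "'a \<times> 'a \<Rightarrow> 'k::field"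
  assumes R: "triangular R"
begin

lemma triangular_Units: "R \<in> Units kG2"
  using R by (simp add: triangular_def)

lemma triangular_carrier: "R \<in> carrier kG2"
  using triangular_Units by (rule G2.A.Units_closed)

lemma triangular_flip: "flip R = inv\<^bsub>kG2\<^esub> R"
  using R triangular_carrier by (simp add: triangular_def G2.A.inv_unique' G2.A.Units_r_inv
      G2.A.inv_char [symmetric] G2.A.Units_inv_closed) (metis G2.A.inv_unique G2.A.Units_closed
      G2.A.Units_inv_closed G2.A.Units_r_inv leg_closed(6) triangular_Units)

lemma triangular_coproduct1: "coproduct1 R = embed13 R \<star>\<^sub>3 embed23 R"
  using R by (simp add: triangular_def)

text \<open>By cocommutativity (\<Delta> \<otimes> I)(R) is fixed by the swap of the first two legs,
  which exchanges R_13 and R_23.\<close>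

lemma triangular_embed13_embed23_commute:
  "embed13 R \<star>\<^sub>3 embed23 R = embed23 R \<star>\<^sub>3 embed13 R"
proof -
  have "permute3 swap12 (coproduct1 R) = embed23 R \<star>\<^sub>3 embed13 R"
    unfolding triangular_coproduct1
    by (subst permute3_mult(3)) (use triangular_carrier in \<open>auto simp: permute3_leg\<close>)
  then show ?thesis unfolding permute3_leg unfolding triangular_coproduct1 .
qed

text \<open>The second hexagon is the first one, inverted and with its legs rotated: inversion
  reverses the product, and R_21 = R^-1 turns the inverses back into R.\<close>

lemma triangular_coproduct2: "coproduct2 R = embed13 R \<star>\<^sub>3 embed12 R"
proof -
  let ?R' = "inv\<^bsub>kG2\<^esub> R"
  note U = triangular_Units
  have RC: "?R' \<in> carrier kG2" using U by simp
  have fl: "flip ?R' = R"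
    using triangular_flip triangular_carrier by (metis flip_flip)
  have "coproduct1 ?R' = inv\<^bsub>kG3\<^esub> (embed13 R \<star>\<^sub>3 embed23 R)"
    using U by (simp add: leg_inv triangular_coproduct1)
  also have "\<dots> = embed23 ?R' \<star>\<^sub>3 embed13 ?R'"
    using U by (simp add: inv_mult_Units [OF G3.A.monoid_axioms] leg_inv)
  finally have "permute3 rotate_right (coproduct1 (flip R)) =
      permute3 rotate_right (embed23 ?R') \<star>\<^sub>3 permute3 rotate_right (embed13 ?R')"
    unfolding triangular_flip using RC by (simp add: permute3_mult)
  then show ?thesis unfolding permute3_leg fl .
qed

text \<open>The commutation of R with g \<otimes> g, extended by a third leg. It suffices to take y
  = g \<otimes> k, for which g \<otimes> g sits in the legs of R and k in the leg where R_12 is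
  trivial.\<close>

lemma triangular_commutes:
  assumes y: "y \<in> carrier kG2"
  shows "embed12 R \<star>\<^sub>3 coproduct1 y = coproduct1 y \<star>\<^sub>3 embed12 R"
proof -
  let ?u = "embed12 R"
  have u: "?u \<in> Units kG3" using triangular_Units by simp
  have "coproduct1 y = ?u \<star>\<^sub>3 coproduct1 y \<star>\<^sub>3 inv\<^bsub>kG3\<^esub> ?u"
  proof (rule G2.alg_hom_eqI [OF _ _ y])
    show "coproduct1 \<in> alg_hom GG GGG" by (rule leg_alg_hom)
    show "(\<lambda>y. ?u \<star>\<^sub>3 coproduct1 y \<star>\<^sub>3 inv\<^bsub>kG3\<^esub> ?u) \<in> alg_hom GG GGG"
      by (rule alg_hom_conj [OF fg(3) _ u]) (rule leg_alg_hom)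
    fix p assume "p \<in> carrier GG"
    then obtain g k where p: "p = (g, k)" "g \<in> carrier G" "k \<in> carrier G" by auto
    have "coproduct1 (basis_elem p) = (basis_elem (g, g, k) :: _ \<Rightarrow> 'k)"
      unfolding coproduct1_def p(1) by (subst pushforward_basis [OF fg(2)]) (use p in auto)
    moreover have "basis_elem (g, g, k) \<star>\<^sub>3 ?u = ?u \<star>\<^sub>3 basis_elem (g, g, k)"
    proof (subst G3.commutes_basis_iff, use p in simp, intro ballI)
      fix c assume "c \<in> carrier GGG"
      then obtain a b d where c: "c = (a, b, d)" "a \<in> carrier G" "b \<in> carrier G" "d \<in> carrier G" by auto
      have "basis_elem (g, g) \<star>\<^sub>2 R = R \<star>\<^sub>2 basis_elem (g, g)"
        using R p(2) by (simp add: triangular_def)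
      then have *: "R (inv g \<otimes> a, inv g \<otimes> b) = R (a \<otimes> inv g, b \<otimes> inv g)"
        using p(2) c by (subst (asm) G2.commutes_basis_iff) (auto simp: inv_DirProd is_group)
      have "inv k \<otimes> d = \<one> \<longleftrightarrow> d \<otimes> inv k = \<one>"
        using p c by (metis inv_comm inv_closed)
      then show "?u (inv\<^bsub>G \<times>\<times> GG\<^esub> (g, g, k) \<otimes>\<^bsub>G \<times>\<times> GG\<^esub> c) =
          ?u (c \<otimes>\<^bsub>G \<times>\<times> GG\<^esub> inv\<^bsub>G \<times>\<times> GG\<^esub> (g, g, k))"
        using * p by (simp add: c inv_DirProd is_group G2.is_group leg_apply triangular_carrier)
    qed
    ultimately have "?u \<star>\<^sub>3 coproduct1 (basis_elem p) = coproduct1 (basis_elem p) \<star>\<^sub>3 ?u"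
      by simp
    then show "coproduct1 (basis_elem p) = ?u \<star>\<^sub>3 coproduct1 (basis_elem p) \<star>\<^sub>3 inv\<^bsub>kG3\<^esub> ?u"
      using u p by (simp add: G3.A.m_assoc G3.A.Units_closed)
  qed
  then have "coproduct1 y \<star>\<^sub>3 ?u = ?u \<star>\<^sub>3 coproduct1 y \<star>\<^sub>3 inv\<^bsub>kG3\<^esub> ?u \<star>\<^sub>3 ?u"
    by simp
  then show ?thesis using u y by (simp add: G3.A.m_assoc G3.A.Units_closed)
qed

text \<open>Both sides equal R_23 R_13 R_12: the left one after R_12 has been moved past (\<Delta>
  \<otimes> I)(R) = R_13 R_23 = R_23 R_13, the right one by the second hexagon.\<close>

lemma triangular_cocycle: "twist_cocycle R"
proof -
  note c = triangular_carrier
  have "embed12 R \<star>\<^sub>3 coproduct1 R = embed23 R \<star>\<^sub>3 embed13 R \<star>\<^sub>3 embed12 R"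
    using triangular_commutes [OF c] triangular_embed13_embed23_commute triangular_coproduct1 by simp
  then show ?thesis
    unfolding twist_cocycle_def triangular_coproduct2 using c by (simp add: G3.A.m_assoc)
qed

text \<open>R_13 and R_23 commute, so the hexagon survives taking powers. This is what places the
  square root of R among the triangular structures.\<close>

lemma triangular_pow: "triangular (R [^]\<^bsub>kG2\<^esub> (n::nat))"
proof -
  note c = triangular_carrier and U = triangular_Units
  have "R \<star>\<^sub>2 flip R = \<one>\<^bsub>kG2\<^esub>" "flip R \<star>\<^sub>2 R = \<one>\<^bsub>kG2\<^esub>"
    using U by (auto simp: triangular_flip)
  then have "flip R [^]\<^bsub>kG2\<^esub> n \<star>\<^sub>2 R [^]\<^bsub>kG2\<^esub> n = \<one>\<^bsub>kG2\<^esub>"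
    using c by (metis G2.A.nat_pow_one G2.A.pow_mult_distrib leg_closed(6))
  moreover have "coproduct1 R [^]\<^bsub>kG3\<^esub> n = embed13 R [^]\<^bsub>kG3\<^esub> n \<star>\<^sub>3 embed23 R [^]\<^bsub>kG3\<^esub> n"
    unfolding triangular_coproduct1 using c
    by (intro G3.A.pow_mult_distrib triangular_embed13_embed23_commute) auto
  moreover have "basis_elem (g, g) \<star>\<^sub>2 R [^]\<^bsub>kG2\<^esub> n = R [^]\<^bsub>kG2\<^esub> n \<star>\<^sub>2 basis_elem (g, g)"
    if "g \<in> carrier G" for g
    using R that c
    by (intro G2.A.group_commutes_pow [symmetric]) (auto simp: triangular_def)
  ultimately show ?thesis
    using U c leg_alg_hom [THEN alg_hom_pow [rotated 2]] 
    unfolding triangular_def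
    by (simp add: G2.A.Units_pow_closed alg_hom_pow [OF fg(2,3) leg_alg_hom(4)]
       alg_hom_pow [OF fg(2,3) leg_alg_hom(2)]
       alg_hom_pow [OF fg(2,3) leg_alg_hom(3)]
       alg_hom_pow [OF fg(2,2) leg_alg_hom(6)])
qed

end

section \<open>Elements \<Sum> \<phi>(g) \<otimes> r_g for a family of orthogonal idempotents
  r_g\<close>

definition spread :: "('a \<Rightarrow> 'a \<Rightarrow> 'k::field) \<Rightarrow> ('a \<Rightarrow> 'a) \<Rightarrow> 'a \<times> 'a \<Rightarrow> 'k" where
  "spread r \<phi> = (\<lambda>p. \<Sum>g\<in>carrier G. tensor (basis_elem (\<phi> g)) (r g) p)"

lemma spread_apply:
  "spread r \<phi> (a, b) = (\<Sum>g\<in>carrier G. if \<phi> g = a then r g b else 0)"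
  unfolding spread_def by (intro sum.cong) (auto simp: basis_elem_def)

lemma spread_cong: "(\<And>g. g \<in> carrier G \<Longrightarrow> \<phi> g = \<psi> g) \<Longrightarrow> spread r \<phi> = spread r \<psi>"
  by (simp add: spread_def)

lemma spread_id:
  assumes "F \<in> carrier kG2"
  shows "spread (\<lambda>g h. F (g, h)) (\<lambda>g. g) = F"
proof
  fix p :: "'a \<times> 'a"
  obtain a b where "p = (a, b)" by (cases p)
  then show "spread (\<lambda>g h. F (g, h)) (\<lambda>g. g) p = F p"
    using assms by (auto simp: spread_apply sum.delta group_algebra_carrier)
qed

definition orthogonal_idempotents :: "('a \<Rightarrow> 'a \<Rightarrow> 'k::field) \<Rightarrow> bool" where
  "orthogonal_idempotents r \<longleftrightarrow>
     (\<forall>g\<in>carrier G. r g \<in> carrier (GA G)) \<and>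
     (\<forall>g\<in>carrier G. \<forall>h\<in>carrier G. r g \<star> r h = (if g = h then r g else (\<lambda>_. 0)))"

context
  fixes r :: "'a \<Rightarrow> 'a \<Rightarrow> 'k::field"
  assumes r: "orthogonal_idempotents r"
begin

lemma spread_closed:
  assumes "\<phi> \<in> carrier G \<rightarrow> carrier G"
  shows "spread r \<phi> \<in> carrier kG2"
  using r assms
  by (auto simp: spread_apply group_algebra_carrier orthogonal_idempotents_def intro!: sum.neutral)

text \<open>Orthogonality kills the mixed terms, so products are computed pointwise in the first
  leg. The inverse and the order of R = \<Sum> g \<otimes> r_g are thereby controlled by those of
  the elements g.\<close>

lemma spread_mult:
  assumes "\<phi> \<in> carrier G \<rightarrow> carrier G" "\<psi> \<in> carrier G \<rightarrow> carrier G"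
  shows "spread r \<phi> \<star>\<^sub>2 spread r \<psi> = spread r (\<lambda>g. \<phi> g \<otimes> \<psi> g)"
proof
  fix p
  have t0: "tensor x (\<lambda>_. 0) = (\<lambda>_. 0 :: 'k)" for x :: "'a \<Rightarrow> 'k"
    by (auto simp: tensor_def)
  have "(spread r \<phi> \<star>\<^sub>2 spread r \<psi>) p =
    (\<Sum>g\<in>carrier G. \<Sum>h\<in>carrier G.
       (tensor (basis_elem (\<phi> g)) (r g) \<star>\<^sub>2 tensor (basis_elem (\<psi> h)) (r h)) p)"
    unfolding spread_def G2.sum_mult_left G2.sum_mult_right ..
  also have "\<dots> = (\<Sum>g\<in>carrier G. \<Sum>h\<in>carrier G.
       if g = h then tensor (basis_elem (\<phi> g \<otimes> \<psi> g)) (r g) p else 0)"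
    using r assms unfolding orthogonal_idempotents_def
    by (intro sum.cong refl)
       (auto simp: tensor_mult [OF fg(1,1)] basis_mult_basis Pi_iff t0)
  also have "\<dots> = spread r (\<lambda>g. \<phi> g \<otimes> \<psi> g) p"
    by (simp add: spread_def sum.delta)
  finally show "(spread r \<phi> \<star>\<^sub>2 spread r \<psi>) p = spread r (\<lambda>g. \<phi> g \<otimes> \<psi> g) p" .
qed

context
  assumes unit: "spread r (\<lambda>g. g) \<in> Units kG2"
begin

text \<open>Multiplication by \<Sum> 1 \<otimes> r_g fixes the unit \<Sum> g \<otimes> r_g, and
  cancelling that unit leaves 1. In this way invertibility forces the idempotents to sum to
  1.\<close>

lemma spread_one: "spread r (\<lambda>_. \<one>) = \<one>\<^bsub>kG2\<^esub>"
proof -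
  have c: "spread r (\<lambda>g. g) \<in> carrier kG2" "spread r (\<lambda>_. \<one>) \<in> carrier kG2"
    by (auto intro!: spread_closed)
  have "spread r (\<lambda>_. \<one>) \<star>\<^sub>2 spread r (\<lambda>g. g) = spread r (\<lambda>g. g)"
    by (subst spread_mult) (auto intro: spread_cong)
  then have "spread r (\<lambda>_. \<one>) \<star>\<^sub>2 (spread r (\<lambda>g. g) \<star>\<^sub>2 inv\<^bsub>kG2\<^esub> spread r (\<lambda>g. g)) =
      spread r (\<lambda>g. g) \<star>\<^sub>2 inv\<^bsub>kG2\<^esub> spread r (\<lambda>g. g)"
    using c unit by (simp add: G2.A.m_assoc [symmetric] del: G2.A.Units_r_inv)
  then show ?thesis using c unit by simp
qed

lemma orthogonal_idempotents_sum:
  "(\<Sum>g\<in>carrier G. r g h) = (if h = \<one> then 1 else 0)"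
proof -
  have "(\<Sum>g\<in>carrier G. r g h) = spread r (\<lambda>_. \<one>) (\<one>, h)"
    by (simp add: spread_apply)
  then show ?thesis by (simp add: spread_one group_algebra_one basis_elem_def)
qed

lemma spread_inv: "inv\<^bsub>kG2\<^esub> spread r (\<lambda>g. g) = spread r (\<lambda>g. inv g)"
proof -
  have "spread r (\<lambda>g. inv g) \<star>\<^sub>2 spread r (\<lambda>g. g) = \<one>\<^bsub>kG2\<^esub>"
    by (subst spread_mult) (auto simp: spread_one [symmetric] intro: spread_cong)
  moreover have "spread r (\<lambda>g. g) \<star>\<^sub>2 spread r (\<lambda>g. inv g) = \<one>\<^bsub>kG2\<^esub>"
    by (subst spread_mult) (auto simp: spread_one [symmetric] intro: spread_cong)
  ultimately show ?thesis
    by (intro G2.A.inv_unique' [symmetric] spread_closed) auto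
qed

lemma spread_pow_order: "spread r (\<lambda>g. g) [^]\<^bsub>kG2\<^esub> Coset.order G = \<one>\<^bsub>kG2\<^esub>"
proof -
  have "spread r (\<lambda>g. g) [^]\<^bsub>kG2\<^esub> (n::nat) = spread r (\<lambda>g. g [^] n)" for n
  proof (induction n)
    case (Suc n)
    then show ?case by (simp add: spread_mult)
  qed (simp add: spread_one)
  then show ?thesis
    by (simp add: spread_one [symmetric] pow_order_eq_1 cong: spread_cong)
qed

end
end

lemma (in -) form_twist_apply:
  assumes "finite S"
  shows "form_twist S \<beta> (a, b) = (if a \<in> S \<and> b \<in> S then \<beta> a b / of_nat (card S) else 0)"
proof -
  have "(\<Sum>s\<in>S. \<Sum>t\<in>S. \<beta> s t * tensor (basis_elem s) (basis_elem t) (a, b)) =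
     (\<Sum>s\<in>S. if s = a then (\<Sum>t\<in>S. if t = b then \<beta> s t else 0) else 0)"
    by (intro sum.cong refl) (auto simp: basis_elem_def intro!: sum.cong)
  then show ?thesis
    using assms by (simp add: form_twist_def sum.delta)
qed

text \<open>Compare the coefficients of (\<Delta> \<otimes> I)(R) = R_13 R_23 at g \<otimes> h
  \<otimes> c: the left side vanishes unless g = h, and the right side is the coefficient of r_g r_h
  at c.\<close>

lemma triangular_orthogonal_idempotents:
  fixes R :: "'a \<times> 'a \<Rightarrow> 'k::field"
  assumes "triangular R"
  shows "orthogonal_idempotents (\<lambda>g h. R (g, h))"
  unfolding orthogonal_idempotents_def
proof (intro conjI ballI)
  note c = triangular_carrier [OF assms]
  show r: "(\<lambda>h. R (g, h)) \<in> carrier (GA G)" for g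
    using c by (auto simp: group_algebra_carrier)
  fix g h assume gh: "g \<in> carrier G" "h \<in> carrier G"
  show "(\<lambda>c. R (g, c)) \<star> (\<lambda>c. R (h, c)) = (if g = h then \<lambda>c. R (g, c) else (\<lambda>_. 0))"
  proof (rule group_algebra_eqI [where G = G])
    fix c' assume c': "c' \<in> carrier G"
    have "(embed13 R \<star>\<^sub>3 embed23 R) (g, h, c') =
       (\<Sum>a\<in>carrier G. \<Sum>b\<in>carrier G. \<Sum>d\<in>carrier G. embed13 R (a, b, d) * embed23 R (inv a \<otimes> g, inv b \<otimes> h, inv d \<otimes> c'))"
      using gh c'
      by (subst G3.mult_apply) (auto simp: inv_DirProd is_group G2.is_group sum.cartesian_product
          intro!: sum.cong)
    also have "\<dots> = (\<Sum>a\<in>carrier G. \<Sum>b\<in>carrier G. \<Sum>d\<in>carrier G.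
        if a = g then (if b = \<one> then R (g, d) * R (h, inv d \<otimes> c') else 0) else 0)"
    proof -
      have "inv a \<otimes> g = \<one> \<longleftrightarrow> a = g" if "a \<in> carrier G" for a
        using that gh by (metis inv_closed inv_equality inv_inv l_inv)
      then show ?thesis
        using gh by (intro sum.cong refl) (auto simp: leg_apply c)
    qed
    also have "\<dots> = (\<Sum>a\<in>carrier G. if a = g then (\<Sum>b\<in>carrier G. if b = \<one> then
          (\<Sum>d\<in>carrier G. R (g, d) * R (h, inv d \<otimes> c')) else 0) else 0)"
    proof -
      have "(\<Sum>d\<in>carrier G. if P then f d else 0) = (if P then sum f (carrier G) else 0)"
        for P and f :: "'a \<Rightarrow> 'k"
        by simp
      then show ?thesis by (simp only:)
    qed
    also have "\<dots> = ((\<lambda>c. R (g, c)) \<star> (\<lambda>c. R (h, c))) c'"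
      using gh c' by (simp add: mult_apply)
    finally show "((\<lambda>c. R (g, c)) \<star> (\<lambda>c. R (h, c))) c' = (if g = h then \<lambda>c. R (g, c) else (\<lambda>_. 0)) c'"
      unfolding triangular_coproduct1 [OF assms, symmetric] by (cases "g = h") (simp_all add: leg_apply c)
  qed (use r gh in \<open>auto simp: group_algebra_carrier mult_outside\<close>)
qed

section \<open>Classification of triangular structures\<close>

context
  fixes R :: "'a \<times> 'a \<Rightarrow> 'k::field"
  assumes R: "triangular R"
begin

private abbreviation (input) r where "r \<equiv> \<lambda>g h. R (g, h)"
text \<open>The subgroup of the normal form, as yet only a set.\<close>

private definition A where "A = {g \<in> carrier G. r g \<noteq> (\<lambda>_. 0)}"

private lemma r_closed: "r g \<in> carrier (GA G)"
  using triangular_carrier [OF R] by (auto simp: group_algebra_carrier)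

private lemma r_mult: "g \<in> carrier G \<Longrightarrow> h \<in> carrier G \<Longrightarrow> r g \<star> r h = (if g = h then r g else (\<lambda>_. 0))"
  using triangular_orthogonal_idempotents [OF R] by (simp add: orthogonal_idempotents_def)

private lemma spread_r: "spread r (\<lambda>g. g) = R"
  by (rule spread_id [OF triangular_carrier [OF R]])

private lemma r_unit: "spread r (\<lambda>g. g) \<in> Units kG2"
  unfolding spread_r by (rule triangular_Units [OF R])

private lemma r_sum: "(\<Sum>g\<in>carrier G. r g h) = (if h = \<one> then 1 else 0)"
  by (rule orthogonal_idempotents_sum [OF triangular_orthogonal_idempotents [OF R] r_unit])

lemma triangular_pow_order: "R [^]\<^bsub>kG2\<^esub> Coset.order G = \<one>\<^bsub>kG2\<^esub>"
  using spread_pow_order [OF triangular_orthogonal_idempotents [OF R] r_unit] by (simp add: spread_r)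

text \<open>The identity R_21 = R^-1 = \<Sum> g^-1 \<otimes> r_g, compared coefficientwise.\<close>

private lemma skew:
  assumes "a \<in> carrier G" "b \<in> carrier G"
  shows "R (b, a) = R (inv a, b)"
proof -
  have "flip R = spread r (\<lambda>g. inv g)"
    using spread_inv [OF triangular_orthogonal_idempotents [OF R] r_unit]
    by (simp add: spread_r triangular_flip [OF R])
  then have "R (b, a) = spread r (\<lambda>g. inv g) (a, b)"
    using leg_apply(6) [OF triangular_carrier [OF R]] by metis
  also have "\<dots> = (\<Sum>g\<in>carrier G. if g = inv a then R (g, b) else 0)"
    unfolding spread_apply using assms by (intro sum.cong) auto
  finally show ?thesis using assms by (simp add: sum.delta)
qed

private lemma A_carrier: "g \<in> A \<Longrightarrow> g \<in> carrier G"
  by (simp add: A_def)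

private lemma A_support:
  assumes "R (g, h) \<noteq> 0"
  shows "g \<in> A" "h \<in> A"
proof -
  have gh: "g \<in> carrier G" "h \<in> carrier G"
    using assms triangular_carrier [OF R] by (auto simp: group_algebra_carrier)
  show "g \<in> A" using assms gh by (auto simp: A_def fun_eq_iff)
  have "R (h, inv g) = R (g, h)" using skew [of "inv g" h] gh by simp
  then show "h \<in> A" using assms gh by (auto simp: A_def fun_eq_iff intro!: exI [of _ "inv g"])
qed

text \<open>By skewness R(x,h) = R(h,x^-1), so the sum is the coefficient of r_g r_h at 1. Read in
  k[G], it says that \<Sum> R(g,x) r_x is a multiple of g. Elements of \<open>A\<close> are thus
  combinations of the idempotents, which is why they act on them by scalars.\<close>

private lemma r_contract:
  assumes "g \<in> carrier G"
  shows "(\<lambda>h. \<Sum>x\<in>carrier G. R (g, x) * R (x, h)) = (\<lambda>h. R (g, \<one>) * basis_elem g h)"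
proof
  fix h
  show "(\<Sum>x\<in>carrier G. R (g, x) * R (x, h)) = R (g, \<one>) * basis_elem g h"
  proof (cases "h \<in> carrier G")
    case True
    have "(\<Sum>x\<in>carrier G. R (g, x) * R (x, h)) = (\<Sum>x\<in>carrier G. R (g, x) * R (h, inv x \<otimes> \<one>))"
      using True skew [of "inv x" h for x] by (intro sum.cong) auto
    also have "\<dots> = (r g \<star> r h) \<one>" by (simp add: mult_apply)
    finally show ?thesis using assms True by (auto simp: r_mult basis_elem_def)
  next
    case False
    then show ?thesis using assms r_closed by (auto simp: basis_elem_def group_algebra_carrier)
  qed
qed

private lemma r_contract_mult:
  assumes "g \<in> carrier G" "y \<in> carrier G"
  shows "R (g, \<one>) * (basis_elem g \<star> r y) c = R (g, y) * R (y, c)"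
proof -
  have "R (g, \<one>) * (basis_elem g \<star> r y) c = ((\<lambda>h. R (g, \<one>) * basis_elem g h) \<star> r y) c"
    by (simp add: smult_mult_left)
  also have "\<dots> = (\<Sum>x\<in>carrier G. R (g, x) * (r x \<star> r y) c)"
    unfolding r_contract [OF assms(1), symmetric] sum_mult_left smult_mult_left ..
  also have "\<dots> = (\<Sum>x\<in>carrier G. if x = y then R (g, y) * R (y, c) else 0)"
    using assms by (intro sum.cong) (auto simp: r_mult)
  finally show ?thesis using assms by (simp add: sum.delta)
qed

text \<open>If R(g,1) vanished, \<open>r_contract_mult\<close> would give R(g,y) r_y = 0 for all y,
  whereas r_y is nonzero as soon as R(g,y) is.\<close>

private lemma r_one_nonzero:
  assumes "g \<in> A"
  shows "R (g, \<one>) \<noteq> 0"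
proof
  assume 0: "R (g, \<one>) = 0"
  have "R (g, y) = 0" for y
  proof (rule ccontr)
    assume *: "R (g, y) \<noteq> 0"
    then have "y \<in> A" by (rule A_support)
    then obtain c where "R (y, c) \<noteq> 0" "y \<in> carrier G" by (auto simp: A_def)
    with r_contract_mult [of g y c] 0 * assms show False by (simp add: A_def)
  qed
  with assms show False by (simp add: A_def)
qed

text \<open>The eigenvalue of left multiplication by g on r_y, and in the end the form on the
  subgroup.\<close>

private definition \<gamma> where "\<gamma> g y = R (g, y) / R (g, \<one>)"

private lemma basis_r:
  assumes "g \<in> A" "y \<in> carrier G"
  shows "basis_elem g \<star> r y = (\<lambda>c. \<gamma> g y * R (y, c))"
  using r_contract_mult [OF A_carrier [OF assms(1)] assms(2)] r_one_nonzero [OF assms(1)]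
  by (auto simp: \<gamma>_def field_simps)

private lemma A_not_empty: "A \<noteq> {}"
proof
  assume "A = {}"
  then have "(\<Sum>g\<in>carrier G. r g \<one>) = 0" by (intro sum.neutral) (auto dest: A_support)
  then show False by (simp add: r_sum)
qed

text \<open>Skewness applied twice gives R(g^-1,h^-1) = R(g,h).\<close>

private lemma A_inv:
  assumes "g \<in> A" shows "inv g \<in> A"
proof -
  obtain h where h: "R (g, h) \<noteq> 0" using assms by (auto simp: A_def)
  then have "g \<in> carrier G" "h \<in> carrier G" using A_support A_carrier by blast+
  with skew [of g "inv h"] skew [of h g] h show ?thesis by (auto intro: A_support)
qed

private lemma r_expand: "(\<lambda>h. \<Sum>y\<in>carrier G. r y h) = basis_elem \<one>"
  by (auto simp: r_sum basis_elem_def)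

text \<open>The r_y sum to 1, so an element of \<open>G\<close> is determined by its action on them.
  As elements of \<open>A\<close> act by scalars, \<open>A\<close> turns out to be
  commutative.\<close>

private lemma basis_eqI:
  assumes "g \<in> carrier G" "h \<in> carrier G"
    "\<And>y. y \<in> carrier G \<Longrightarrow> basis_elem g \<star> r y = basis_elem h \<star> r y"
  shows "g = h"
proof -
  have "basis_elem g \<star> (\<lambda>h. \<Sum>y\<in>carrier G. r y h) = basis_elem h \<star> (\<lambda>h. \<Sum>y\<in>carrier G. r y h)"
    unfolding sum_mult_right using assms(3) by simp
  then have "(basis_elem g :: 'a \<Rightarrow> 'k) = basis_elem h"
    unfolding r_expand group_algebra_one [symmetric] using assms by simp
  then show ?thesis by simp
qed

private lemma basis_basis_r:
  assumes "g \<in> A" "g' \<in> A" "y \<in> carrier G"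
  shows "basis_elem (g \<otimes> g') \<star> r y = (\<lambda>c. \<gamma> g y * \<gamma> g' y * R (y, c))"
proof -
  have "basis_elem (g \<otimes> g') \<star> r y = basis_elem g \<star> (basis_elem g' \<star> r y)"
    using assms by (simp add: A_carrier basis_mult_basis [symmetric] group_algebra_assoc)
  also have "\<dots> = basis_elem g \<star> (\<lambda>c. \<gamma> g' y * R (y, c))"
    using assms by (simp only: basis_r)
  also have "\<dots> = (\<lambda>c. \<gamma> g' y * (\<gamma> g y * R (y, c)))"
    using assms by (simp add: smult_mult_right basis_r)
  finally show ?thesis by (simp add: mult.assoc mult.left_commute)
qed

text \<open>In the expansion gg' = \<Sum> \<gamma>(g,y) \<gamma>(g',y) r_y the coefficient at gg' is
  1, so gg' occurs in some r_y; the second legs of R lie in \<open>A\<close> as well.\<close>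

private lemma A_mult:
  assumes "g \<in> A" "g' \<in> A"
  shows "g \<otimes> g' \<in> A"
proof -
  have "basis_elem (g \<otimes> g') \<star> (\<lambda>h. \<Sum>y\<in>carrier G. r y h) =
      (\<lambda>c. \<Sum>y\<in>carrier G. \<gamma> g y * \<gamma> g' y * R (y, c))"
    unfolding sum_mult_right using assms by (simp add: basis_basis_r)
  then have "(\<Sum>y\<in>carrier G. \<gamma> g y * \<gamma> g' y * R (y, g \<otimes> g')) = basis_elem (g \<otimes> g') (g \<otimes> g')"
    unfolding r_expand group_algebra_one [symmetric] using assms
    by (metis A.r_one A_carrier basis_elem_in m_closed)
  then have "(\<Sum>y\<in>carrier G. \<gamma> g y * \<gamma> g' y * R (y, g \<otimes> g')) \<noteq> 0"
    by (simp add: basis_elem_def)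
  then obtain y where "R (y, g \<otimes> g') \<noteq> 0"
    by (rule sum.not_neutral_contains_not_neutral) auto
  then show ?thesis by (rule A_support)
qed

private lemma A_comm:
  assumes "g \<in> A" "g' \<in> A"
  shows "g \<otimes> g' = g' \<otimes> g"
  by (rule basis_eqI) (use assms in \<open>auto simp: A_carrier basis_basis_r mult_ac\<close>)

private lemma A_one: "\<one> \<in> A"
  using A_not_empty A_inv A_mult A_carrier r_inv by (metis ex_in_conv)

private lemma A_subgroup: "subgroup A G"
  by (rule subgroupI) (auto simp: A_carrier A_not_empty A_inv A_mult)

private lemma R_invariant:
  assumes "g \<in> carrier G" "s \<in> carrier G" "t \<in> carrier G"
  shows "R (g \<otimes> s \<otimes> inv g, g \<otimes> t \<otimes> inv g) = R (s, t)"
proof -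
  have "basis_elem (g, g) \<star>\<^sub>2 R = R \<star>\<^sub>2 basis_elem (g, g)"
    using R assms by (simp add: triangular_def)
  then have "\<forall>c\<in>carrier GG. R (inv\<^bsub>G \<times>\<times> G\<^esub> (g, g) \<otimes>\<^bsub>G \<times>\<times> G\<^esub> c) = R (c \<otimes>\<^bsub>G \<times>\<times> G\<^esub> inv\<^bsub>G \<times>\<times> G\<^esub> (g, g))"
    using assms by (subst (asm) G2.commutes_basis_iff) auto
  then have "R (inv\<^bsub>G \<times>\<times> G\<^esub> (g, g) \<otimes>\<^bsub>G \<times>\<times> G\<^esub> (g \<otimes> s, g \<otimes> t)) = R ((g \<otimes> s, g \<otimes> t) \<otimes>\<^bsub>G \<times>\<times> G\<^esub> inv\<^bsub>G \<times>\<times> G\<^esub> (g, g))"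
    using assms by auto
  then show ?thesis using assms by (simp add: inv_DirProd is_group m_assoc [symmetric])
qed

private lemma A_normal: "A \<lhd> G"
  unfolding normal_inv_iff
proof (intro conjI A_subgroup ballI)
  fix g s assume gs: "g \<in> carrier G" "s \<in> A"
  then obtain t where t: "R (s, t) \<noteq> 0" by (auto simp: A_def)
  then have "t \<in> carrier G" by (metis A_carrier A_support(2))
  with gs t show "g \<otimes> s \<otimes> inv g \<in> A"
    using R_invariant [of g s t] A_support(1) [of "g \<otimes> s \<otimes> inv g" "g \<otimes> t \<otimes> inv g"]
    by (simp add: A_carrier)
qed

text \<open>The element 1 acts on r_y with eigenvalue 1, hence R(1,y) = R(1,1), and skewness moves y
  to the left. All denominators in \<gamma> on \<open>A\<close> are therefore one constant.\<close>

private lemma R_one: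
  assumes "y \<in> A"
  shows "R (y, \<one>) = R (\<one>, \<one>)"
proof -
  obtain c where c: "R (y, c) \<noteq> 0" using assms by (auto simp: A_def)
  have "basis_elem \<one> \<star> r y = r y"
    unfolding group_algebra_one [symmetric] by (simp add: r_closed)
  then have "\<gamma> \<one> y * R (y, c) = R (y, c)"
    using basis_r [OF A_one A_carrier [OF assms]] by metis
  then have "R (\<one>, y) = R (\<one>, \<one>)" using c r_one_nonzero [OF A_one] by (simp add: \<gamma>_def field_simps)
  then show ?thesis using skew [of \<one> y] assms by (simp add: A_carrier)
qed

private lemma R_eq: "x \<in> A \<Longrightarrow> R (x, y) = R (\<one>, \<one>) * \<gamma> x y"
  using R_one [of x] r_one_nonzero [of x] by (simp add: \<gamma>_def)

private lemma \<gamma>_mult: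
  assumes "x \<in> A" "x' \<in> A" "y \<in> A"
  shows "\<gamma> (x \<otimes> x') y = \<gamma> x y * \<gamma> x' y"
proof -
  obtain c where c: "R (y, c) \<noteq> 0" using assms by (auto simp: A_def)
  show ?thesis
    using basis_basis_r [OF assms(1,2) A_carrier [OF assms(3)]]
      basis_r [OF A_mult [OF assms(1,2)] A_carrier [OF assms(3)]] c
    by (metis mult_right_cancel)
qed

private lemma \<gamma>_one: "y \<in> A \<Longrightarrow> \<gamma> \<one> y = 1"
  using skew [of \<one> y] R_one [of y] r_one_nonzero [OF A_one] by (simp add: \<gamma>_def A_carrier)

private lemma \<gamma>_inv: "x \<in> A \<Longrightarrow> y \<in> A \<Longrightarrow> \<gamma> x y * \<gamma> (inv x) y = 1"
  using \<gamma>_mult [of x "inv x" y] by (simp add: A_inv A_carrier \<gamma>_one)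

private lemma \<gamma>_skew: "x \<in> A \<Longrightarrow> y \<in> A \<Longrightarrow> \<gamma> y x = \<gamma> (inv x) y"
  using skew [of x y] R_one [of y] R_one [of "inv x"] by (simp add: \<gamma>_def A_carrier A_inv)

text \<open>One factor of r_1 = r_1 r_1 is expanded in group elements. Each x in \<open>A\<close>
  contributes the same R(1,1) r_1, because R(1,x) = R(1,1) \<gamma>(x^-1,1) meets the eigenvalue
  \<gamma>(x,1). This is the origin of the factor 1/|S| in the form twist.\<close>

private lemma card_A: "of_nat (card A) * R (\<one>, \<one>) = 1"
proof -
  obtain c where c: "R (\<one>, c) \<noteq> 0" using A_one by (auto simp: A_def)
  have "r \<one> = r \<one> \<star> r \<one>" by (simp add: r_mult)
  also have "\<dots> = (\<lambda>h. \<Sum>x\<in>carrier G. R (\<one>, x) * basis_elem x h) \<star> r \<one>"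
    by (subst (1) basis_expansion [OF r_closed]) (rule refl)
  also have "\<dots> = (\<lambda>h. \<Sum>x\<in>carrier G. R (\<one>, x) * (basis_elem x \<star> r \<one>) h)"
    unfolding sum_mult_left smult_mult_left ..
  also have "\<dots> = (\<lambda>h. \<Sum>x\<in>carrier G. if x \<in> A then R (\<one>, \<one>) * R (\<one>, h) else 0)"
  proof (intro ext sum.cong refl)
    fix h x assume x: "x \<in> carrier G"
    show "R (\<one>, x) * (basis_elem x \<star> r \<one>) h = (if x \<in> A then R (\<one>, \<one>) * R (\<one>, h) else 0)"
    proof (cases "x \<in> A")
      case True
      then have "R (\<one>, x) = R (\<one>, \<one>) * \<gamma> (inv x) \<one>"
        using R_eq [of \<one> x] \<gamma>_skew [of x \<one>] A_one by simp
      then show ?thesis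
        using True \<gamma>_inv [OF True A_one] by (simp add: basis_r mult_ac)
    next
      case False
      then have "R (\<one>, x) = 0" using A_support by blast
      with False show ?thesis by simp
    qed
  qed
  also have "\<dots> = (\<lambda>h. of_nat (card A) * R (\<one>, \<one>) * R (\<one>, h))"
    by (auto simp: sum.If_cases Int_absorb1 A_carrier subset_iff mult.assoc)
  finally have "R (\<one>, c) = of_nat (card A) * R (\<one>, \<one>) * R (\<one>, c)"
    by (rule fun_cong)
  then show ?thesis using c by simp
qed

private lemma R_form_twist: "R = form_twist A \<gamma>"
proof
  fix p :: "'a \<times> 'a"
  obtain a b where p: "p = (a, b)" by (cases p)
  have "finite A" by (rule finite_subset [OF _ finite_carrier]) (auto simp: A_carrier)
  moreover have "R (\<one>, \<one>) = 1 / of_nat (card A)"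
    using card_A by (metis mult_zero_left nonzero_eq_divide_eq mult.commute zero_neq_one)
  moreover have "R (a, b) = 0" if "\<not> (a \<in> A \<and> b \<in> A)"
    using A_support [of a b] that by blast
  ultimately show "R p = form_twist A \<gamma> p"
    using R_eq [of a b] unfolding p by (simp add: form_twist_apply)
qed

text \<open>Surjectivity of the pairing without counting characters. The element e = \<Sum>
  \<chi>(h^-1) h is an eigenvector of \<open>A\<close> with character \<chi>. It is also a
  combination of the r_y, and any r_y that really occurs in it must have the character \<chi>
  too.\<close>

private lemma character_eq:
  assumes \<chi>: "\<chi> \<in> hom (G\<lparr>carrier := A\<rparr>) (field_units :: 'k monoid)"
  shows "\<exists>y\<in>A. \<forall>x\<in>A. \<chi> x = \<gamma> x y"
proof -
  have \<chi>m: "\<chi> (x \<otimes> y) = \<chi> x * \<chi> y" and \<chi>0: "\<chi> x \<noteq> 0" if "x \<in> A" "y \<in> A" for x y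
    using \<chi> that by (auto simp: hom_def field_units_def)
  have \<chi>1: "\<chi> \<one> = 1" using \<chi>m [OF A_one A_one] \<chi>0 [OF A_one A_one] by simp
  define e where "e = (\<lambda>h. if h \<in> A then \<chi> (inv h) else 0)"
  have e: "e \<in> carrier (GA G)" by (auto simp: e_def group_algebra_carrier A_carrier)
  have xe: "basis_elem x \<star> e = (\<lambda>c. \<chi> x * e c)" if x: "x \<in> A" for x
  proof (rule group_algebra_eqI [where G = G])
    fix c assume c: "c \<in> carrier G"
    have "inv x \<otimes> c \<in> A \<longleftrightarrow> c \<in> A"
      using x c A_mult A_inv A_carrier by (metis inv_solve_left inv_closed)
    moreover have "\<chi> (inv (inv x \<otimes> c)) = \<chi> x * \<chi> (inv c)" if "c \<in> A"
      using x that A_comm [of x "inv c"] \<chi>m [of x "inv c"] by (simp add: inv_mult_group A_carrier A_inv)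
    ultimately show "(basis_elem x \<star> e) c = \<chi> x * e c"
      using x c by (simp add: basis_mult_left A_carrier e_def)
  qed (use e in \<open>auto simp: group_algebra_carrier mult_outside\<close>)
  \<comment> \<open>Here \<open>S y\<close> is a scalar, the eigenvalue of e on r_y.\<close>
  define S where "S y = (\<Sum>x\<in>carrier G. e x * \<gamma> x y)" for y
  have er: "e \<star> r y = (\<lambda>c. S y * R (y, c))" if y: "y \<in> carrier G" for y
  proof -
    have "e \<star> r y = (\<lambda>h. \<Sum>x\<in>carrier G. e x * basis_elem x h) \<star> r y"
      by (subst (1) basis_expansion [OF e]) (rule refl)
    also have "\<dots> = (\<lambda>h. \<Sum>x\<in>carrier G. e x * (basis_elem x \<star> r y) h)"
      unfolding sum_mult_left smult_mult_left ..
    also have "\<dots> = (\<lambda>c. S y * R (y, c))"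
      unfolding S_def sum_distrib_right
      by (intro ext sum.cong refl) (auto simp: e_def basis_r y)
    finally show ?thesis .
  qed
  have "e = e \<star> (\<lambda>h. \<Sum>y\<in>carrier G. r y h)"
    unfolding r_expand group_algebra_one [symmetric] using e by simp
  also have "\<dots> = (\<lambda>c. \<Sum>y\<in>carrier G. S y * R (y, c))"
    unfolding sum_mult_right by (simp add: er)
  \<comment> \<open>The coefficient of e at 1 is \<chi>(1) = 1, which forces a y with both S(y) and
    R(y,1) nonzero.\<close>
  finally have "e \<one> = (\<Sum>y\<in>carrier G. S y * R (y, \<one>))" by (rule fun_cong)
  moreover have "e \<one> = 1" by (simp add: e_def A_one \<chi>1)
  ultimately have "(\<Sum>y\<in>carrier G. S y * R (y, \<one>)) \<noteq> 0" by simp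
  then obtain y where y: "y \<in> carrier G" "S y \<noteq> 0" "R (y, \<one>) \<noteq> 0"
    by (rule sum.not_neutral_contains_not_neutral) auto
  have yA: "y \<in> A" by (rule A_support [OF y(3)])
  have "\<chi> x = \<gamma> x y" if x: "x \<in> A" for x
  proof -
    have "basis_elem x \<star> (e \<star> r y) = (\<lambda>c. \<chi> x * e c) \<star> r y"
      unfolding xe [OF x, symmetric] group_algebra_assoc ..
    also have "\<dots> = (\<lambda>c. \<chi> x * (S y * R (y, c)))"
      unfolding smult_mult_left er [OF y(1)] ..
    finally have "basis_elem x \<star> (e \<star> r y) = (\<lambda>c. \<chi> x * (S y * R (y, c)))" .
    moreover have "basis_elem x \<star> (e \<star> r y) = (\<lambda>c. S y * (\<gamma> x y * R (y, c)))"
      unfolding er [OF y(1)] smult_mult_right basis_r [OF x y(1)] ..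
    ultimately have "\<chi> x * (S y * R (y, \<one>)) = S y * (\<gamma> x y * R (y, \<one>))" by metis
    then show ?thesis using y by simp
  qed
  with yA show ?thesis by blast
qed

private lemma \<gamma>_nonzero: "x \<in> A \<Longrightarrow> y \<in> A \<Longrightarrow> \<gamma> x y \<noteq> 0"
  using \<gamma>_inv [of x y] by auto

private lemma \<gamma>_mult_right:
  assumes "x \<in> A" "x' \<in> A" "y \<in> A"
  shows "\<gamma> y (x \<otimes> x') = \<gamma> y x * \<gamma> y x'"
proof -
  have "\<gamma> y (x \<otimes> x') = \<gamma> (inv x' \<otimes> inv x) y"
    using \<gamma>_skew [of "x \<otimes> x'" y] assms by (simp add: A_mult inv_mult_group A_carrier)
  also have "\<dots> = \<gamma> (inv x') y * \<gamma> (inv x) y"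
    using assms by (simp add: \<gamma>_mult A_inv)
  finally show ?thesis
    using \<gamma>_skew [of x y] \<gamma>_skew [of x' y] assms by simp
qed

private lemma \<gamma>_bimultiplicative: "bimultiplicative (G\<lparr>carrier := A\<rparr>) \<gamma>"
  by (auto simp: bimultiplicative_def hom_def field_units_def \<gamma>_mult \<gamma>_mult_right \<gamma>_nonzero)

private lemma \<gamma>_nondegenerate: "nondegenerate_form (G\<lparr>carrier := A\<rparr>) \<gamma>"
  unfolding nondegenerate_form_def iso_def bij_betw_def
proof (intro CollectI conjI)
  let ?f = "\<lambda>s. \<lambda>t\<in>carrier (G\<lparr>carrier := A\<rparr>). \<gamma> s t"
  let ?H = "character_group (G\<lparr>carrier := A\<rparr>) :: ('a \<Rightarrow> 'k) monoid"
  show "?f \<in> hom (G\<lparr>carrier := A\<rparr>) ?H"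
    by (auto simp: hom_def character_group_def field_units_def \<gamma>_mult \<gamma>_mult_right \<gamma>_nonzero A_mult
        restrict_def extensional_def)
  show "inj_on ?f (carrier (G\<lparr>carrier := A\<rparr>))"
  proof (rule inj_onI)
    fix s s' assume s: "s \<in> carrier (G\<lparr>carrier := A\<rparr>)" "s' \<in> carrier (G\<lparr>carrier := A\<rparr>)" "?f s = ?f s'"
    have "R (s, t) = R (s', t)" for t
    proof (cases "t \<in> A")
      case True
      then have "\<gamma> s t = \<gamma> s' t" using fun_cong [OF s(3), of t] by simp
      then show ?thesis using s R_eq [of s] R_eq [of s'] by simp
    next
      case False
      then show ?thesis using A_support(2) by metis
    qed
    \<comment> \<open>Equal rows would be orthogonal if s and s' differed, but r_s is a nonzero
      idempotent.\<close>
    then have "r s \<star> r s' = r s \<star> r s" by simp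
    then show "s = s'"
      using s r_mult [of s s'] r_mult [of s s] by (auto simp: A_def split: if_splits)
  qed
  show "?f ` carrier (G\<lparr>carrier := A\<rparr>) = carrier ?H"
  proof
    show "?f ` carrier (G\<lparr>carrier := A\<rparr>) \<subseteq> carrier ?H"
      by (auto simp: hom_def character_group_def field_units_def \<gamma>_mult_right \<gamma>_nonzero A_mult)
    show "carrier ?H \<subseteq> ?f ` carrier (G\<lparr>carrier := A\<rparr>)"
    proof
      fix \<chi> assume \<chi>: "\<chi> \<in> carrier ?H"
      then have "\<chi> \<in> hom (G\<lparr>carrier := A\<rparr>) (field_units :: 'k monoid)" by (simp add: character_group_def)
      then obtain y where y: "y \<in> A" "\<forall>x\<in>A. \<chi> x = \<gamma> x y" using character_eq by blast
      \<comment> \<open>In \<open>character_eq\<close> the element y stands in the second variable;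
        \<gamma>(x,y) = \<gamma>(y^-1,x) brings it into the first at the price of an
        inverse.\<close>
      have "\<chi> = ?f (inv y)"
      proof
        fix x show "\<chi> x = ?f (inv y) x"
          using \<chi> y \<gamma>_skew [of y x] by (auto simp: character_group_def extensional_def)
      qed
      then show "\<chi> \<in> ?f ` carrier (G\<lparr>carrier := A\<rparr>)" using y A_inv by auto
    qed
  qed
qed

text \<open>Skewness gives \<gamma>(x,x)^2 = 1, and \<gamma>(x,x) to the odd power |G| is 1 as well,
  which excludes the value -1.\<close>

private lemma \<gamma>_alternative:
  assumes "odd (Coset.order G)" "x \<in> A"
  shows "\<gamma> x x = 1"
proof -
  have sq: "\<gamma> x x * \<gamma> x x = 1" using \<gamma>_skew [of x x] \<gamma>_inv [of x x] assms by simp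
  have "x [^] n \<in> A \<and> \<gamma> (x [^] n) x = \<gamma> x x ^ n" for n :: nat
    using assms by (induction n) (auto simp: A_one \<gamma>_one A_mult \<gamma>_mult)
  then have pow: "\<gamma> (x [^] n) x = \<gamma> x x ^ n" for n :: nat by blast
  have 1: "\<gamma> x x ^ Coset.order G = 1"
    using pow [of "Coset.order G"] assms by (simp add: pow_order_eq_1 A_carrier \<gamma>_one)
  obtain l where l: "Coset.order G = 2 * l + 1" using assms(1) by (rule oddE)
  have "\<gamma> x x ^ (2 * l) = 1" unfolding power_mult power2_eq_square sq by simp
  then show ?thesis using 1 by (simp add: l)
qed

theorem triangular_eq_form_twist:
  assumes "odd (Coset.order G)" "\<phi> \<in> iso G G"
  shows "\<exists>S \<beta>. normal_form_data G \<phi> S \<beta> \<and> R = form_twist S \<beta>"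
proof (intro exI conjI)
  have "comm_group (G\<lparr>carrier := A\<rparr>)"
  proof -
    interpret S: group "G\<lparr>carrier := A\<rparr>" by (rule subgroup_imp_group [OF A_subgroup])
    show ?thesis by (rule S.group_comm_groupI) (simp add: A_comm)
  qed
  moreover have "invariant_form G A \<gamma>"
    unfolding invariant_form_def
  proof (intro ballI)
    fix g s t assume g: "g \<in> carrier G" and s: "s \<in> A" and t: "t \<in> A"
    have "g \<otimes> s \<otimes> inv g \<in> A" using A_normal g s by (simp add: normal_inv_iff)
    then show "\<gamma> (g \<otimes> s \<otimes> inv g) (g \<otimes> t \<otimes> inv g) = \<gamma> s t"
      using R_invariant [OF g A_carrier [OF s] A_carrier [OF t]] R_one s by (simp add: \<gamma>_def)
  qed
  ultimately show "normal_form_data G \<phi> A \<gamma>"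
    using assms by (simp add: normal_form_data_def A_normal \<gamma>_bimultiplicative alternative_form_def
        \<gamma>_nondegenerate \<gamma>_alternative)
  show "R = form_twist A \<gamma>" by (rule R_form_twist)
qed

end
end

section \<open>Operators on finitely supported functions\<close>

text \<open>Gaussian elimination, one coordinate of \<open>S\<close> at a time.\<close>

lemma exists_linear_relation:
  fixes v :: "'i \<Rightarrow> 'a \<Rightarrow> 'k::field"
  assumes "finite S" "finite I" "card S < card I"
  shows "\<exists>c. (\<exists>i\<in>I. c i \<noteq> 0) \<and> (\<forall>s\<in>S. (\<Sum>i\<in>I. c i * v i s) = 0)"
  using assms
proof (induction S arbitrary: I v rule: finite_induct)
  case empty
  then obtain i where "i \<in> I" by fastforce
  then show ?case by (intro exI [of _ "\<lambda>_. 1"]) auto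
next
  case (insert s\<^sub>0 S)
  show ?case
  proof (cases "\<forall>i\<in>I. v i s\<^sub>0 = 0")
    case True
    with insert.IH [of I v] insert.prems insert.hyps show ?thesis by auto
  next
    case False
    then obtain j where j: "j \<in> I" "v j s\<^sub>0 \<noteq> 0" by blast
    \<comment> \<open>The pivot vector v_j clears the coordinate \<open>s\<^sub>0\<close> of the
      others; its coefficient in \<open>c'\<close> below collects the multiples that were
      subtracted.\<close>
    define v' where "v' i s = v i s - v i s\<^sub>0 / v j s\<^sub>0 * v j s" for i s
    have "card S < card (I - {j})" using insert j by simp
    with insert.IH [of "I - {j}" v'] insert.prems obtain c where
      c: "\<exists>i\<in>I - {j}. c i \<noteq> 0" "\<forall>s\<in>S. (\<Sum>i\<in>I - {j}. c i * v' i s) = 0" by auto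
    define c' where "c' = c(j := - (\<Sum>i\<in>I - {j}. c i * (v i s\<^sub>0 / v j s\<^sub>0)))"
    have sum: "(\<Sum>i\<in>I. c' i * v i s) = (\<Sum>i\<in>I - {j}. c i * v' i s)" for s
    proof -
      have "(\<Sum>i\<in>I. c' i * v i s) = c' j * v j s + (\<Sum>i\<in>I - {j}. c' i * v i s)"
        using insert.prems j by (intro sum.remove)
      also have "(\<Sum>i\<in>I - {j}. c' i * v i s) = (\<Sum>i\<in>I - {j}. c i * v i s)"
        by (intro sum.cong) (auto simp: c'_def)
      also have "c' j * v j s + \<dots> = (\<Sum>i\<in>I - {j}. c i * v' i s)"
        by (simp add: c'_def v'_def algebra_simps sum_subtractf sum_distrib_left)
      finally show ?thesis .
    qed
    have "\<exists>i\<in>I. c' i \<noteq> 0" using c(1) by (auto simp: c'_def)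
    moreover have "v' i s\<^sub>0 = 0" for i using j by (simp add: v'_def)
    ultimately show ?thesis using c(2) by (intro exI [of _ c']) (auto simp: sum)
  qed
qed

text \<open>\<open>E\<close> is any T-stable subspace rather than the whole function space, because
  simultaneous eigenvectors are found by restricting one operator to a joint eigenspace of the
  others. Finiteness of \<open>S\<close> keeps \<open>E\<close> finite-dimensional, and the nonzero
  vector \<open>w\<close> generates the sequence w, T w, T^2 w, ...\<close>

locale finitely_supported_operator =
  fixes S :: "'a set" and E :: "('a \<Rightarrow> 'k::field) set" and T :: "('a \<Rightarrow> 'k) \<Rightarrow> 'a \<Rightarrow> 'k"
    and w :: "'a \<Rightarrow> 'k"
  assumes finite_S: "finite S"
    and support: "\<And>x s. x \<in> E \<Longrightarrow> s \<notin> S \<Longrightarrow> x s = 0"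
    and add_closed: "\<And>x y. x \<in> E \<Longrightarrow> y \<in> E \<Longrightarrow> (\<lambda>s. x s + y s) \<in> E"
    and smult_closed: "\<And>c x. x \<in> E \<Longrightarrow> (\<lambda>s. c * x s) \<in> E"
    and T_closed: "\<And>x. x \<in> E \<Longrightarrow> T x \<in> E"
    and T_add: "\<And>x y. x \<in> E \<Longrightarrow> y \<in> E \<Longrightarrow> T (\<lambda>s. x s + y s) = (\<lambda>s. T x s + T y s)"
    and T_smult: "\<And>c x. x \<in> E \<Longrightarrow> T (\<lambda>s. c * x s) = (\<lambda>s. c * T x s)"
    and w: "w \<in> E" "w \<noteq> (\<lambda>_. 0)"
begin

lemma zero_closed: "(\<lambda>_. 0) \<in> E"
  using smult_closed [OF w(1), of 0] by simp

lemma sum_closed: "(\<And>i. i \<in> I \<Longrightarrow> x i \<in> E) \<Longrightarrow> (\<lambda>s. \<Sum>i\<in>I. x i s) \<in> E"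
proof (induction I rule: infinite_finite_induct)
  case (insert i I)
  then show ?case using add_closed by simp
qed (simp_all add: zero_closed)

lemma T_zero: "T (\<lambda>_. 0) = (\<lambda>_. 0)"
  using T_smult [OF w(1), of 0] by simp

lemma T_sum: "(\<And>i. i \<in> I \<Longrightarrow> x i \<in> E) \<Longrightarrow> T (\<lambda>s. \<Sum>i\<in>I. x i s) = (\<lambda>s. \<Sum>i\<in>I. T (x i) s)"
proof (induction I rule: infinite_finite_induct)
  case (insert i I)
  then have "x i \<in> E" "(\<lambda>s. \<Sum>i\<in>I. x i s) \<in> E" by (auto intro: sum_closed)
  from T_add [OF this] insert show ?case by simp
qed (simp_all add: T_zero)

lemma funpow_closed: "(T ^^ i) w \<in> E"
  by (induction i) (auto simp: w T_closed)

text \<open>The vector \<open>p(T) w\<close>.\<close>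

definition eval_at :: "'k poly \<Rightarrow> 'a \<Rightarrow> 'k" where
  "eval_at p = (\<lambda>s. \<Sum>i\<le>degree p. coeff p i * (T ^^ i) w s)"

lemma eval_at_bound: "degree p \<le> n \<Longrightarrow> eval_at p = (\<lambda>s. \<Sum>i\<le>n. coeff p i * (T ^^ i) w s)"
  unfolding eval_at_def by (intro ext sum.mono_neutral_left) (auto simp: coeff_eq_0)

lemma eval_at_closed: "eval_at p \<in> E"
  unfolding eval_at_def by (intro sum_closed smult_closed funpow_closed)

lemma eval_at_pCons: "eval_at (pCons a p) = (\<lambda>s. a * w s + T (eval_at p) s)"
proof -
  have "eval_at (pCons a p) = (\<lambda>s. \<Sum>i\<le>Suc (degree p). coeff (pCons a p) i * (T ^^ i) w s)"
    by (rule eval_at_bound) (rule degree_pCons_le)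
  also have "\<dots> = (\<lambda>s. a * w s + (\<Sum>i\<le>degree p. coeff p i * T ((T ^^ i) w) s))"
    by (simp add: sum.atMost_Suc_shift del: sum.atMost_Suc)
  also have "\<dots> = (\<lambda>s. a * w s + T (eval_at p) s)"
    unfolding eval_at_def
    by (subst T_sum) (auto simp: smult_closed funpow_closed T_smult)
  finally show ?thesis .
qed

lemma eval_at_add: "eval_at (p + q) = (\<lambda>s. eval_at p s + eval_at q s)"
proof -
  let ?n = "max (degree p) (degree q)"
  have "eval_at (p + q) = (\<lambda>s. \<Sum>i\<le>?n. coeff (p + q) i * (T ^^ i) w s)"
    by (rule eval_at_bound) (rule degree_add_le_max)
  then show ?thesis
    using eval_at_bound [of p ?n] eval_at_bound [of q ?n] by (simp add: algebra_simps sum.distrib)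
qed

lemma eval_at_smult: "eval_at (smult c p) = (\<lambda>s. c * eval_at p s)"
  using eval_at_bound [of "smult c p" "degree p"]
  by (simp add: degree_smult_le eval_at_def sum_distrib_left mult.assoc)

text \<open>The minimal polynomial of \<open>w\<close> under \<open>T\<close>. It exists because the
  |S| + 1 vectors w, T w, ..., T^|S| w are linearly dependent.\<close>

lemma minimal_annihilator:
  obtains p where "p \<noteq> 0" "eval_at p = (\<lambda>_. 0)"
    "\<And>q. q \<noteq> 0 \<Longrightarrow> degree q < degree p \<Longrightarrow> eval_at q \<noteq> (\<lambda>_. 0)"
proof -
  let ?P = "\<lambda>p. p \<noteq> 0 \<and> eval_at p = (\<lambda>_. 0)"
  obtain c where c: "\<exists>i\<in>{..card S}. c i \<noteq> 0"
      "\<And>s. s \<in> S \<Longrightarrow> (\<Sum>i\<le>card S. c i * (T ^^ i) w s) = 0"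
    using exists_linear_relation [OF finite_S, of "{..card S}" "\<lambda>i. (T ^^ i) w"] by auto
  define p where "p = (\<Sum>i\<le>card S. monom (c i) i)"
  have coeff: "coeff p i = (if i \<le> card S then c i else 0)" for i
    unfolding p_def by (simp add: coeff_sum sum.delta)
  then have "degree p \<le> card S" by (intro degree_le) auto
  then have "eval_at p = (\<lambda>s. \<Sum>i\<le>card S. c i * (T ^^ i) w s)"
    by (subst eval_at_bound) (auto simp: coeff)
  moreover have "(\<Sum>i\<le>card S. c i * (T ^^ i) w s) = 0" for s
    using c(2) support [OF funpow_closed] by (cases "s \<in> S") auto
  moreover have "p \<noteq> 0" using c(1) coeff by (metis atMost_iff coeff_0)
  ultimately have "?P p" by simp
  then obtain p where "?P p" "\<And>q. ?P q \<Longrightarrow> degree p \<le> degree q"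
    using ex_has_least_nat [of ?P p degree] by blast
  then show ?thesis using that [of p] by (metis linorder_not_less)
qed

end

text \<open>For a root z of the minimal polynomial p = (X - z) q of \<open>w\<close>, the vector
  q(T) w is nonzero by minimality and is killed by T - z.\<close>

lemma eigenvector_exists:
  fixes T :: "('a \<Rightarrow> 'k::alg_closed_field) \<Rightarrow> 'a \<Rightarrow> 'k"
  assumes "finitely_supported_operator S E T w"
  shows "\<exists>v\<in>E. v \<noteq> (\<lambda>_. 0) \<and> (\<exists>c. T v = (\<lambda>s. c * v s))"
proof -
  interpret finitely_supported_operator S E T w by fact
  obtain p where p: "p \<noteq> 0" "eval_at p = (\<lambda>_. 0)"
    "\<And>q. q \<noteq> 0 \<Longrightarrow> degree q < degree p \<Longrightarrow> eval_at q \<noteq> (\<lambda>_. 0)"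
    by (rule minimal_annihilator) blast
  have "degree p \<noteq> 0"
  proof
    assume "degree p = 0"
    then obtain a where a: "p = [:a:]" by (metis degree_eq_zeroE)
    then have "(\<lambda>s. a * w s) = (\<lambda>_. 0)" using p(2) by (simp add: eval_at_def)
    moreover have "a \<noteq> 0" using a p(1) by simp
    ultimately have "w = (\<lambda>_. 0)" by (metis mult_eq_0_iff)
    with w show False by simp
  qed
  then obtain z where "poly p z = 0" using alg_closed_imp_poly_has_root by blast
  then obtain q where q: "p = [:- z, 1:] * q" by (metis dvdE poly_eq_0_iff_dvd)
  then have "q \<noteq> 0" using p(1) by auto
  moreover have "degree p = Suc (degree q)"
    unfolding q using \<open>q \<noteq> 0\<close> by (subst degree_mult_eq) auto
  ultimately have "eval_at q \<noteq> (\<lambda>_. 0)" using p(3) by auto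
  moreover have "T (eval_at q) = (\<lambda>s. z * eval_at q s)"
  proof
    fix s
    have "p = smult (- z) q + pCons 0 q" by (simp add: q)
    then have "eval_at p = (\<lambda>s. - z * eval_at q s + T (eval_at q) s)"
      by (simp only: eval_at_add eval_at_smult eval_at_pCons) simp
    with p(2) have "- z * eval_at q s + T (eval_at q) s = 0" by metis
    then show "T (eval_at q) s = z * eval_at q s" by (simp add: eq_neg_iff_add_eq_0 algebra_simps)
  qed
  ultimately show ?thesis using eval_at_closed by blast
qed

lemma (in finite_group) common_eigenvector:
  fixes T :: "'i \<Rightarrow> ('a \<Rightarrow> 'k::alg_closed_field) \<Rightarrow> 'a \<Rightarrow> 'k"
  assumes "finite I"
    and closed: "\<And>i x. i \<in> I \<Longrightarrow> x \<in> carrier (GA G) \<Longrightarrow> T i x \<in> carrier (GA G)"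
    and add: "\<And>i x y. i \<in> I \<Longrightarrow> x \<in> carrier (GA G) \<Longrightarrow> y \<in> carrier (GA G) \<Longrightarrow>
      T i (\<lambda>s. x s + y s) = (\<lambda>s. T i x s + T i y s)"
    and smult: "\<And>i c x. i \<in> I \<Longrightarrow> x \<in> carrier (GA G) \<Longrightarrow> T i (\<lambda>s. c * x s) = (\<lambda>s. c * T i x s)"
    and commute: "\<And>i j x. i \<in> I \<Longrightarrow> j \<in> I \<Longrightarrow> x \<in> carrier (GA G) \<Longrightarrow> T i (T j x) = T j (T i x)"
  shows "\<exists>c w. w \<in> carrier (GA G) \<and> w \<noteq> (\<lambda>_. 0) \<and> (\<forall>i\<in>I. T i w = (\<lambda>s. c i * w s))"
  using assms
proof (induction I rule: finite_induct)
  case empty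
  show ?case
    by (rule exI, rule exI [of _ "basis_elem \<one>"])
       (auto simp: basis_elem_def fun_eq_iff group_algebra_carrier)
next
  case (insert j I)
  have "\<exists>c w. w \<in> carrier (GA G) \<and> w \<noteq> (\<lambda>_. 0) \<and> (\<forall>i\<in>I. T i w = (\<lambda>s. c i * w s))"
    by (rule insert.IH) (use insert.prems in auto)
  then obtain c w where w: "w \<in> carrier (GA G)" "w \<noteq> (\<lambda>_. 0)" "\<forall>i\<in>I. T i w = (\<lambda>s. c i * w s)"
    by blast
  \<comment> \<open>The joint eigenspace of the operators treated so far, with their eigenvalues
    held fixed; \<open>T j\<close> maps it to itself because it commutes with them.\<close>
  define E where "E = {x \<in> carrier (GA G). \<forall>i\<in>I. T i x = (\<lambda>s. c i * x s)}"
  have "finitely_supported_operator (carrier G) E (T j) w"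
  proof
    fix x y assume xy: "x \<in> E" "y \<in> E"
    then show "(\<lambda>s. x s + y s) \<in> E"
      using insert.prems by (auto simp: E_def group_algebra_carrier algebra_simps)
    show "T j (\<lambda>s. x s + y s) = (\<lambda>s. T j x s + T j y s)"
      using xy insert.prems by (simp add: E_def)
  next
    fix x and b :: 'k assume x: "x \<in> E"
    then show "(\<lambda>s. b * x s) \<in> E"
      using insert.prems by (auto simp: E_def group_algebra_carrier algebra_simps)
    show "T j (\<lambda>s. b * x s) = (\<lambda>s. b * T j x s)"
      using x insert.prems by (simp add: E_def)
  next
    fix x assume x: "x \<in> E"
    have "T i (T j x) = (\<lambda>s. c i * T j x s)" if "i \<in> I" for i
    proof -
      have "T i (T j x) = T j (T i x)"
        using x that by (intro insert.prems) (auto simp: E_def)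
      also have "T i x = (\<lambda>s. c i * x s)" using x that by (simp add: E_def)
      finally show ?thesis using x insert.prems by (simp add: E_def)
    qed
    then show "T j x \<in> E" using x insert.prems by (simp add: E_def)
  qed (use w in \<open>auto simp: E_def group_algebra_carrier\<close>)
  then obtain v b where v: "v \<in> E" "v \<noteq> (\<lambda>_. 0)" "T j v = (\<lambda>s. b * v s)"
    using eigenvector_exists by blast
  show ?case
    by (rule exI [of _ "c(j := b)"], rule exI [of _ v])
       (use v insert.hyps in \<open>auto simp: E_def\<close>)
qed

text \<open>The minimal polynomial of 1 under left multiplication by b has a nonzero constant term,
  since otherwise one factor b could be cancelled by a from the left. Solving for the constant term
  gives 1 = b z with z a polynomial in b, and ab = 1 then forces z = a.\<close>

lemma (in finite_group) right_invertible_Units: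
  fixes a b :: "'a \<Rightarrow> 'k::field"
  assumes a: "a \<in> carrier (GA G)" and b: "b \<in> carrier (GA G)" and ab: "a \<otimes>\<^bsub>GA G\<^esub> b = \<one>\<^bsub>GA G\<^esub>"
  shows "a \<in> Units (GA G)"
proof -
  interpret T: finitely_supported_operator "carrier G" "carrier (GA G)" "\<lambda>x. b \<otimes>\<^bsub>GA G\<^esub> x" "\<one>\<^bsub>GA G\<^esub>"
  proof
    show "\<one>\<^bsub>GA G\<^esub> \<noteq> (\<lambda>_. 0 :: 'k)" by (auto simp: group_algebra_one basis_elem_def fun_eq_iff)
    fix x y :: "'a \<Rightarrow> 'k" assume "x \<in> carrier (GA G)" "y \<in> carrier (GA G)"
    then show "b \<otimes>\<^bsub>GA G\<^esub> (\<lambda>s. x s + y s) = (\<lambda>s. (b \<otimes>\<^bsub>GA G\<^esub> x) s + (b \<otimes>\<^bsub>GA G\<^esub> y) s)"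
      using A.r_distr [of x y b] b by (simp add: group_algebra_add)
  qed (use b group_algebra_carrierD [OF A.one_closed] in
      \<open>auto simp: group_algebra_carrier smult_mult_right mult_outside\<close>)
  obtain p where p: "p \<noteq> 0" "T.eval_at p = (\<lambda>_. 0)"
    "\<And>q. q \<noteq> 0 \<Longrightarrow> degree q < degree p \<Longrightarrow> T.eval_at q \<noteq> (\<lambda>_. 0)"
    by (rule T.minimal_annihilator) blast
  obtain c q where pq: "p = pCons c q" by (cases p)
  let ?y = "T.eval_at q"
  have y: "?y \<in> carrier (GA G)" by (rule T.eval_at_closed)
  have eq: "c * \<one>\<^bsub>GA G\<^esub> s + (b \<otimes>\<^bsub>GA G\<^esub> ?y) s = 0" for s
    using p(2) unfolding pq T.eval_at_pCons by (rule fun_cong)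
  have "c \<noteq> 0"
  proof
    assume c: "c = 0"
    then have q: "q \<noteq> 0" using p(1) pq by auto
    have "b \<otimes>\<^bsub>GA G\<^esub> ?y = (\<lambda>_. 0)" using eq c by (auto simp: fun_eq_iff)
    then have "a \<otimes>\<^bsub>GA G\<^esub> (b \<otimes>\<^bsub>GA G\<^esub> ?y) = (\<lambda>_. 0)"
      using smult_mult_right [of a 0 "\<lambda>_. 0"] by simp
    then have "?y = (\<lambda>_. 0)" using a b y ab by (simp add: A.m_assoc [symmetric])
    moreover have "degree q < degree p" using q by (simp add: pq)
    ultimately show False using p(3) q by blast
  qed
  define z where "z = (\<lambda>s. - 1 / c * ?y s)"
  have z: "z \<in> carrier (GA G)" using y by (simp add: z_def group_algebra_carrier)
  have "b \<otimes>\<^bsub>GA G\<^esub> z = \<one>\<^bsub>GA G\<^esub>"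
  proof
    fix s show "(b \<otimes>\<^bsub>GA G\<^esub> z) s = \<one>\<^bsub>GA G\<^esub> s"
    proof -
      have "(b \<otimes>\<^bsub>GA G\<^esub> ?y) s = - (c * \<one>\<^bsub>GA G\<^esub> s)"
        using eq [of s] by (simp add: eq_neg_iff_add_eq_0 add.commute)
      then show ?thesis using \<open>c \<noteq> 0\<close> unfolding z_def smult_mult_right by simp
    qed
  qed
  moreover from this have "z = a"
    using A.m_assoc [OF a b z] ab a z by simp
  ultimately show ?thesis using a b ab by (auto simp: Units_def)
qed

section \<open>Symmetric twists are trivial\<close>

context finite_group_powers
begin

lemma pushforward_snd_alg_hom: "pushforward GG snd \<in> alg_hom GG G"
  by (rule pushforward_alg_hom [OF fg(2,1)]) (auto simp: hom_def)

lemma pushforward_snd_tensor: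
  assumes "y \<in> carrier (GA G)"
  shows "pushforward GG snd (tensor x y) = (\<lambda>b. counit G x * y b)"
proof
  fix b
  have "pushforward GG snd (tensor x y) b =
      (\<Sum>g\<in>carrier G. \<Sum>h\<in>carrier G. if h = b then x g * y h else 0)"
    unfolding pushforward_apply sum.cartesian_product by (auto intro!: sum.cong)
  then show "pushforward GG snd (tensor x y) b = counit G x * y b"
    using group_algebra_carrierD [OF assms, of b]
    by (cases "b \<in> carrier G") (simp_all add: counit_def sum_distrib_right)
qed

lemma pushforward_snd_coproduct:
  "x \<in> carrier (GA G) \<Longrightarrow> pushforward GG snd (coproduct G x) = x"
  unfolding coproduct_eq
  by (subst pushforward_pushforward [OF fg(2)]) (auto simp: pushforward_id)

text \<open>Right multiplication by 1 \<otimes> K leaves the first leg alone and acts on each slice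
  separately. This lets a triple product be read as an iterate of the operators \<open>T h\<close>
  of \<open>symmetric_twist_trivial\<close>.\<close>

lemma embed23_mult_slice:
  assumes K: "K \<in> carrier kG2" and "a \<in> carrier G" "b \<in> carrier G" "c \<in> carrier G"
  shows "(u \<star>\<^sub>3 embed23 K) (a, b, c) = ((\<lambda>p. u (a, p)) \<star>\<^sub>2 K) (b, c)"
proof -
  have inv: "inv x \<otimes> a = \<one> \<longleftrightarrow> x = a" if "x \<in> carrier G" for x
    using that assms by (metis inv_closed inv_equality inv_inv l_inv)
  have "(u \<star>\<^sub>3 embed23 K) (a, b, c) =
     (\<Sum>x\<in>carrier G. \<Sum>p\<in>carrier GG. u (x, p) * embed23 K (inv x \<otimes> a, inv\<^bsub>G \<times>\<times> G\<^esub> p \<otimes>\<^bsub>G \<times>\<times> G\<^esub> (b, c)))"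
    using assms
    by (subst G3.mult_apply) (auto simp: inv_DirProd is_group G2.is_group sum.cartesian_product
        intro!: sum.cong)
  also have "\<dots> = (\<Sum>x\<in>carrier G. if x = a then
       (\<Sum>p\<in>carrier GG. u (a, p) * K (inv\<^bsub>G \<times>\<times> G\<^esub> p \<otimes>\<^bsub>G \<times>\<times> G\<^esub> (b, c))) else 0)"
  proof (intro sum.cong refl)
    fix x assume "x \<in> carrier G"
    moreover have "embed23 K (x, p) = (if x = \<one> then K p else 0)" for x p
      using K by (cases p) (simp add: leg_apply)
    ultimately show "(\<Sum>p\<in>carrier GG. u (x, p) * embed23 K (inv x \<otimes> a, inv\<^bsub>G \<times>\<times> G\<^esub> p \<otimes>\<^bsub>G \<times>\<times> G\<^esub> (b, c))) =
      (if x = a then (\<Sum>p\<in>carrier GG. u (a, p) * K (inv\<^bsub>G \<times>\<times> G\<^esub> p \<otimes>\<^bsub>G \<times>\<times> G\<^esub> (b, c))) else 0)"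
      by (simp add: inv del: carrier_DirProd)
  qed
  also have "\<dots> = ((\<lambda>p. u (a, p)) \<star>\<^sub>2 K) (b, c)"
    using assms by (simp add: G2.mult_apply)
  finally show ?thesis .
qed

lemma tensor_one_mult_slice:
  assumes "a \<in> carrier (GA G)" "b \<in> carrier G" "c \<in> carrier G"
  shows "(tensor a \<one>\<^bsub>GA G\<^esub> \<star>\<^sub>2 u) (b, c) = (a \<star> (\<lambda>x. u (x, c))) b"
proof -
  have "(tensor a \<one>\<^bsub>GA G\<^esub> \<star>\<^sub>2 u) (b, c) =
     (\<Sum>x\<in>carrier G. \<Sum>y\<in>carrier G. if y = \<one> then a x * u (inv x \<otimes> b, inv y \<otimes> c) else 0)"
  proof -
    have "(tensor a \<one>\<^bsub>GA G\<^esub> \<star>\<^sub>2 u) (b, c) = (\<Sum>(x, y)\<in>carrier G \<times> carrier G.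
        if y = \<one> then a x * u (inv x \<otimes> b, inv y \<otimes> c) else 0)"
      using assms
      by (subst G2.mult_apply) (auto simp: inv_DirProd is_group group_algebra_one
          basis_elem_def intro!: sum.cong)
    then show ?thesis by (simp only: sum.cartesian_product)
  qed
  then show ?thesis using assms by (simp add: mult_apply)
qed

text \<open>With K = J^-1, the map x \<mapsto> \<Delta>(x) K is the transpose of a product on the
  dual of k[G], and \<open>T h\<close> is the transpose of multiplication by the dual basis vector
  of h. The cocycle condition is associativity of this product and symmetry of K is commutativity,
  so the \<open>T h\<close> commute. A common eigenvector w satisfies \<Delta>(w) K = a \<otimes> w,
  where a lists the eigenvalues.\<close>

theorem symmetric_twist_trivial:
  fixes J :: "'a \<times> 'a \<Rightarrow> 'k::alg_closed_field"
  assumes J: "J \<in> Units kG2" and sym: "flip J = J" and cocycle: "twist_cocycle J"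
  shows "\<exists>a\<in>Units (GA G). coproduct G a = tensor a a \<star>\<^sub>2 J"
proof -
  define K where "K = inv\<^bsub>kG2\<^esub> J"
  have K: "K \<in> carrier kG2" and JC: "J \<in> carrier kG2" and JK: "J \<star>\<^sub>2 K = \<one>\<^bsub>kG2\<^esub>" "K \<star>\<^sub>2 J = \<one>\<^bsub>kG2\<^esub>"
    using J by (auto simp: K_def)
  have symK: "flip K = K" using J by (simp add: K_def leg_inv sym)
  have cocK: "coproduct1 K \<star>\<^sub>3 embed12 K = coproduct2 K \<star>\<^sub>3 embed23 K"
    using cocycle J unfolding K_def twist_cocycle_def
    by (simp add: leg_inv inv_mult_Units [OF G3.A.monoid_axioms, symmetric])
  define T where "T h x = (\<lambda>g. (coproduct G x \<star>\<^sub>2 K) (h, g))" for h x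
  have slice: "(coproduct2 z \<star>\<^sub>3 embed23 K) (h', h, g) = T h (\<lambda>g. z (h', g)) g"
    if "z \<in> carrier kG2" "h' \<in> carrier G" "h \<in> carrier G" "g \<in> carrier G" for z h' h g
  proof -
    have "(\<lambda>p. coproduct2 z (h', p)) = coproduct G (\<lambda>g. z (h', g))"
    proof
      fix p :: "'a \<times> 'a"
      have "(\<lambda>g. z (h', g)) \<in> carrier (GA G)" using that(1) by (auto simp: group_algebra_carrier)
      then show "coproduct2 z (h', p) = coproduct G (\<lambda>g. z (h', g)) p"
        using that(1) by (cases p) (simp add: leg_apply coproduct_apply)
    qed
    then show ?thesis using that by (simp add: embed23_mult_slice K T_def)
  qed
  have T_closed: "T h x \<in> carrier (GA G)" if "x \<in> carrier (GA G)" for h x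
    by (auto simp: T_def group_algebra_carrier intro!: G2.mult_outside)
  have "\<exists>c w. w \<in> carrier (GA G) \<and> w \<noteq> (\<lambda>_. 0) \<and> (\<forall>h\<in>carrier G. T h w = (\<lambda>s. c h * w s))"
  proof (rule common_eigenvector)
    fix h and x y :: "'a \<Rightarrow> 'k" assume xy: "x \<in> carrier (GA G)" "y \<in> carrier (GA G)"
    have "coproduct G (\<lambda>s. x s + y s) \<star>\<^sub>2 K =
        (\<lambda>p. (coproduct G x \<star>\<^sub>2 K) p + (coproduct G y \<star>\<^sub>2 K) p)"
      using G2.A.l_distr [of "coproduct G x" "coproduct G y" K] xy K
      by (simp add: group_algebra_add alg_hom_add [OF leg_alg_hom(7)])
    then show "T h (\<lambda>s. x s + y s) = (\<lambda>s. T h x s + T h y s)" by (simp add: T_def)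
  next
    fix h c and x :: "'a \<Rightarrow> 'k" assume "x \<in> carrier (GA G)"
    then show "T h (\<lambda>s. c * x s) = (\<lambda>s. c * T h x s)"
      by (simp add: T_def alg_hom_smult [OF leg_alg_hom(7)] G2.smult_mult_left)
  next
    fix h h' and x :: "'a \<Rightarrow> 'k" assume h: "h \<in> carrier G" "h' \<in> carrier G" and x: "x \<in> carrier (GA G)"
    \<comment> \<open>The coefficient of Z at k' \<otimes> k \<otimes> g is that of T_k (T_k' x) at
      g. Once (I \<otimes> \<Delta>)(K) K_23 is rewritten as (\<Delta> \<otimes> I)(K) K_12, every
      factor of Z is visibly symmetric in the first two legs.\<close>
    define Z where "Z = coproduct2 (coproduct G x \<star>\<^sub>2 K) \<star>\<^sub>3 embed23 K"
    have Z: "Z = coproduct2 (coproduct G x) \<star>\<^sub>3 (coproduct1 K \<star>\<^sub>3 embed12 K)"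
      using x K unfolding Z_def cocK by (simp add: leg_mult G3.A.m_assoc)
    have ZC: "Z \<in> carrier kG3" using x K by (simp add: Z_def)
    have "permute3 swap12 Z = Z"
      unfolding Z using x K by (simp add: permute3_mult permute3_leg leg_coproduct symK)
    moreover have "permute3 swap12 Z (a, b, c) = Z (b, a, c)" for a b c
      unfolding permute3_def
      by (subst pushforward_left_inverse_apply [OF fg(3) ZC, where \<psi> = swap12]) auto
    ultimately have Z_swap: "Z (a, b, c) = Z (b, a, c)" for a b c by metis
    have TT: "T k (T k' x) g = Z (k', k, g)" if "k \<in> carrier G" "k' \<in> carrier G" "g \<in> carrier G" for k k' g
      unfolding Z_def using slice [of "coproduct G x \<star>\<^sub>2 K" k' k g] that x K
      by (simp add: T_def [of k' x])
    show "T h (T h' x) = T h' (T h x)"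
      by (rule group_algebra_eqI [where G = G]) (use h x T_closed TT Z_swap in auto)
  qed (use T_closed in auto)
  then obtain c w where w: "w \<in> carrier (GA G)" "w \<noteq> (\<lambda>_. 0)"
    and Tw: "\<And>h. h \<in> carrier G \<Longrightarrow> T h w = (\<lambda>s. c h * w s)" by blast
  define a where "a h = (if h \<in> carrier G then c h else 0)" for h
  have a: "a \<in> carrier (GA G)" by (simp add: a_def group_algebra_carrier)
  let ?\<Delta>wK = "coproduct G w \<star>\<^sub>2 K"
  have \<Delta>w: "?\<Delta>wK = tensor a w"
  proof (rule group_algebra_eqI [where G = "G \<times>\<times> G"])
    fix p assume "p \<in> carrier GG"
    then obtain h g where p: "p = (h, g)" "h \<in> carrier G" "g \<in> carrier G" by auto
    then show "?\<Delta>wK p = tensor a w p"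
      using fun_cong [OF Tw [OF p(2)], of g] by (simp add: T_def a_def)
  qed (use a w K in auto)
  have "flip ?\<Delta>wK = ?\<Delta>wK"
    using w K by (simp add: leg_mult symK leg_coproduct)
  \<comment> \<open>Symmetry of \<Delta>(w) K reads a \<otimes> w = w \<otimes> a, so a is a
    multiple of w.\<close>
  then have swap: "a h * w g = w h * a g" for g h
    using leg_apply(6) [of "tensor a w" g h] a w unfolding \<Delta>w by (simp add: mult.commute)
  obtain g\<^sub>0 where g0: "w g\<^sub>0 \<noteq> 0" using w(2) by auto
  define d where "d = a g\<^sub>0 / w g\<^sub>0"
  have a_eq: "a = (\<lambda>h. d * w h)"
    using swap [of _ g\<^sub>0] g0 by (auto simp: d_def field_simps)
  have \<Delta>a: "coproduct G a \<star>\<^sub>2 K = tensor a a"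
  proof -
    have "coproduct G a \<star>\<^sub>2 K = (\<lambda>p. d * ?\<Delta>wK p)"
      using w by (simp add: a_eq alg_hom_smult [OF leg_alg_hom(7)] G2.smult_mult_left)
    also have "\<dots> = tensor a (\<lambda>h. d * w h)" unfolding \<Delta>w by (auto simp: tensor_def)
    finally show ?thesis unfolding a_eq [symmetric] .
  qed
  have \<Delta>aJ: "coproduct G a = tensor a a \<star>\<^sub>2 J"
    unfolding \<Delta>a [symmetric] using a K JC JK by (simp add: G2.A.m_assoc)
  have a_nonzero: "a \<noteq> (\<lambda>_. 0)"
  proof
    assume "a = (\<lambda>_. 0)"
    then have "?\<Delta>wK = (\<lambda>_. 0)" unfolding \<Delta>w by (auto simp: tensor_def)
    then have "?\<Delta>wK \<star>\<^sub>2 J = (\<lambda>_. 0)"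
      using G2.smult_mult_left [of 0 "\<lambda>_. 0" J] by simp
    then have "coproduct G w = (\<lambda>_. 0)" using w K JC JK by (simp add: G2.A.m_assoc)
    then have "w g\<^sub>0 = 0" using coproduct_apply [OF w(1), of g\<^sub>0 g\<^sub>0] by simp
    with g0 show False by simp
  qed
  define \<epsilon> where "\<epsilon> = counit G a"
  \<comment> \<open>Applying \<epsilon> \<otimes> I to \<Delta>(a) = (a \<otimes> a) J gives a =
    \<epsilon>(a) a j with j = (\<epsilon> \<otimes> I)(J), so \<epsilon>(a) = 0 would make a
    vanish.\<close>
  have "\<epsilon> \<noteq> 0"
  proof
    assume \<epsilon>0: "\<epsilon> = 0"
    have "a = pushforward GG snd (tensor a a) \<star> pushforward GG snd J"
      using a JC by (simp add: alg_hom_mult [OF pushforward_snd_alg_hom, symmetric]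
          \<Delta>aJ [symmetric] pushforward_snd_coproduct)
    then have "a = (\<lambda>_. 0)"
      using \<epsilon>0 smult_mult_left [of 0 a]
      by (simp add: pushforward_snd_tensor a \<epsilon>_def)
    with a_nonzero show False by simp
  qed
  \<comment> \<open>The sum of all group elements, an integral of k[G]: a \<Lambda> = \<epsilon>(a)
    \<Lambda>. Hence (a \<otimes> 1) Y = \<Delta>(a \<Lambda>) = \<epsilon>(a) \<Delta>(\<Lambda>)
    for the Y below. Taking the slice with second leg 1, where \<Delta>(\<Lambda>) reduces to the
    unit, exhibits a right inverse of a.\<close>
  define \<Lambda> where "\<Lambda> = (\<lambda>g. if g \<in> carrier G then 1 else 0 :: 'k)"
  have \<Lambda>: "\<Lambda> \<in> carrier (GA G)" by (simp add: \<Lambda>_def group_algebra_carrier)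
  have a\<Lambda>: "a \<star> \<Lambda> = (\<lambda>g. \<epsilon> * \<Lambda> g)"
  proof
    fix g show "(a \<star> \<Lambda>) g = \<epsilon> * \<Lambda> g"
      by (cases "g \<in> carrier G") (simp_all add: mult_apply mult_outside \<Lambda>_def \<epsilon>_def counit_def)
  qed
  define Y where "Y = tensor \<one>\<^bsub>GA G\<^esub> a \<star>\<^sub>2 (J \<star>\<^sub>2 coproduct G \<Lambda>)"
  have Y: "Y \<in> carrier kG2" using a JC \<Lambda> by (simp add: Y_def)
  have "tensor a \<one>\<^bsub>GA G\<^esub> \<star>\<^sub>2 Y = tensor a a \<star>\<^sub>2 (J \<star>\<^sub>2 coproduct G \<Lambda>)"
    unfolding Y_def using a JC \<Lambda>
    by (simp add: G2.A.m_assoc [symmetric] tensor_mult [OF fg(1,1)])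
  also have "\<dots> = coproduct G (a \<star> \<Lambda>)"
    using a JC \<Lambda> by (simp add: leg_mult \<Delta>aJ G2.A.m_assoc)
  also have "\<dots> = (\<lambda>p. \<epsilon> * coproduct G \<Lambda> p)"
    unfolding a\<Lambda> by (rule alg_hom_smult [OF leg_alg_hom(7) \<Lambda>])
  finally have TY: "tensor a \<one>\<^bsub>GA G\<^esub> \<star>\<^sub>2 Y = (\<lambda>p. \<epsilon> * coproduct G \<Lambda> p)" .
  define b where "b = (\<lambda>g. 1 / \<epsilon> * Y (g, \<one>))"
  have b: "b \<in> carrier (GA G)" using Y by (auto simp: b_def group_algebra_carrier)
  have "a \<star> b = \<one>\<^bsub>GA G\<^esub>"
  proof (rule group_algebra_eqI [where G = G])
    fix g assume g: "g \<in> carrier G"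
    have "(a \<star> b) g = 1 / \<epsilon> * (tensor a \<one>\<^bsub>GA G\<^esub> \<star>\<^sub>2 Y) (g, \<one>)"
      using a g unfolding b_def smult_mult_right by (simp add: tensor_one_mult_slice)
    also have "\<dots> = \<one>\<^bsub>GA G\<^esub> g"
      unfolding TY using \<open>\<epsilon> \<noteq> 0\<close> \<Lambda>
      by (simp add: coproduct_apply group_algebra_one basis_elem_def) (auto simp: \<Lambda>_def)
    finally show "(a \<star> b) g = \<one>\<^bsub>GA G\<^esub> g" .
  qed (use a b in auto)
  then have "a \<in> Units (GA G)" by (rule right_invertible_Units [OF a b])
  with \<Delta>aJ show ?thesis by blast
qed

section \<open>Normal forms\<close>

context
  fixes \<phi> :: "'a \<Rightarrow> 'a" and S :: "'a set" and \<beta> :: "'a \<Rightarrow> 'a \<Rightarrow> 'k::field_char_0"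
  assumes data: "normal_form_data G \<phi> S \<beta>"
begin

private lemma S_subgroup: "subgroup S G"
  using data by (simp add: normal_form_data_def normal_def)

private lemma S_carrier: "s \<in> S \<Longrightarrow> s \<in> carrier G"
  by (rule subgroup.mem_carrier [OF S_subgroup])

private lemma S_finite: "finite S"
  by (rule finite_subset [OF _ finite_carrier]) (auto simp: S_carrier)

private lemma S_closed: "s \<in> S \<Longrightarrow> t \<in> S \<Longrightarrow> s \<otimes> t \<in> S" "s \<in> S \<Longrightarrow> inv s \<in> S" "\<one> \<in> S"
  by (auto intro: subgroup.m_closed subgroup.m_inv_closed subgroup.one_closed S_subgroup)

private lemma card_S: "(of_nat (card S) :: 'k) \<noteq> 0"
  using S_finite S_closed(3) by (auto simp: card_eq_0_iff)

private lemma \<beta>_nonzero: "s \<in> S \<Longrightarrow> t \<in> S \<Longrightarrow> \<beta> s t \<noteq> 0"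
  using data by (auto simp: normal_form_data_def bimultiplicative_def hom_def field_units_def)

private lemma \<beta>_mult:
  "s \<in> S \<Longrightarrow> s' \<in> S \<Longrightarrow> t \<in> S \<Longrightarrow> \<beta> (s \<otimes> s') t = \<beta> s t * \<beta> s' t"
  "s \<in> S \<Longrightarrow> t \<in> S \<Longrightarrow> t' \<in> S \<Longrightarrow> \<beta> s (t \<otimes> t') = \<beta> s t * \<beta> s t'"
  using data by (auto simp: normal_form_data_def bimultiplicative_def hom_def field_units_def)

private lemma \<beta>_one: "t \<in> S \<Longrightarrow> \<beta> \<one> t = 1"
  using \<beta>_mult(1) [of \<one> \<one> t] \<beta>_nonzero [of \<one> t] S_closed by (simp add: S_carrier)

private lemma \<beta>_inv: "s \<in> S \<Longrightarrow> t \<in> S \<Longrightarrow> \<beta> (inv s) t * \<beta> s t = 1"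
  using \<beta>_mult(1) [of "inv s" s t] \<beta>_one S_closed by (simp add: S_carrier)

text \<open>Polarisation: \<beta>(st,st) = 1 expands to \<beta>(s,t) \<beta>(t,s) = 1.\<close>

private lemma \<beta>_skew:
  assumes "s \<in> S" "t \<in> S"
  shows "\<beta> t s = \<beta> (inv s) t"
proof -
  have "\<beta> (s \<otimes> t) (s \<otimes> t) = 1" "\<beta> s s = 1" "\<beta> t t = 1"
    using data assms S_closed by (auto simp: normal_form_data_def alternative_form_def)
  then have "\<beta> s t * \<beta> t s = 1"
    using assms S_closed by (simp add: \<beta>_mult mult.commute)
  then show ?thesis using \<beta>_inv [OF assms] \<beta>_nonzero assms
    by (metis mult.commute mult_left_cancel)
qed

text \<open>Orthogonality of characters. For u different from 1, nondegeneracy supplies a t with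
  \<beta>(u,t) different from 1, and translation by t multiplies the sum by this number.\<close>

private lemma \<beta>_sum:
  assumes u: "u \<in> S"
  shows "(\<Sum>x\<in>S. \<beta> u x) = (if u = \<one> then of_nat (card S) else 0)"
proof (cases "u = \<one>")
  case True
  then show ?thesis by (simp add: \<beta>_one)
next
  case False
  have "inj_on (\<lambda>s. \<lambda>t\<in>S. \<beta> s t) S"
    using data by (simp add: normal_form_data_def nondegenerate_form_def iso_def bij_betw_def)
  then have "(\<lambda>t\<in>S. \<beta> u t) \<noteq> (\<lambda>t\<in>S. \<beta> \<one> t)"
    using False u S_closed(3) by (metis inj_onD)
  then obtain t where t: "t \<in> S" "\<beta> u t \<noteq> 1"
    using \<beta>_one by (auto simp: restrict_def fun_eq_iff split: if_splits)
  have "bij_betw (\<lambda>x. t \<otimes> x) S S"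
    by (rule bij_betw_byWitness [where f' = "\<lambda>x. inv t \<otimes> x"])
       (use t S_closed in \<open>auto simp: S_carrier m_assoc [symmetric]\<close>)
  then have "(\<Sum>x\<in>S. \<beta> u x) = (\<Sum>x\<in>S. \<beta> u (t \<otimes> x))"
    by (rule sum.reindex_bij_betw [symmetric])
  also have "\<dots> = \<beta> u t * (\<Sum>x\<in>S. \<beta> u x)"
    using t u by (simp add: \<beta>_mult sum_distrib_left)
  finally have "(1 - \<beta> u t) * (\<Sum>x\<in>S. \<beta> u x) = 0" by (simp add: algebra_simps)
  with t False show ?thesis by simp
qed

private abbreviation (input) "\<rho> \<equiv> \<lambda>g h. form_twist S \<beta> (g, h)"

lemma form_twist_closed: "form_twist S \<beta> \<in> carrier kG2"
  by (auto simp: group_algebra_carrier form_twist_apply S_finite S_carrier)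

text \<open>On S the coefficient of r_g r_h at c is \<beta>(h,c)/|S|^2 times the character sum
  \<Sum> \<beta>(g h^-1,x). The calculus of \<open>spread\<close> therefore applies to a form twist
  directly and yields the order and inverse that uniqueness relies on.\<close>

lemma normal_form_orthogonal_idempotents: "orthogonal_idempotents (\<lambda>g h. form_twist S \<beta> (g, h))"
  unfolding orthogonal_idempotents_def
proof (intro conjI ballI)
  show r: "\<rho> g \<in> carrier (GA G)" for g
    by (auto simp: group_algebra_carrier form_twist_apply S_finite S_carrier)
  fix g h assume gh: "g \<in> carrier G" "h \<in> carrier G"
  show "\<rho> g \<star> \<rho> h = (if g = h then \<rho> g else (\<lambda>_. 0))"
  proof (rule group_algebra_eqI [where G = G])
    fix c assume c: "c \<in> carrier G"
    have "(\<rho> g \<star> \<rho> h) c = (\<Sum>x\<in>S. \<rho> g x * \<rho> h (inv x \<otimes> c))"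
      unfolding mult_apply [OF c]
      by (rule sum.mono_neutral_right) (auto simp: form_twist_apply S_finite S_carrier)
    also have "\<dots> = (if g = h then \<rho> g c else 0)"
    proof (cases "g \<in> S \<and> h \<in> S \<and> c \<in> S")
      case True
      have "(\<Sum>x\<in>S. \<rho> g x * \<rho> h (inv x \<otimes> c)) =
          (\<Sum>x\<in>S. \<beta> (g \<otimes> inv h) x * (\<beta> h c / (of_nat (card S) * of_nat (card S))))"
      proof (intro sum.cong refl)
        fix x assume x: "x \<in> S"
        have "\<beta> h (inv x) = \<beta> (inv h) x"
          using \<beta>_skew [of "inv x" h] \<beta>_skew [of h x] x True S_closed by (simp add: S_carrier)
        then show "\<rho> g x * \<rho> h (inv x \<otimes> c) =
            \<beta> (g \<otimes> inv h) x * (\<beta> h c / (of_nat (card S) * of_nat (card S)))"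
          using x True S_closed by (simp add: form_twist_apply S_finite \<beta>_mult)
      qed
      also have "\<dots> = (\<Sum>x\<in>S. \<beta> (g \<otimes> inv h) x) * (\<beta> h c / (of_nat (card S) * of_nat (card S)))"
        by (rule sum_distrib_right [symmetric])
      also have "\<dots> = (if g = h then \<rho> g c else 0)"
      proof -
        have "g \<otimes> inv h = \<one> \<longleftrightarrow> g = h" using gh by (metis inv_closed inv_equality inv_inv r_inv)
        moreover have "g \<otimes> inv h \<in> S" using True S_closed by blast
        ultimately show ?thesis
          using True card_S by (simp add: \<beta>_sum form_twist_apply S_finite)
      qed
      finally show ?thesis .
    next
      case False
      have "\<rho> g x * \<rho> h (inv x \<otimes> c) = 0" if x: "x \<in> S" for x
      proof -
        have "c = x \<otimes> (inv x \<otimes> c)" using x c by (simp add: S_carrier m_assoc [symmetric])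
        then have "inv x \<otimes> c \<in> S \<Longrightarrow> c \<in> S" using S_closed(1) [OF x] by metis
        with False show ?thesis by (auto simp: form_twist_apply S_finite)
      qed
      then have "(\<Sum>x\<in>S. \<rho> g x * \<rho> h (inv x \<otimes> c)) = 0" by (intro sum.neutral ballI)
      moreover have "g = h \<Longrightarrow> \<rho> g c = 0" using False by (auto simp: form_twist_apply S_finite)
      ultimately show ?thesis by simp
    qed
    finally show "(\<rho> g \<star> \<rho> h) c = (if g = h then \<rho> g else (\<lambda>_. 0)) c" by simp
  qed (use r in \<open>auto simp: group_algebra_carrier mult_outside\<close>)
qed

private lemma spread_rho: "spread \<rho> (\<lambda>g. g) = form_twist S \<beta>"
  by (rule spread_id [OF form_twist_closed])

lemma normal_form_pow_order:
  assumes "form_twist S \<beta> \<in> Units kG2"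
  shows "form_twist S \<beta> [^]\<^bsub>kG2\<^esub> Coset.order G = \<one>\<^bsub>kG2\<^esub>"
  using spread_pow_order [OF normal_form_orthogonal_idempotents] assms by (simp add: spread_rho)

text \<open>The inverse is \<Sum> g^-1 \<otimes> r_g, and skewness of \<beta> matches its
  coefficients with those of F_21.\<close>

lemma normal_form_flip:
  assumes "form_twist S \<beta> \<in> Units kG2"
  shows "flip (form_twist S \<beta>) = inv\<^bsub>kG2\<^esub> form_twist S \<beta>"
proof -
  have "inv\<^bsub>kG2\<^esub> form_twist S \<beta> = spread \<rho> (\<lambda>g. inv g)"
    using spread_inv [OF normal_form_orthogonal_idempotents] assms by (simp add: spread_rho)
  also have "\<dots> = flip (form_twist S \<beta>)"
  proof (rule group_algebra_eqI [where G = "G \<times>\<times> G"])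
    show "spread \<rho> (\<lambda>g. inv g) \<in> carrier kG2"
      by (rule spread_closed [OF normal_form_orthogonal_idempotents]) auto
    fix p assume "p \<in> carrier GG"
    then obtain a b where p: "p = (a, b)" "a \<in> carrier G" "b \<in> carrier G" by auto
    have "spread \<rho> (\<lambda>g. inv g) (a, b) = (\<Sum>g\<in>carrier G. if g = inv a then \<rho> g b else 0)"
      unfolding spread_apply using p by (intro sum.cong) auto
    also have "\<dots> = form_twist S \<beta> (inv a, b)" using p by simp
    also have "\<dots> = form_twist S \<beta> (b, a)"
      using \<beta>_skew [of a b] S_closed(2) [of a] S_closed(2) [of "inv a"] p
      by (auto simp: form_twist_apply S_finite)
    finally show "spread \<rho> (\<lambda>g. inv g) p = flip (form_twist S \<beta>) p"
      by (simp add: p leg_apply form_twist_closed)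
  qed (use form_twist_closed in auto)
  finally show ?thesis ..
qed

text \<open>Coefficients are invariant under simultaneous conjugation: normality of \<open>S\<close>
  preserves the support, invariance of \<beta> the values.\<close>

lemma normal_form_commutes:
  assumes g: "g \<in> carrier G"
  shows "basis_elem (g, g) \<star>\<^sub>2 form_twist S \<beta> =
    form_twist S \<beta> \<star>\<^sub>2 basis_elem (g, g)"
proof (subst G2.commutes_basis_iff, use g in simp, intro ballI)
  fix c assume "c \<in> carrier GG"
  then obtain a b where c: "c = (a, b)" "a \<in> carrier G" "b \<in> carrier G" by auto
  have normal: "x \<otimes> s \<otimes> inv x \<in> S" if "x \<in> carrier G" "s \<in> S" for x s
    using data that by (simp add: normal_form_data_def normal_inv_iff)
  have conj: "x \<otimes> inv g = g \<otimes> (inv g \<otimes> x) \<otimes> inv g" if "x \<in> carrier G" for x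
    using g that by (simp add: m_assoc [symmetric])
  have conj': "inv g \<otimes> x = inv g \<otimes> (x \<otimes> inv g) \<otimes> inv (inv g)" if "x \<in> carrier G" for x
    using g that by (simp add: m_assoc)
  have mem: "x \<otimes> inv g \<in> S \<longleftrightarrow> inv g \<otimes> x \<in> S" if "x \<in> carrier G" for x
  proof
    assume "x \<otimes> inv g \<in> S"
    then show "inv g \<otimes> x \<in> S" by (subst conj' [OF that]) (intro normal inv_closed g)
  next
    assume "inv g \<otimes> x \<in> S"
    then show "x \<otimes> inv g \<in> S" by (subst conj [OF that]) (intro normal g)
  qed
  have "\<beta> (a \<otimes> inv g) (b \<otimes> inv g) = \<beta> (inv g \<otimes> a) (inv g \<otimes> b)"
    if "inv g \<otimes> a \<in> S" "inv g \<otimes> b \<in> S"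
    unfolding conj [OF c(2)] conj [OF c(3)]
    using data that g by (simp add: normal_form_data_def invariant_form_def)
  then have "form_twist S \<beta> (inv g \<otimes> a, inv g \<otimes> b) = form_twist S \<beta> (a \<otimes> inv g, b \<otimes> inv g)"
    unfolding form_twist_apply [OF S_finite] mem [OF c(2)] mem [OF c(3)] by auto
  then show "form_twist S \<beta> (inv\<^bsub>G \<times>\<times> G\<^esub> (g, g) \<otimes>\<^bsub>G \<times>\<times> G\<^esub> c) =
      form_twist S \<beta> (c \<otimes>\<^bsub>G \<times>\<times> G\<^esub> inv\<^bsub>G \<times>\<times> G\<^esub> (g, g))"
    using g by (simp add: c inv_DirProd is_group)
qed

lemma form_twist_support: "form_twist S \<beta> (s, t) \<noteq> 0 \<longleftrightarrow> s \<in> S \<and> t \<in> S"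
  using \<beta>_nonzero card_S by (auto simp: form_twist_apply S_finite)

lemma form_twist_form: "s \<in> S \<Longrightarrow> t \<in> S \<Longrightarrow> \<beta> s t = of_nat (card S) * form_twist S \<beta> (s, t)"
  using card_S by (simp add: form_twist_apply S_finite)

end

section \<open>Gauge invariants of form twists\<close>

lemma form_twist_eqD:
  fixes \<beta> \<beta>' :: "'a \<Rightarrow> 'a \<Rightarrow> 'k::field_char_0"
  assumes "normal_form_data G \<phi> S \<beta>" "normal_form_data G \<phi>' S' \<beta>'"
    and eq: "form_twist S' \<beta>' = form_twist S \<beta>"
  shows "S' = S" "\<forall>s\<in>S. \<forall>t\<in>S. \<beta>' s t = \<beta> s t"
proof -
  show S: "S' = S"
    using form_twist_support [OF assms(1)] form_twist_support [OF assms(2)] unfolding eq by blast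
  show "\<forall>s\<in>S. \<forall>t\<in>S. \<beta>' s t = \<beta> s t"
    using form_twist_form [OF assms(1)] form_twist_form [OF assms(2)] by (simp add: eq S eq [unfolded S])
qed

text \<open>The coefficients of u are orthogonal idempotents of the field, so exactly one of them is
  nonzero and it equals 1.\<close>

lemma grouplike_basis:
  fixes u :: "'a \<Rightarrow> 'k::field"
  assumes u: "u \<in> carrier (GA G)" "u \<noteq> (\<lambda>_. 0)" and eq: "coproduct G u = tensor u u"
  shows "\<exists>g\<in>carrier G. u = basis_elem g"
proof -
  have *: "u a * u b = (if a = b then u a else 0)" for a b
    using fun_cong [OF eq, of "(a, b)"] u(1) by (simp add: coproduct_apply)
  obtain g where g: "u g \<noteq> 0" using u(2) by auto
  have "u g = 1" using * [of g g] g by simp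
  moreover have "u h = 0" if "h \<noteq> g" for h using * [of h g] g that by simp
  ultimately have "u = basis_elem g" by (auto simp: basis_elem_def)
  moreover have "g \<in> carrier G" using g u(1) by (auto simp: group_algebra_carrier)
  ultimately show ?thesis by blast
qed

text \<open>Both \<open>F\<^sub>1\<close> and \<open>F\<^sub>2\<close> are powers of their squares, and the square \<open>F (flip F)\<^sup>-\<^sup>1\<close> of \<open>F\<close> is
  conjugated by \<open>c \<otimes> c\<close> under the gauge transformation \<open>c\<close>.\<close>

lemma gauge_grouplike:
  fixes F\<^sub>1 F\<^sub>2 :: "'a \<times> 'a \<Rightarrow> 'k::field"
  assumes odd: "odd (Coset.order G)"
    and F1: "F\<^sub>1 \<in> Units kG2" "flip F\<^sub>1 = inv\<^bsub>kG2\<^esub> F\<^sub>1"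
      "F\<^sub>1 [^]\<^bsub>kG2\<^esub> Coset.order G = \<one>\<^bsub>kG2\<^esub>"
    and F2: "F\<^sub>2 \<in> Units kG2" "flip F\<^sub>2 = inv\<^bsub>kG2\<^esub> F\<^sub>2"
      "F\<^sub>2 [^]\<^bsub>kG2\<^esub> Coset.order G = \<one>\<^bsub>kG2\<^esub>"
    and c: "c \<in> carrier (GA G)"
    and gauge: "F\<^sub>2 \<star>\<^sub>2 coproduct G c = tensor c c \<star>\<^sub>2 F\<^sub>1"
  shows "coproduct G c = tensor c c"
proof -
  note m = G2.A.m_assoc
  have C: "F\<^sub>1 \<in> carrier kG2" "F\<^sub>2 \<in> carrier kG2" "coproduct G c \<in> carrier kG2" "tensor c c \<in> carrier kG2"
    using F1 F2 c by auto
  have "flip (tensor c c) = tensor c c"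
    unfolding flip_def by (rule pushforward_swap_tensor [OF fg(1,1) c c])
  then have "inv\<^bsub>kG2\<^esub> F\<^sub>2 \<star>\<^sub>2 coproduct G c = tensor c c \<star>\<^sub>2 inv\<^bsub>kG2\<^esub> F\<^sub>1"
    using arg_cong [OF gauge, of flip] C by (simp add: leg_mult leg_coproduct F1(2) F2(2))
  then have "F\<^sub>2 \<star>\<^sub>2 (inv\<^bsub>kG2\<^esub> F\<^sub>2 \<star>\<^sub>2 coproduct G c) \<star>\<^sub>2 F\<^sub>1 =
      F\<^sub>2 \<star>\<^sub>2 (tensor c c \<star>\<^sub>2 inv\<^bsub>kG2\<^esub> F\<^sub>1) \<star>\<^sub>2 F\<^sub>1" by simp
  moreover have "F\<^sub>2 \<star>\<^sub>2 (inv\<^bsub>kG2\<^esub> F\<^sub>2 \<star>\<^sub>2 coproduct G c) \<star>\<^sub>2 F\<^sub>1 = coproduct G c \<star>\<^sub>2 F\<^sub>1"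
    using C F2(1) by (simp add: m [symmetric])
  moreover have "F\<^sub>2 \<star>\<^sub>2 (tensor c c \<star>\<^sub>2 inv\<^bsub>kG2\<^esub> F\<^sub>1) \<star>\<^sub>2 F\<^sub>1 = F\<^sub>2 \<star>\<^sub>2 tensor c c"
    using C F1(1) by (simp add: m)
  ultimately have swap: "coproduct G c \<star>\<^sub>2 F\<^sub>1 = F\<^sub>2 \<star>\<^sub>2 tensor c c"
    by simp
  \<comment> \<open>By \<open>gauge\<close>, moving a factor F past c \<otimes> c turns it into
    \<Delta>(c); by \<open>swap\<close>, the next factor turns it back. Only even exponents return
    to c \<otimes> c.\<close>
  have even: "tensor c c \<star>\<^sub>2 F\<^sub>1 [^]\<^bsub>kG2\<^esub> (2 * n) = F\<^sub>2 [^]\<^bsub>kG2\<^esub> (2 * n) \<star>\<^sub>2 tensor c c" for n :: nat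
  proof (induction n)
    case (Suc n)
    have "tensor c c \<star>\<^sub>2 F\<^sub>1 [^]\<^bsub>kG2\<^esub> (2 * Suc n) =
        tensor c c \<star>\<^sub>2 F\<^sub>1 [^]\<^bsub>kG2\<^esub> (2 * n) \<star>\<^sub>2 F\<^sub>1 \<star>\<^sub>2 F\<^sub>1"
      using C by (simp add: m)
    also have "\<dots> = F\<^sub>2 [^]\<^bsub>kG2\<^esub> (2 * n) \<star>\<^sub>2 (tensor c c \<star>\<^sub>2 F\<^sub>1) \<star>\<^sub>2 F\<^sub>1"
      unfolding Suc.IH using C by (simp add: m)
    also have "\<dots> = F\<^sub>2 [^]\<^bsub>kG2\<^esub> (2 * n) \<star>\<^sub>2 F\<^sub>2 \<star>\<^sub>2 (coproduct G c \<star>\<^sub>2 F\<^sub>1)"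
      unfolding gauge [symmetric] using C by (simp add: m)
    also have "\<dots> = F\<^sub>2 [^]\<^bsub>kG2\<^esub> (2 * Suc n) \<star>\<^sub>2 tensor c c"
      unfolding swap using C by (simp add: m)
    finally show ?case .
  qed (use C in simp)
  obtain l where l: "Coset.order G = 2 * l + 1" using odd by (rule oddE)
  \<comment> \<open>The number |G| + 1 = 2(l + 1) is even and F^|G| = 1, so F is an even power of
    itself.\<close>
  have root: "F [^]\<^bsub>kG2\<^esub> (2 * (l + 1)) = F"
    if "F \<in> carrier kG2" "F [^]\<^bsub>kG2\<^esub> Coset.order G = \<one>\<^bsub>kG2\<^esub>" for F :: "'a \<times> 'a \<Rightarrow> 'k"
  proof -
    have "2 * (l + 1) = Suc (Coset.order G)" by (simp add: l)
    then show ?thesis using that by (simp only: nat_pow_Suc) simp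
  qed
  have "F\<^sub>2 \<star>\<^sub>2 tensor c c = F\<^sub>2 \<star>\<^sub>2 coproduct G c"
    using even [of "l + 1"] root [OF C(1) F1(3)] root [OF C(2) F2(3)] gauge by simp
  then have "inv\<^bsub>kG2\<^esub> F\<^sub>2 \<star>\<^sub>2 (F\<^sub>2 \<star>\<^sub>2 tensor c c) = inv\<^bsub>kG2\<^esub> F\<^sub>2 \<star>\<^sub>2 (F\<^sub>2 \<star>\<^sub>2 coproduct G c)"
    by simp
  then show ?thesis using C F2(1) by (simp add: m [symmetric])
qed

end

section \<open>Twisted automorphisms\<close>

lemma tensor_map_left_inverse:
  assumes "finite_group G" "finite_group H" "finite_group G'" "finite_group H'"
    and f: "f \<in> alg_hom G G'" "f' \<in> alg_hom G' G" "\<And>x. x \<in> carrier (GA G) \<Longrightarrow> f' (f x) = x"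
    and h: "h \<in> alg_hom H H'" "h' \<in> alg_hom H' H" "\<And>x. x \<in> carrier (GA H) \<Longrightarrow> h' (h x) = x"
    and y: "y \<in> carrier (GA (G \<times>\<times> H))"
  shows "tensor_map G' H' f' h' (tensor_map G H f h y) = y"
proof -
  interpret GH: finite_group "G \<times>\<times> H" using assms(1,2) by blast
  show ?thesis
  proof (rule GH.alg_hom_eqI [OF _ alg_hom_id y])
    show "(\<lambda>y. tensor_map G' H' f' h' (tensor_map G H f h y)) \<in> alg_hom (G \<times>\<times> H) (G \<times>\<times> H)"
      by (rule alg_hom_comp [OF tensor_map_alg_hom [OF assms(1-4) f(1) h(1)]
            tensor_map_alg_hom [OF assms(3,4,1,2) f(2) h(2)]])
    fix p assume "p \<in> carrier (G \<times>\<times> H)"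
    then obtain a b where p: "p = (a, b)" "a \<in> carrier G" "b \<in> carrier H" by auto
    then show "tensor_map G' H' f' h' (tensor_map G H f h (basis_elem p)) = basis_elem p"
      by (simp add: tensor_map_basis [OF assms(1,2)] tensor_map_tensor [OF assms(3,4) f(2) h(2)]
          alg_hom_closed [OF f(1)] alg_hom_closed [OF h(1)] f(3) h(3) tensor_basis)
  qed
qed

context finite_group_powers
begin

abbreviation "tensor2 f \<equiv> tensor_map G G f f"
abbreviation "tensor3 f \<equiv> tensor_map G GG f (tensor2 f)"

lemma leg_basis:
  assumes "g \<in> carrier G" "h \<in> carrier G"
  shows "embed12 (basis_elem (g, h)) = basis_elem (g, h, \<one>)"
    and "embed13 (basis_elem (g, h)) = basis_elem (g, \<one>, h)"
    and "embed23 (basis_elem (g, h)) = basis_elem (\<one>, g, h)"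
    and "coproduct1 (basis_elem (g, h)) = basis_elem (g, g, h)"
    and "coproduct2 (basis_elem (g, h)) = basis_elem (g, h, h)"
    and "flip (basis_elem (g, h)) = basis_elem (h, g)"
    and "coproduct G (basis_elem g) = basis_elem (g, g)"
  unfolding leg_defs coproduct_eq
  by (simp_all add: pushforward_basis fg(2,1) assms)

lemma leg_tensor:
  assumes "x \<in> carrier (GA G)" "y \<in> carrier (GA G)"
  shows "embed12 (tensor x y) = tensor x (tensor y \<one>\<^bsub>GA G\<^esub>)"
    and "embed13 (tensor x y) = tensor x (tensor \<one>\<^bsub>GA G\<^esub> y)"
    and "embed23 (tensor x y) = tensor \<one>\<^bsub>GA G\<^esub> (tensor x y)"
    and "coproduct1 (tensor x y) = tensor_assoc (tensor (coproduct G x) y)"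
    and "coproduct2 (tensor x y) = tensor x (coproduct G y)"
    and "flip (tensor x y) = tensor y x"
  using assms
  by (auto simp: fun_eq_iff leg_apply coproduct_apply tensor_assoc_def group_algebra_one basis_elem_def)

lemma embed12_eq_tensor: "F \<in> carrier kG2 \<Longrightarrow> embed12 F = tensor_assoc (tensor F \<one>\<^bsub>GA G\<^esub>)"
  by (auto simp: fun_eq_iff leg_apply tensor_assoc_def group_algebra_one basis_elem_def)

lemma embed23_eq_tensor: "F \<in> carrier kG2 \<Longrightarrow> embed23 F = tensor \<one>\<^bsub>GA G\<^esub> F"
  by (auto simp: fun_eq_iff leg_apply tensor_assoc_def group_algebra_one basis_elem_def)

lemma tensor_assoc_mult:
  assumes "x \<in> carrier (GA (GG \<times>\<times> G))" "y \<in> carrier (GA (GG \<times>\<times> G))"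
  shows "tensor_assoc (x \<otimes>\<^bsub>GA (GG \<times>\<times> G)\<^esub> y) =
    tensor_assoc x \<star>\<^sub>3 tensor_assoc y"
proof -
  have hom: "pushforward (GG \<times>\<times> G) (\<lambda>((a, b), c). (a, b, c)) \<in> alg_hom (GG \<times>\<times> G) GGG"
    by (rule pushforward_alg_hom [OF fg(4,3)]) (auto simp: hom_def)
  show ?thesis
    using assms alg_hom_mult [OF hom assms]
    by (simp add: tensor_assoc_eq [OF fg(1,1,1)])
qed

lemma twisted_automorphism_iff:
  "twisted_automorphism G f F \<longleftrightarrow>
     f \<in> alg_hom G G \<and> bij_betw f (carrier (GA G)) (carrier (GA G)) \<and> F \<in> Units kG2 \<and>
     (\<forall>x\<in>carrier (GA G). F \<star>\<^sub>2 coproduct G (f x) =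
        tensor2 f (coproduct G x) \<star>\<^sub>2 F) \<and>
     twist_cocycle F \<and> counit_left G F = \<one>\<^bsub>GA G\<^esub> \<and> counit_right G F = \<one>\<^bsub>GA G\<^esub>"
proof -
  have "f \<in> algebra_automorphisms G \<longleftrightarrow>
      f \<in> alg_hom G G \<and> bij_betw f (carrier (GA G)) (carrier (GA G))"
    by (auto simp: algebra_automorphisms_def alg_hom_def ring_iso_def group_algebra_smult)
  moreover have "F \<in> Units kG2 \<Longrightarrow>
      tensor_assoc (tensor F \<one>\<^bsub>GA G\<^esub> \<otimes>\<^bsub>GA (GG \<times>\<times> G)\<^esub> tensor_map G G (coproduct G) id F) =
       tensor \<one>\<^bsub>GA G\<^esub> F \<star>\<^sub>3 tensor_map G G id (coproduct G) F \<longleftrightarrow> twist_cocycle F"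
    unfolding twist_cocycle_def by (simp add: cocycle_condition_eq G2.A.Units_closed)
  ultimately show ?thesis unfolding twisted_automorphism_def by blast
qed

context
  fixes f :: "('a \<Rightarrow> 'k::field) \<Rightarrow> 'a \<Rightarrow> 'k"
  assumes f: "f \<in> alg_hom G G"
begin

lemma tensor2_alg_hom: "tensor2 f \<in> alg_hom GG GG"
  by (rule tensor_map_alg_hom [OF fg(1,1,1,1) f f])

lemma tensor3_alg_hom: "tensor3 f \<in> alg_hom GGG GGG"
  by (rule tensor_map_alg_hom [OF fg(1,2,1,2) f tensor2_alg_hom])

private lemma f_basis: "g \<in> carrier G \<Longrightarrow> f (basis_elem g) \<in> carrier (GA G)"
  by (simp add: alg_hom_closed [OF f])

lemma tensor2_basis:
  "g \<in> carrier G \<Longrightarrow> h \<in> carrier G \<Longrightarrow>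
     tensor2 f (basis_elem (g, h)) = tensor (f (basis_elem g)) (f (basis_elem h))"
  by (rule tensor_map_basis [OF fg(1,1)])

lemma tensor3_basis:
  "g \<in> carrier G \<Longrightarrow> h \<in> carrier G \<Longrightarrow> k \<in> carrier G \<Longrightarrow>
     tensor3 f (basis_elem (g, h, k)) = tensor (f (basis_elem g)) (tensor (f (basis_elem h)) (f (basis_elem k)))"
  by (subst tensor_map_basis [OF fg(1,2)]) (auto simp: tensor2_basis)

private lemma f_one: "f (basis_elem \<one>) = \<one>\<^bsub>GA G\<^esub>"
  using alg_hom_one [OF f] by (simp add: group_algebra_one)

text \<open>Leg embeddings only insert a 1, and f(1) = 1. Coproducts, in contrast, are respected
  only up to conjugation by F.\<close>

lemma tensor_leg:
  assumes y: "y \<in> carrier kG2"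
  shows "tensor2 f (flip y) = flip (tensor2 f y)"
    and "tensor3 f (embed12 y) = embed12 (tensor2 f y)"
    and "tensor3 f (embed13 y) = embed13 (tensor2 f y)"
    and "tensor3 f (embed23 y) = embed23 (tensor2 f y)"
proof -
  show "tensor2 f (flip y) = flip (tensor2 f y)"
    by (rule G2.alg_hom_eqI [OF alg_hom_comp [OF leg_alg_hom(6) tensor2_alg_hom]
          alg_hom_comp [OF tensor2_alg_hom leg_alg_hom(6)] y])
       (auto simp: leg_basis tensor2_basis tensor3_basis leg_tensor f_basis f_one)
  show "tensor3 f (embed12 y) = embed12 (tensor2 f y)"
    by (rule G2.alg_hom_eqI [OF alg_hom_comp [OF leg_alg_hom(1) tensor3_alg_hom]
          alg_hom_comp [OF tensor2_alg_hom leg_alg_hom(1)] y])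
       (auto simp: leg_basis tensor2_basis tensor3_basis leg_tensor f_basis f_one)
  show "tensor3 f (embed13 y) = embed13 (tensor2 f y)"
    by (rule G2.alg_hom_eqI [OF alg_hom_comp [OF leg_alg_hom(2) tensor3_alg_hom]
          alg_hom_comp [OF tensor2_alg_hom leg_alg_hom(2)] y])
       (auto simp: leg_basis tensor2_basis tensor3_basis leg_tensor f_basis f_one)
  show "tensor3 f (embed23 y) = embed23 (tensor2 f y)"
    by (rule G2.alg_hom_eqI [OF alg_hom_comp [OF leg_alg_hom(3) tensor3_alg_hom]
          alg_hom_comp [OF tensor2_alg_hom leg_alg_hom(3)] y])
       (auto simp: leg_basis tensor2_basis tensor3_basis leg_tensor f_basis f_one)
qed

context
  fixes F :: "'a \<times> 'a \<Rightarrow> 'k"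
  assumes F: "F \<in> Units kG2"
    and intertwine: "\<And>x. x \<in> carrier (GA G) \<Longrightarrow>
      F \<star>\<^sub>2 coproduct G (f x) = tensor2 f (coproduct G x) \<star>\<^sub>2 F"
begin

private lemma FC: "F \<in> carrier kG2"
  by (rule G2.A.Units_closed [OF F])

private lemma intertwine_basis:
  "g \<in> carrier G \<Longrightarrow> F \<star>\<^sub>2 coproduct G (f (basis_elem g)) =
     tensor (f (basis_elem g)) (f (basis_elem g)) \<star>\<^sub>2 F"
  using intertwine [of "basis_elem g"] by (simp add: leg_basis tensor2_basis)

private lemma conj_eqI:
  assumes y: "y \<in> carrier kG2" and u: "u \<in> Units kG3"
    and D: "D \<in> alg_hom GG GGG"
    and *: "\<And>g h. g \<in> carrier G \<Longrightarrow> h \<in> carrier G \<Longrightarrow>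
      u \<star>\<^sub>3 D (tensor2 f (basis_elem (g, h))) =
      tensor3 f (D (basis_elem (g, h))) \<star>\<^sub>3 u"
  shows "u \<star>\<^sub>3 D (tensor2 f y) = tensor3 f (D y) \<star>\<^sub>3 u"
proof -
  have D2: "(\<lambda>y. D (tensor2 f y)) \<in> alg_hom GG GGG"
    by (rule alg_hom_comp [OF tensor2_alg_hom D])
  have 3: "(\<lambda>y. tensor3 f (D y)) \<in> alg_hom GG GGG"
    by (rule alg_hom_comp [OF D tensor3_alg_hom])
  have "u \<star>\<^sub>3 D (tensor2 f y) \<star>\<^sub>3 inv\<^bsub>kG3\<^esub> u = tensor3 f (D y)"
  proof (rule G2.alg_hom_eqI [OF alg_hom_conj [OF fg(3) D2 u] 3 y])
    fix p assume "p \<in> carrier GG"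
    then obtain g h where p: "p = (g, h)" "g \<in> carrier G" "h \<in> carrier G" by auto
    then have C: "tensor3 f (D (basis_elem p)) \<in> carrier kG3"
      by (intro alg_hom_closed [OF 3]) auto
    show "u \<star>\<^sub>3 D (tensor2 f (basis_elem p)) \<star>\<^sub>3 inv\<^bsub>kG3\<^esub> u = tensor3 f (D (basis_elem p))"
      using C u by (simp add: p(1) * [OF p(2,3)] G3.A.m_assoc G3.A.Units_closed)
  qed
  then have "u \<star>\<^sub>3 D (tensor2 f y) \<star>\<^sub>3 inv\<^bsub>kG3\<^esub> u \<star>\<^sub>3 u = tensor3 f (D y) \<star>\<^sub>3 u"
    by simp
  then show ?thesis
    using u alg_hom_closed [OF D2 y] by (simp add: G3.A.m_assoc G3.A.Units_closed)
qed

text \<open>The intertwining property of F, used in the first two legs: (\<Delta> \<otimes> I)(f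
  \<otimes> f) and (f \<otimes> f \<otimes> f)(\<Delta> \<otimes> I) are conjugate by F_12. This
  stands in for compatibility of f with \<Delta>.\<close>

lemma tensor_coproduct1:
  assumes y: "y \<in> carrier kG2"
  shows "embed12 F \<star>\<^sub>3 coproduct1 (tensor2 f y) =
    tensor3 f (coproduct1 y) \<star>\<^sub>3 embed12 F"
proof (rule conj_eqI [OF y _ leg_alg_hom(4)])
  show "embed12 F \<in> Units kG3" using F by simp
  fix g h assume gh: "g \<in> carrier G" "h \<in> carrier G"
  let ?B' = "GA (GG \<times>\<times> G)"
  let ?x = "f (basis_elem g)" and ?y = "f (basis_elem h)"
  note xy = f_basis [OF gh(1)] f_basis [OF gh(2)]
  have "embed12 F \<star>\<^sub>3 coproduct1 (tensor ?x ?y) =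
      tensor_assoc (tensor F \<one>\<^bsub>GA G\<^esub> \<otimes>\<^bsub>?B'\<^esub> tensor (coproduct G ?x) ?y)"
    using xy FC by (simp add: embed12_eq_tensor leg_tensor tensor_assoc_mult)
  also have "\<dots> = tensor_assoc (tensor (tensor ?x ?x) ?y \<otimes>\<^bsub>?B'\<^esub> tensor F \<one>\<^bsub>GA G\<^esub>)"
    using xy by (simp add: tensor_mult [OF fg(2,1)] intertwine_basis [OF gh(1)])
  also have "\<dots> = tensor_assoc (tensor (tensor ?x ?x) ?y) \<star>\<^sub>3 embed12 F"
    using xy FC by (simp add: embed12_eq_tensor tensor_assoc_mult)
  also have "tensor_assoc (tensor (tensor ?x ?x) ?y) = tensor ?x (tensor ?x ?y)"
    by (auto simp: tensor_assoc_def)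
  finally show "embed12 F \<star>\<^sub>3 coproduct1 (tensor2 f (basis_elem (g, h))) =
      tensor3 f (coproduct1 (basis_elem (g, h))) \<star>\<^sub>3 embed12 F"
    using gh by (simp add: tensor2_basis leg_basis tensor3_basis)
qed

lemma tensor_coproduct2:
  assumes y: "y \<in> carrier kG2"
  shows "embed23 F \<star>\<^sub>3 coproduct2 (tensor2 f y) =
    tensor3 f (coproduct2 y) \<star>\<^sub>3 embed23 F"
proof (rule conj_eqI [OF y _ leg_alg_hom(5)])
  show "embed23 F \<in> Units kG3" using F by simp
  fix g h assume gh: "g \<in> carrier G" "h \<in> carrier G"
  then show "embed23 F \<star>\<^sub>3 coproduct2 (tensor2 f (basis_elem (g, h))) =
      tensor3 f (coproduct2 (basis_elem (g, h))) \<star>\<^sub>3 embed23 F"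
    using f_basis [OF gh(1)] f_basis [OF gh(2)] FC
    by (simp add: tensor2_basis leg_basis tensor3_basis leg_tensor embed23_eq_tensor
        tensor_mult [OF fg(1,2)] intertwine_basis)
qed

end
end

text \<open>In the application a = F_12, b = F_23, c = (I \<otimes> \<Delta>)(F), d = (\<Delta>
  \<otimes> I)(F) and m = (\<Delta> \<otimes> I)(F_21); q and p are F and F_21 in legs 1 and 3, t is
  F_21 in legs 2 and 3, and s is F with \<Delta> in legs 1 and 3. The three equations are the
  cocycle condition under permutations of the legs. Eliminating s and c leaves the hexagon for F_21
  F^-1, up to conjugation by F_12.\<close>

lemma (in Group.monoid) cocycle_quotient:
  assumes "a \<in> Units G" "b \<in> Units G" "c \<in> Units G" "d \<in> Units G" "q \<in> Units G"
    and "m \<in> carrier G" "p \<in> carrier G" "s \<in> carrier G" "t \<in> carrier G"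
    and "a \<otimes> d = b \<otimes> c" "p \<otimes> s = a \<otimes> m" "q \<otimes> s = t \<otimes> c"
  shows "a \<otimes> (m \<otimes> inv d) = (p \<otimes> inv q) \<otimes> (t \<otimes> inv b) \<otimes> a"
proof -
  note C = assms(1-5) [THEN Units_closed] assms(1-5) [THEN Units_inv_closed] assms(6-9)
  have s: "s = inv q \<otimes> (t \<otimes> c)"
    using C assms(5,12) by (metis Units_l_inv l_one m_assoc)
  have "c = inv b \<otimes> (a \<otimes> d)"
    using C assms(2,10) by (metis Units_l_inv l_one m_assoc)
  then have "a \<otimes> m = p \<otimes> (inv q \<otimes> (t \<otimes> (inv b \<otimes> (a \<otimes> d))))"
    using assms(11) s by simp
  then have "a \<otimes> m \<otimes> inv d = p \<otimes> (inv q \<otimes> (t \<otimes> (inv b \<otimes> (a \<otimes> d)))) \<otimes> inv d"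
    by simp
  then show ?thesis using C assms(4) by (simp add: m_assoc)
qed

theorem twisted_automorphism_triangular:
  fixes F :: "'a \<times> 'a \<Rightarrow> 'k::field"
  assumes tw: "twisted_automorphism G f F"
  shows "\<exists>R. triangular R \<and> tensor2 f R = flip F \<star>\<^sub>2 inv\<^bsub>kG2\<^esub> F"
proof -
  from tw have f: "f \<in> alg_hom G G" and bij: "bij_betw f (carrier (GA G)) (carrier (GA G))"
    and F: "F \<in> Units kG2" and cocycle: "twist_cocycle F"
    and intertwine: "\<And>x. x \<in> carrier (GA G) \<Longrightarrow>
      F \<star>\<^sub>2 coproduct G (f x) = tensor2 f (coproduct G x) \<star>\<^sub>2 F"
    by (simp_all add: twisted_automorphism_iff)
  have FC: "F \<in> carrier kG2" by (rule G2.A.Units_closed [OF F])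
  define g where "g = inv_into (carrier (GA G)) f"
  have gf: "g (f x) = x" if "x \<in> carrier (GA G)" for x
    unfolding g_def using bij that by (simp add: bij_betw_def)
  have fg_id: "f (g x) = x" if "x \<in> carrier (GA G)" for x
    unfolding g_def using bij that by (simp add: bij_betw_def f_inv_into_f)
  have g: "g \<in> alg_hom G G"
  proof -
    have "f \<in> ring_iso (GA G) (GA G)" using f bij by (simp add: alg_hom_def ring_iso_def)
    then have "g \<in> ring_iso (GA G) (GA G)"
      unfolding g_def by (rule ring_iso_set_sym [OF A.ring_axioms])
    then have ring_hom: "g \<in> ring_hom (GA G) (GA G)" by (simp add: ring_iso_def)
    have "g (\<lambda>h. c * x h) = (\<lambda>h. c * g x h)" if x: "x \<in> carrier (GA G)" for c x
    proof -
      have gx: "g x \<in> carrier (GA G)" using ring_hom x by (rule ring_hom_closed)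
      have "g (f (\<lambda>h. c * g x h)) = (\<lambda>h. c * g x h)"
        using gx by (intro gf) (simp add: group_algebra_carrier)
      then show ?thesis by (simp add: alg_hom_smult [OF f gx] fg_id [OF x])
    qed
    with ring_hom show ?thesis by (simp add: alg_hom_def)
  qed
  note f2 = tensor2_alg_hom [OF f] and g2 = tensor2_alg_hom [OF g] and f3 = tensor3_alg_hom [OF f]
  have f2g2: "tensor2 f (tensor2 g y) = y" if "y \<in> carrier kG2" for y
    by (rule tensor_map_left_inverse [OF fg(1,1,1,1) g f fg_id g f fg_id that])
  have g2f2: "tensor2 g (tensor2 f y) = y" if "y \<in> carrier kG2" for y
    by (rule tensor_map_left_inverse [OF fg(1,1,1,1) f g gf f g gf that])
  have g3f3: "tensor3 g (tensor3 f y) = y" if "y \<in> carrier kG3" for y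
    using that
    by (intro tensor_map_left_inverse [where f = f and f' = g and h = "tensor2 f" and h' = "tensor2 g"
          and G' = G and H' = "G \<times>\<times> G"] fg f g f2 g2 gf g2f2)
  \<comment> \<open>This \<open>R\<close> belongs to the twisted side. Its preimage
    \<open>R'\<close> under f \<otimes> f satisfies the axioms with respect to \<Delta>
    itself.\<close>
  define R where "R = flip F \<star>\<^sub>2 inv\<^bsub>kG2\<^esub> F"
  have R: "R \<in> Units kG2" using F by (simp add: R_def)
  have RC: "R \<in> carrier kG2" by (rule G2.A.Units_closed [OF R])
  define R' where "R' = tensor2 g R"
  have R'U: "R' \<in> Units kG2" unfolding R'_def by (rule alg_hom_Units(1) [OF fg(2,2) g2 R])
  have R'C: "R' \<in> carrier kG2" by (rule G2.A.Units_closed [OF R'U])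
  have fR': "tensor2 f R' = R" unfolding R'_def by (rule f2g2 [OF RC])
  have "flip R \<star>\<^sub>2 R = \<one>\<^bsub>kG2\<^esub>"
  proof -
    have "flip R = F \<star>\<^sub>2 inv\<^bsub>kG2\<^esub> flip F"
      using F FC by (simp add: R_def leg_mult leg_inv)
    also have "\<dots> = inv\<^bsub>kG2\<^esub> R"
      using F by (simp add: R_def inv_mult_Units [OF G2.A.monoid_axioms])
    finally show ?thesis using R by simp
  qed
  then have flip: "flip R' \<star>\<^sub>2 R' = \<one>\<^bsub>kG2\<^esub>"
    unfolding R'_def using RC
    by (simp add: tensor_leg(1) [OF g, symmetric] alg_hom_mult [OF g2, symmetric] alg_hom_one [OF g2])
  have coproduct: "coproduct1 R' = embed13 R' \<star>\<^sub>3 embed23 R'"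
  proof -
    let ?a = "embed12 F"
    have c0: "?a \<star>\<^sub>3 coproduct1 F = embed23 F \<star>\<^sub>3 coproduct2 F"
      using cocycle by (simp add: twist_cocycle_def)
    have c1: "embed13 (flip F) \<star>\<^sub>3 permute3 swap23 (coproduct1 F) = ?a \<star>\<^sub>3 coproduct1 (flip F)"
      using arg_cong [OF c0, of "permute3 rotate_left"] FC by (simp add: permute3_mult permute3_leg)
    have c2: "embed13 F \<star>\<^sub>3 permute3 swap23 (coproduct1 F) = embed23 (flip F) \<star>\<^sub>3 coproduct2 F"
      using arg_cong [OF c0, of "permute3 swap23"] FC by (simp add: permute3_mult permute3_leg)
    have s: "permute3 swap23 (coproduct1 F) \<in> carrier kG3"
      by (rule alg_hom_closed [OF permute3_alg_hom(4)]) (use FC in auto)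
    have "?a \<star>\<^sub>3 (coproduct1 (flip F) \<star>\<^sub>3 inv\<^bsub>kG3\<^esub> coproduct1 F) =
        (embed13 (flip F) \<star>\<^sub>3 inv\<^bsub>kG3\<^esub> embed13 F) \<star>\<^sub>3 (embed23 (flip F) \<star>\<^sub>3 inv\<^bsub>kG3\<^esub> embed23 F) \<star>\<^sub>3 ?a"
      by (rule G3.A.cocycle_quotient [OF _ _ _ _ _ _ _ _ _ c0 c1 c2]) (use F FC s in auto)
    then have "?a \<star>\<^sub>3 coproduct1 R = embed13 R \<star>\<^sub>3 embed23 R \<star>\<^sub>3 ?a"
      using F FC by (simp add: R_def leg_mult leg_inv)
    moreover have "?a \<star>\<^sub>3 coproduct1 R = tensor3 f (coproduct1 R') \<star>\<^sub>3 ?a"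
      using tensor_coproduct1 [OF f F intertwine R'C] by (simp add: fR')
    moreover have "embed13 R \<star>\<^sub>3 embed23 R = tensor3 f (embed13 R' \<star>\<^sub>3 embed23 R')"
      using R'C by (simp add: alg_hom_mult [OF f3] tensor_leg [OF f] fR')
    \<comment> \<open>The conjugation by F_12 left over from \<open>cocycle_quotient\<close> is the
      one that \<open>tensor_coproduct1\<close> produces, so both cancel; injectivity of f \<otimes>
      f \<otimes> f then removes f.\<close>
    ultimately have "tensor3 f (coproduct1 R') \<star>\<^sub>3 ?a = tensor3 f (embed13 R' \<star>\<^sub>3 embed23 R') \<star>\<^sub>3 ?a"
      by simp
    then have "tensor3 f (coproduct1 R') \<star>\<^sub>3 ?a \<star>\<^sub>3 inv\<^bsub>kG3\<^esub> ?a =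
        tensor3 f (embed13 R' \<star>\<^sub>3 embed23 R') \<star>\<^sub>3 ?a \<star>\<^sub>3 inv\<^bsub>kG3\<^esub> ?a" by simp
    then have "tensor3 f (coproduct1 R') = tensor3 f (embed13 R' \<star>\<^sub>3 embed23 R')"
      using F FC R'C by (simp add: G3.A.m_assoc alg_hom_closed [OF f3])
    from arg_cong [OF this, of "tensor3 g"] show ?thesis
      using R'C by (simp only: g3f3 leg_closed G3.A.m_closed)
  qed
  \<comment> \<open>Both F and F_21 intertwine v = \<Delta>(f(h)) with u = f(h) \<otimes> f(h), the
    latter because u and v are symmetric. Hence F_21 F^-1 commutes with u.\<close>
  have "basis_elem (h, h) \<star>\<^sub>2 R' = R' \<star>\<^sub>2 basis_elem (h, h)" if h: "h \<in> carrier G" for h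
  proof -
    define u where "u = tensor (f (basis_elem h)) (f (basis_elem h))"
    define v where "v = coproduct G (f (basis_elem h))"
    have fh: "f (basis_elem h) \<in> carrier (GA G)" using h by (simp add: alg_hom_closed [OF f])
    have uC: "u \<in> carrier kG2" and vC: "v \<in> carrier kG2" using fh by (simp_all add: u_def v_def)
    have uF: "F \<star>\<^sub>2 v = u \<star>\<^sub>2 F"
      using intertwine [of "basis_elem h"] h by (simp add: u_def v_def leg_basis tensor2_basis [OF f])
    have flips: "flip u = u" "flip v = v"
      using fh by (simp_all add: u_def v_def leg_tensor leg_coproduct)
    have uflipF: "flip F \<star>\<^sub>2 v = u \<star>\<^sub>2 flip F"
      using arg_cong [OF uF, of flip] uC vC FC by (simp add: leg_mult flips)
    have "v \<star>\<^sub>2 inv\<^bsub>kG2\<^esub> F = inv\<^bsub>kG2\<^esub> F \<star>\<^sub>2 (F \<star>\<^sub>2 v) \<star>\<^sub>2 inv\<^bsub>kG2\<^esub> F"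
      using F FC vC by (simp add: G2.A.m_assoc [symmetric])
    also have "\<dots> = inv\<^bsub>kG2\<^esub> F \<star>\<^sub>2 u"
      unfolding uF using F FC uC by (simp add: G2.A.m_assoc)
    finally have vF: "v \<star>\<^sub>2 inv\<^bsub>kG2\<^esub> F = inv\<^bsub>kG2\<^esub> F \<star>\<^sub>2 u" .
    have "u \<star>\<^sub>2 R = flip F \<star>\<^sub>2 (v \<star>\<^sub>2 inv\<^bsub>kG2\<^esub> F)"
      unfolding R_def using F FC uC vC by (simp add: G2.A.m_assoc [symmetric] uflipF)
    also have "\<dots> = R \<star>\<^sub>2 u"
      unfolding R_def vF using F FC uC by (simp add: G2.A.m_assoc)
    finally have "u \<star>\<^sub>2 R = R \<star>\<^sub>2 u" .
    moreover have "u = tensor2 f (basis_elem (h, h))" using h by (simp add: u_def tensor2_basis [OF f])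
    ultimately have "tensor2 f (basis_elem (h, h) \<star>\<^sub>2 R') = tensor2 f (R' \<star>\<^sub>2 basis_elem (h, h))"
      using h R'C by (simp add: alg_hom_mult [OF f2] fR')
    from arg_cong [OF this, of "tensor2 g"] show ?thesis
      using h R'C by (simp add: g2f2)
  qed
  then have "triangular R'"
    using R'U flip coproduct by (simp add: triangular_def)
  with fR' show ?thesis unfolding R_def by blast
qed

section \<open>Twisted automorphisms from triangular structures and group automorphisms\<close>

lemma triangular_commutes_coproduct:
  fixes R :: "'a \<times> 'a \<Rightarrow> 'k::field"
  assumes R: "triangular R" and x: "x \<in> carrier (GA G)"
  shows "R \<star>\<^sub>2 coproduct G x = coproduct G x \<star>\<^sub>2 R"
proof -
  note U = triangular_Units [OF R] and C = triangular_carrier [OF R]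
  have "R \<star>\<^sub>2 coproduct G x \<star>\<^sub>2 inv\<^bsub>kG2\<^esub> R = coproduct G x"
  proof (rule alg_hom_eqI [OF alg_hom_conj [OF fg(2) leg_alg_hom(7) U] leg_alg_hom(7) x])
    fix g assume g: "g \<in> carrier G"
    have "R \<star>\<^sub>2 basis_elem (g, g) = basis_elem (g, g) \<star>\<^sub>2 R"
      using R g by (simp add: triangular_def)
    then show "R \<star>\<^sub>2 coproduct G (basis_elem g) \<star>\<^sub>2 inv\<^bsub>kG2\<^esub> R = coproduct G (basis_elem g)"
      using g U C by (simp add: leg_basis G2.A.m_assoc)
  qed
  then have "R \<star>\<^sub>2 coproduct G x \<star>\<^sub>2 inv\<^bsub>kG2\<^esub> R \<star>\<^sub>2 R = coproduct G x \<star>\<^sub>2 R" by simp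
  then show ?thesis using x U C by (simp add: G2.A.m_assoc)
qed

lemma triangular_pushforward:
  fixes R :: "'a \<times> 'a \<Rightarrow> 'k::field"
  assumes \<phi>: "\<phi> \<in> iso G G" and R: "triangular R"
  shows "triangular (pushforward GG (\<lambda>(a, b). (\<phi> a, \<phi> b)) R)"
proof -
  let ?P = "pushforward GG (\<lambda>(a, b). (\<phi> a, \<phi> b)) :: ('a \<times> 'a \<Rightarrow> 'k) \<Rightarrow> 'a \<times> 'a \<Rightarrow> 'k"
  let ?P3 = "pushforward GGG (\<lambda>(a, b, c). (\<phi> a, \<phi> b, \<phi> c)) :: ('a \<times> 'a \<times> 'a \<Rightarrow> 'k) \<Rightarrow> 'a \<times> 'a \<times> 'a \<Rightarrow> 'k"
  note C = triangular_carrier [OF R]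
  have hom: "\<phi> \<in> hom G G" and bij: "bij_betw \<phi> (carrier G) (carrier G)"
    using \<phi> by (auto simp: iso_def)
  interpret \<phi>: group_hom G G \<phi> by unfold_locales (rule hom)
  have P: "?P \<in> alg_hom GG GG"
    by (rule pushforward_alg_hom [OF fg(2,2)]) (auto simp: hom_def)
  have P3: "?P3 \<in> alg_hom GGG GGG"
    by (rule pushforward_alg_hom [OF fg(3,3)]) (auto simp: hom_def)
  have PP: "pushforward GG \<rho> (?P R) = pushforward GG (\<lambda>(a, b). \<rho> (\<phi> a, \<phi> b)) R"
    for \<rho> :: "'a \<times> 'a \<Rightarrow> 'c"
    by (subst pushforward_pushforward [OF fg(2)]) (auto simp: case_prod_beta')
  have "flip (?P R) = ?P (flip R)"
    "coproduct1 (?P R) = ?P3 (coproduct1 R)" "embed13 (?P R) = ?P3 (embed13 R)" "embed23 (?P R) = ?P3 (embed23 R)"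
    unfolding pushforward_leg unfolding leg_defs PP by (simp_all add: case_prod_beta')
  moreover have "basis_elem (g, g) \<star>\<^sub>2 ?P R = ?P R \<star>\<^sub>2 basis_elem (g, g)"
    if g: "g \<in> carrier G" for g
  proof -
    obtain h where h: "h \<in> carrier G" "g = \<phi> h" using g bij by (auto simp: bij_betw_def)
    have "basis_elem (g, g) = ?P (basis_elem (h, h))"
      using h by (subst pushforward_basis [OF fg(2)]) auto
    moreover have "basis_elem (h, h) \<star>\<^sub>2 R = R \<star>\<^sub>2 basis_elem (h, h)"
      using R h by (simp add: triangular_def)
    ultimately show ?thesis
      using h C by (simp add: alg_hom_mult [OF P, symmetric])
  qed
  ultimately show ?thesis
    using R C alg_hom_Units(1) [OF fg(2,2) P] unfolding triangular_def
    by (simp add: alg_hom_mult [OF P, symmetric] alg_hom_one [OF P] alg_hom_mult [OF P3])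
qed

text \<open>On the left this is the fact that the idempotents r_g sum to 1; on the right R_21 = R^-1
  reduces it to the inverse of the left counit.\<close>

lemma triangular_counit:
  fixes R :: "'a \<times> 'a \<Rightarrow> 'k::field"
  assumes R: "triangular R"
  shows "counit_left G R = \<one>\<^bsub>GA G\<^esub>" "counit_right G R = \<one>\<^bsub>GA G\<^esub>"
proof -
  note C = triangular_carrier [OF R] and U = triangular_Units [OF R]
  have sr: "spread (\<lambda>g h. R (g, h)) (\<lambda>g. g) = R" by (rule spread_id [OF C])
  have *: "(\<Sum>g\<in>carrier G. R (g, h)) = (if h = \<one> then 1 else 0)" for h
    using orthogonal_idempotents_sum [OF triangular_orthogonal_idempotents [OF R]] U by (simp add: sr)
  show left: "counit_left G R = \<one>\<^bsub>GA G\<^esub>"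
  proof (rule group_algebra_eqI [where G = G])
    show "counit_left G R \<in> carrier (GA G)"
      unfolding counit_left_eq by (rule alg_hom_closed [OF pushforward_snd_alg_hom C])
    fix b assume b: "b \<in> carrier G"
    have "counit_left G R b = (\<Sum>g\<in>carrier G. \<Sum>h\<in>carrier G. if h = b then R (g, h) else 0)"
      unfolding counit_left_eq pushforward_apply sum.cartesian_product by (auto intro!: sum.cong)
    then show "counit_left G R b = \<one>\<^bsub>GA G\<^esub> b"
      using b by (simp add: * group_algebra_one basis_elem_def)
  qed auto
  have "counit_right G R = pushforward GG snd (flip R)"
    unfolding counit_right_eq pushforward_leg by (simp add: case_prod_beta')
  also have "\<dots> = inv\<^bsub>GA G\<^esub> (counit_left G R)"
    unfolding triangular_flip [OF R] counit_left_eq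
    by (rule alg_hom_Units(2) [OF fg(2,1) pushforward_snd_alg_hom U])
  finally show "counit_right G R = \<one>\<^bsub>GA G\<^esub>" by (simp add: left)
qed

text \<open>An induced automorphism is compatible with \<Delta>, so the intertwining condition only
  asks R to commute with coproducts.\<close>

lemma induced_automorphism_twisted:
  fixes R :: "'a \<times> 'a \<Rightarrow> 'k::field"
  assumes \<phi>: "\<phi> \<in> iso G G" and R: "triangular R"
  shows "twisted_automorphism G (induced_automorphism G \<phi>) R"
proof -
  have hom: "\<phi> \<in> hom G G" and bij: "bij_betw \<phi> (carrier G) (carrier G)"
    using \<phi> by (auto simp: iso_def)
  have ind: "induced_automorphism G \<phi> = (pushforward G \<phi> :: ('a \<Rightarrow> 'k) \<Rightarrow> _)"
    by (rule induced_automorphism_eq)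
  have P: "pushforward G \<phi> \<in> (alg_hom G G :: (('a \<Rightarrow> 'k) \<Rightarrow> _) set)"
    by (rule pushforward_alg_hom [OF fg(1,1) hom])
  define \<psi> where "\<psi> = inv_into (carrier G) \<phi>"
  have \<psi>: "\<psi> \<in> hom G G"
    using iso_set_sym [OF \<phi>] by (simp add: \<psi>_def iso_def)
  have \<psi>\<phi>: "\<psi> (\<phi> g) = g" "\<phi> (\<psi> g) = g" if "g \<in> carrier G" for g
    using bij that by (auto simp: \<psi>_def bij_betw_def f_inv_into_f)
  have maps: "\<phi> \<in> carrier G \<rightarrow> carrier G" "\<psi> \<in> carrier G \<rightarrow> carrier G"
    using hom \<psi> by (auto simp: hom_def)
  have id: "pushforward G (\<lambda>g. \<psi> (\<phi> g)) x = x" "pushforward G (\<lambda>g. \<phi> (\<psi> g)) x = x"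
    if "x \<in> carrier (GA G)" for x :: "'a \<Rightarrow> 'k"
    by (subst (2) pushforward_id [OF that, symmetric], rule pushforward_cong, simp add: \<psi>\<phi>)+
  have P': "pushforward G \<psi> \<in> (alg_hom G G :: (('a \<Rightarrow> 'k) \<Rightarrow> _) set)"
    by (rule pushforward_alg_hom [OF fg(1,1) \<psi>])
  have "bij_betw (pushforward G \<phi>) (carrier (GA G)) (carrier (GA G :: ('k, 'a \<Rightarrow> 'k) module))"
    by (rule bij_betw_byWitness [where f' = "pushforward G \<psi>"])
       (auto simp: pushforward_pushforward [OF fg(1)] maps id
         alg_hom_closed [OF P] alg_hom_closed [OF P'])
  moreover have "R \<star>\<^sub>2 coproduct G (pushforward G \<phi> x) =
      tensor2 (pushforward G \<phi>) (coproduct G x) \<star>\<^sub>2 R" if x: "x \<in> carrier (GA G)" for x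
  proof -
    have "tensor2 (pushforward G \<phi>) (coproduct G x) = coproduct G (pushforward G \<phi> x)"
      unfolding tensor_map_pushforward [OF fg(1,1)] coproduct_eq
      by (subst pushforward_pushforward [OF fg(2)], use maps in force,
          subst pushforward_pushforward [OF fg(1) maps(1)]) simp
    then show ?thesis
      using triangular_commutes_coproduct [OF R alg_hom_closed [OF P x]] by simp
  qed
  ultimately show ?thesis
    unfolding twisted_automorphism_iff ind
    using P triangular_Units [OF R] triangular_cocycle [OF R] triangular_counit [OF R] by blast
qed

text \<open>An injective algebra map compatible with \<Delta> carries group-like elements to
  group-like elements, and these are the elements of \<open>G\<close>.\<close>

lemma hopf_automorphism_induced:
  fixes f :: "('a \<Rightarrow> 'k::field) \<Rightarrow> 'a \<Rightarrow> 'k"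
  assumes f: "f \<in> alg_hom G G" and inj: "inj_on f (carrier (GA G))"
    and hopf: "\<And>x. x \<in> carrier (GA G) \<Longrightarrow> coproduct G (f x) = tensor2 f (coproduct G x)"
  shows "\<exists>\<phi>\<in>iso G G. \<forall>x\<in>carrier (GA G). f x = pushforward G \<phi> x"
proof -
  have "\<exists>h\<in>carrier G. f (basis_elem g) = basis_elem h" if g: "g \<in> carrier G" for g
  proof (rule grouplike_basis)
    show "f (basis_elem g) \<in> carrier (GA G)" using g by (simp add: alg_hom_closed [OF f])
    show "coproduct G (f (basis_elem g)) = tensor (f (basis_elem g)) (f (basis_elem g))"
      using g by (simp add: hopf leg_basis tensor2_basis [OF f])
    show "f (basis_elem g) \<noteq> (\<lambda>_. 0)"
    proof
      assume "f (basis_elem g) = (\<lambda>_. 0)"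
      then have "f (basis_elem g) = f (\<lambda>_. 0)" by (simp add: alg_hom_zero [OF f])
      then have "basis_elem g = (\<lambda>_. 0 :: 'k)"
        by (rule inj_onD [OF inj]) (use g in \<open>auto simp: group_algebra_carrier basis_elem_def\<close>)
      then show False by (simp add: basis_elem_nonzero)
    qed
  qed
  then obtain \<phi> where \<phi>: "\<And>g. g \<in> carrier G \<Longrightarrow> \<phi> g \<in> carrier G"
    "\<And>g. g \<in> carrier G \<Longrightarrow> f (basis_elem g) = basis_elem (\<phi> g)" by metis
  have hom: "\<phi> \<in> hom G G"
  proof (rule homI)
    fix g h assume gh: "g \<in> carrier G" "h \<in> carrier G"
    have "(basis_elem (\<phi> (g \<otimes> h)) :: 'a \<Rightarrow> 'k) = f (basis_elem g \<star> basis_elem h)"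
      using gh by (simp add: \<phi> basis_mult_basis)
    also have "\<dots> = basis_elem (\<phi> g \<otimes> \<phi> h)"
      using gh by (subst alg_hom_mult [OF f]) (simp_all add: \<phi> basis_mult_basis)
    finally show "\<phi> (g \<otimes> h) = \<phi> g \<otimes> \<phi> h" by simp
  qed (rule \<phi>)
  have "inj_on \<phi> (carrier G)"
  proof (rule inj_onI)
    fix g h assume gh: "g \<in> carrier G" "h \<in> carrier G" "\<phi> g = \<phi> h"
    then have "f (basis_elem g) = f (basis_elem h)" by (simp add: \<phi>)
    then have "(basis_elem g :: 'a \<Rightarrow> 'k) = basis_elem h"
      by (rule inj_onD [OF inj]) (use gh in auto)
    then show "g = h" by simp
  qed
  then have "\<phi> \<in> iso G G"
    using hom \<phi>(1) endo_inj_surj [OF finite_carrier, of \<phi>] by (auto simp: iso_def bij_betw_def)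
  moreover have "f x = pushforward G \<phi> x" if "x \<in> carrier (GA G)" for x
    by (rule alg_hom_eqI [OF f pushforward_alg_hom [OF fg(1,1) hom] that])
       (simp add: \<phi> pushforward_basis fg(1))
  ultimately show ?thesis by blast
qed

text \<open>Under \<epsilon> \<otimes> I both twists disappear from the gauge equation and a =
  \<epsilon>(a) a remains. The normalisation of a gauge transformation is thus a consequence of its
  equation.\<close>

lemma gauge_transformation_counit:
  fixes F F' :: "'a \<times> 'a \<Rightarrow> 'k::field"
  assumes F: "F \<in> carrier kG2" "counit_left G F = \<one>\<^bsub>GA G\<^esub>"
    and F': "F' \<in> carrier kG2" "counit_left G F' = \<one>\<^bsub>GA G\<^esub>"
    and a: "a \<in> Units (GA G)"
    and gauge: "F' \<star>\<^sub>2 coproduct G a = tensor a a \<star>\<^sub>2 F"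
  shows "counit G a = 1"
proof -
  have aC: "a \<in> carrier (GA G)" by (rule A.Units_closed [OF a])
  have "(\<lambda>b. counit G a * a b) \<in> carrier (GA G)" using aC by (simp add: group_algebra_carrier)
  moreover have "counit_left G F' \<star> a = (\<lambda>b. counit G a * a b) \<star> counit_left G F"
    using arg_cong [OF gauge, of "counit_left G"] F(1) F'(1) aC
    by (simp add: counit_left_eq alg_hom_mult [OF pushforward_snd_alg_hom] pushforward_snd_tensor
        pushforward_snd_coproduct)
  ultimately have "a = (\<lambda>b. counit G a * a b)" using aC by (simp add: F(2) F'(2))
  then have *: "a b = counit G a * a b" for b by (rule fun_cong)
  have "\<exists>b. a b \<noteq> 0"
  proof (rule ccontr)
    assume "\<nexists>b. a b \<noteq> 0"
    then have "a = (\<lambda>g. 0 * a g)" by auto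
    then have "\<one>\<^bsub>GA G\<^esub> = (\<lambda>g. 0 * (a \<star> inv\<^bsub>GA G\<^esub> a) g)"
      using a smult_mult_left [of 0 a "inv\<^bsub>GA G\<^esub> a"] A.Units_r_inv [OF a] by metis
    then show False by (simp add: group_algebra_one basis_elem_nonzero)
  qed
  with * show ?thesis by (metis mult_cancel_right1)
qed

section \<open>Existence and uniqueness of the normal form\<close>

theorem normal_form_exists:
  fixes f :: "('a \<Rightarrow> 'k::alg_closed_field) \<Rightarrow> 'a \<Rightarrow> 'k"
  assumes odd: "odd (Coset.order G)" and tw: "twisted_automorphism G f F"
  shows "\<exists>\<phi> S \<beta>. normal_form_data G \<phi> S \<beta> \<and>
    gauge_isomorphic G f F (induced_automorphism G \<phi>) (form_twist S \<beta>)"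
proof -
  from tw have f: "f \<in> alg_hom G G" and bij: "bij_betw f (carrier (GA G)) (carrier (GA G))"
    and F: "F \<in> Units kG2" and cocycle: "twist_cocycle F"
    and intertwine: "\<And>x. x \<in> carrier (GA G) \<Longrightarrow>
      F \<star>\<^sub>2 coproduct G (f x) = tensor2 f (coproduct G x) \<star>\<^sub>2 F"
    and counit: "counit_left G F = \<one>\<^bsub>GA G\<^esub>"
    by (simp_all add: twisted_automorphism_iff)
  have FC: "F \<in> carrier kG2" by (rule G2.A.Units_closed [OF F])
  note f2 = tensor2_alg_hom [OF f] and f3 = tensor3_alg_hom [OF f]
  obtain R where R: "triangular R" and fR: "tensor2 f R = flip F \<star>\<^sub>2 inv\<^bsub>kG2\<^esub> F"
    using twisted_automorphism_triangular [OF tw] by blast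
  have RC: "R \<in> carrier kG2" by (rule triangular_carrier [OF R])
  obtain l where l: "Coset.order G = 2 * l + 1" using odd by (rule oddE)
  \<comment> \<open>With |G| = 2l + 1 and R^|G| = 1, the exponent l + 1 gives P^2 = R^(|G| + 1) =
    R.\<close>
  define P where "P = R [^]\<^bsub>kG2\<^esub> (l + 1)"
  have P: "triangular P" unfolding P_def by (rule triangular_pow [OF R])
  have PU: "P \<in> Units kG2" and PC: "P \<in> carrier kG2"
    by (rule triangular_Units [OF P], rule triangular_carrier [OF P])
  have PP: "P \<star>\<^sub>2 P = R"
  proof -
    have "P \<star>\<^sub>2 P = R [^]\<^bsub>kG2\<^esub> (Suc (Coset.order G))"
      unfolding P_def using RC by (simp only: G2.A.nat_pow_mult) (simp add: l mult_2)
    also have "\<dots> = R"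
      using triangular_pow_order [OF R] RC by simp
    finally show ?thesis .
  qed
  define Q where "Q = inv\<^bsub>kG2\<^esub> P"
  have Q: "triangular Q"
  proof -
    \<comment> \<open>As (l + 1) + l = |G|, the inverse of P is again a power of R and hence
      triangular.\<close>
    have "Q = R [^]\<^bsub>kG2\<^esub> l"
      unfolding Q_def
    proof (rule G2.A.inv_unique' [symmetric])
      have "R [^]\<^bsub>kG2\<^esub> (2 * l + 1) = \<one>\<^bsub>kG2\<^esub>" using triangular_pow_order [OF R] by (simp add: l)
      moreover have "l + 1 + l = 2 * l + 1" "l + (l + 1) = 2 * l + 1" by simp_all
      ultimately show "P \<star>\<^sub>2 R [^]\<^bsub>kG2\<^esub> l = \<one>\<^bsub>kG2\<^esub>" "R [^]\<^bsub>kG2\<^esub> l \<star>\<^sub>2 P = \<one>\<^bsub>kG2\<^esub>"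
        unfolding P_def using RC by (simp_all only: G2.A.nat_pow_mult)
    qed (use PC RC in auto)
    then show ?thesis using triangular_pow [OF R] by simp
  qed
  define p where "p = tensor2 f P"
  have pU: "p \<in> Units kG2" and pinv: "tensor2 f Q = inv\<^bsub>kG2\<^esub> p"
    unfolding p_def Q_def using alg_hom_Units [OF fg(2,2) f2 PU] by auto
  have pC: "p \<in> carrier kG2" by (rule G2.A.Units_closed [OF pU])
  have pp: "p \<star>\<^sub>2 p = flip F \<star>\<^sub>2 inv\<^bsub>kG2\<^esub> F"
    unfolding p_def using PC by (simp add: alg_hom_mult [OF f2, symmetric] PP fR)
  define J where "J = p \<star>\<^sub>2 F"
  have J: "J \<in> Units kG2" using pU F by (simp add: J_def)
  have JC: "J \<in> carrier kG2" by (rule G2.A.Units_closed [OF J])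
  \<comment> \<open>For p = (f \<otimes> f)(P) one has F_21 = p^2 F and p_21 = p^-1, so the flip of
    p F is p^-1 p^2 F.\<close>
  have "flip J = J"
  proof -
    have "flip p = inv\<^bsub>kG2\<^esub> p"
      unfolding p_def using triangular_flip [OF P] PC alg_hom_Units(2) [OF fg(2,2) f2 PU]
      by (simp add: tensor_leg(1) [OF f, symmetric])
    then have "flip J = inv\<^bsub>kG2\<^esub> p \<star>\<^sub>2 flip F" using pC FC by (simp add: J_def leg_mult)
    also have "flip F = p \<star>\<^sub>2 p \<star>\<^sub>2 F" unfolding pp using F FC by (simp add: G2.A.m_assoc)
    also have "inv\<^bsub>kG2\<^esub> p \<star>\<^sub>2 (p \<star>\<^sub>2 p \<star>\<^sub>2 F) = J"
      using pU pC FC by (simp add: J_def G2.A.m_assoc [symmetric])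
    finally show ?thesis .
  qed
  \<comment> \<open>The cocycle conditions of P, transported by f, and of F multiply, because
    \<open>tensor_coproduct1\<close> and \<open>tensor_coproduct2\<close> carry F_12 and F_23 past
    the coproducts of p.\<close>
  moreover have "twist_cocycle J"
  proof -
    have "embed12 J \<star>\<^sub>3 coproduct1 J =
        embed12 p \<star>\<^sub>3 (embed12 F \<star>\<^sub>3 coproduct1 p) \<star>\<^sub>3 coproduct1 F"
      unfolding J_def using pC FC by (simp add: leg_mult G3.A.m_assoc)
    also have "\<dots> = embed12 p \<star>\<^sub>3 (tensor3 f (coproduct1 P) \<star>\<^sub>3 embed12 F) \<star>\<^sub>3 coproduct1 F"
      unfolding p_def using tensor_coproduct1 [OF f F intertwine PC] by simp
    also have "\<dots> = tensor3 f (embed12 P \<star>\<^sub>3 coproduct1 P) \<star>\<^sub>3 (embed12 F \<star>\<^sub>3 coproduct1 F)"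
      unfolding p_def using PC FC pC
      by (simp add: alg_hom_mult [OF f3] tensor_leg [OF f, symmetric] alg_hom_closed [OF f3] G3.A.m_assoc)
    also have "\<dots> = tensor3 f (embed23 P \<star>\<^sub>3 coproduct2 P) \<star>\<^sub>3 (embed23 F \<star>\<^sub>3 coproduct2 F)"
      using cocycle triangular_cocycle [OF P] by (simp add: twist_cocycle_def)
    also have "\<dots> = embed23 p \<star>\<^sub>3 (tensor3 f (coproduct2 P) \<star>\<^sub>3 embed23 F) \<star>\<^sub>3 coproduct2 F"
      unfolding p_def using PC FC pC
      by (simp add: alg_hom_mult [OF f3] tensor_leg [OF f, symmetric] alg_hom_closed [OF f3] G3.A.m_assoc)
    also have "\<dots> = embed23 p \<star>\<^sub>3 (embed23 F \<star>\<^sub>3 coproduct2 p) \<star>\<^sub>3 coproduct2 F"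
      unfolding p_def using tensor_coproduct2 [OF f F intertwine PC] by simp
    also have "\<dots> = embed23 J \<star>\<^sub>3 coproduct2 J"
      unfolding J_def using pC FC by (simp add: leg_mult G3.A.m_assoc)
    finally show ?thesis by (simp add: twist_cocycle_def)
  qed
  ultimately obtain a where a: "a \<in> Units (GA G)" and \<Delta>a: "coproduct G a = tensor a a \<star>\<^sub>2 J"
    using symmetric_twist_trivial [OF J] by blast
  have aC: "a \<in> carrier (GA G)" by (rule A.Units_closed [OF a])
  define t where "t = tensor a a"
  define t' where "t' = tensor (inv\<^bsub>GA G\<^esub> a) (inv\<^bsub>GA G\<^esub> a)"
  have tC: "t \<in> carrier kG2" "t' \<in> carrier kG2" using aC a by (simp_all add: t_def t'_def)
  have tt': "t \<star>\<^sub>2 t' = \<one>\<^bsub>kG2\<^esub>" "t' \<star>\<^sub>2 t = \<one>\<^bsub>kG2\<^esub>"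
    using a by (simp_all add: t_def t'_def tensor_mult [OF fg(1,1)] tensor_one)
  have t: "t \<in> Units kG2" using tC tt' by (auto simp: Units_def)
  have t': "t' = inv\<^bsub>kG2\<^esub> t" using tC tt' by (intro G2.A.inv_unique') auto
  define f' where "f' = (\<lambda>x. a \<star> f x \<star> inv\<^bsub>GA G\<^esub> a)"
  have f': "f' \<in> alg_hom G G" unfolding f'_def by (rule alg_hom_conj [OF fg(1) f a])
  have inj: "inj_on f' (carrier (GA G))"
  proof (rule inj_onI)
    fix x y assume xy: "x \<in> carrier (GA G)" "y \<in> carrier (GA G)" "f' x = f' y"
    have fxy: "f x \<in> carrier (GA G)" "f y \<in> carrier (GA G)" using xy by (simp_all add: alg_hom_closed [OF f])
    have *: "inv\<^bsub>GA G\<^esub> a \<star> (a \<star> z \<star> inv\<^bsub>GA G\<^esub> a) \<star> a = z" if "z \<in> carrier (GA G)" for z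
      using a aC that by (simp add: A.m_assoc) (simp add: A.m_assoc [symmetric])
    have "f x = inv\<^bsub>GA G\<^esub> a \<star> f' x \<star> a"
      by (simp only: f'_def * [OF fxy(1)])
    also have "\<dots> = f y" by (simp only: xy(3)) (simp only: f'_def * [OF fxy(2)])
    finally have "f x = f y" .
    then show "x = y" by (rule inj_onD [OF bij_betw_imp_inj_on [OF bij]]) (rule xy)+
  qed
  have f'2: "tensor2 f' y = t \<star>\<^sub>2 tensor2 f y \<star>\<^sub>2 t'" if y: "y \<in> carrier kG2" for y
    unfolding t'
  proof (rule G2.alg_hom_eqI [OF tensor2_alg_hom [OF f'] alg_hom_conj [OF fg(2) f2 t] y])
    fix q assume "q \<in> carrier GG"
    then obtain g h where q: "q = (g, h)" "g \<in> carrier G" "h \<in> carrier G" by auto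
    show "tensor2 f' (basis_elem q) = t \<star>\<^sub>2 tensor2 f (basis_elem q) \<star>\<^sub>2 inv\<^bsub>kG2\<^esub> t"
      unfolding t' [symmetric] unfolding t_def t'_def q(1) tensor2_basis [OF f q(2,3)]
        tensor2_basis [OF f' q(2,3)] tensor_mult [OF fg(1,1)] unfolding f'_def ..
  qed
  have \<Delta>a': "coproduct G a = t \<star>\<^sub>2 p \<star>\<^sub>2 F"
    unfolding \<Delta>a J_def t_def [symmetric] using tC pC FC by (simp add: G2.A.m_assoc)
  \<comment> \<open>Since \<Delta>(a) = (a \<otimes> a) p F and p commutes with (f \<otimes>
    f)(\<Delta>(x)), conjugation by \<Delta>(a) takes \<Delta>(f(x)) to (f' \<otimes>
    f')(\<Delta>(x)).\<close>
  have hopf: "coproduct G (f' x) = tensor2 f' (coproduct G x)" if x: "x \<in> carrier (GA G)" for x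
  proof -
    have fx: "f x \<in> carrier (GA G)" using x by (simp add: alg_hom_closed [OF f])
    have Dx: "tensor2 f (coproduct G x) \<in> carrier kG2" using x by (simp add: alg_hom_closed [OF f2])
    have comm: "p \<star>\<^sub>2 tensor2 f (coproduct G x) = tensor2 f (coproduct G x) \<star>\<^sub>2 p"
      unfolding p_def using x PC triangular_commutes_coproduct [OF P x]
      by (simp add: alg_hom_mult [OF f2, symmetric])
    have "coproduct G a \<star>\<^sub>2 coproduct G (f x) = t \<star>\<^sub>2 p \<star>\<^sub>2 (F \<star>\<^sub>2 coproduct G (f x))"
      unfolding \<Delta>a' using tC pC FC fx by (simp add: G2.A.m_assoc)
    also have "\<dots> = t \<star>\<^sub>2 (p \<star>\<^sub>2 tensor2 f (coproduct G x)) \<star>\<^sub>2 F"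
      unfolding intertwine [OF x] using tC pC FC Dx by (simp add: G2.A.m_assoc)
    also have "\<dots> = t \<star>\<^sub>2 tensor2 f (coproduct G x) \<star>\<^sub>2 (p \<star>\<^sub>2 F)"
      unfolding comm using tC pC FC Dx by (simp add: G2.A.m_assoc)
    also have "\<dots> = t \<star>\<^sub>2 tensor2 f (coproduct G x) \<star>\<^sub>2 (t' \<star>\<^sub>2 t) \<star>\<^sub>2 (p \<star>\<^sub>2 F)"
      unfolding tt' using tC Dx by simp
    also have "\<dots> = tensor2 f' (coproduct G x) \<star>\<^sub>2 coproduct G a"
      unfolding \<Delta>a' f'2 [OF leg_closed(7) [OF x]] using tC pC FC Dx by (simp add: G2.A.m_assoc)
    finally have "coproduct G a \<star>\<^sub>2 coproduct G (f x) = tensor2 f' (coproduct G x) \<star>\<^sub>2 coproduct G a" .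
    moreover have "coproduct G (f' x) =
        coproduct G a \<star>\<^sub>2 coproduct G (f x) \<star>\<^sub>2 inv\<^bsub>kG2\<^esub> coproduct G a"
      unfolding f'_def using fx a aC by (simp add: leg_mult leg_inv)
    ultimately show ?thesis
      using a aC alg_hom_closed [OF tensor2_alg_hom [OF f'] leg_closed(7) [OF x]]
      by (simp add: G2.A.m_assoc)
  qed
  obtain \<phi> where \<phi>: "\<phi> \<in> iso G G" and f'\<phi>: "\<And>x. x \<in> carrier (GA G) \<Longrightarrow> f' x = pushforward G \<phi> x"
    using hopf_automorphism_induced [OF f' inj hopf] by blast
  \<comment> \<open>Solving F' \<Delta>(a) = (a \<otimes> a) F with \<Delta>(a) = (a \<otimes> a) p
    F dictates this value. It is the image of P^-1 under f' \<otimes> f', and it is triangular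
    because f' comes from an automorphism of \<open>G\<close>.\<close>
  define F' where "F' = t \<star>\<^sub>2 inv\<^bsub>kG2\<^esub> p \<star>\<^sub>2 t'"
  have "F' = tensor2 f' Q"
    unfolding F'_def pinv [symmetric] by (rule f'2 [symmetric]) (rule triangular_carrier [OF Q])
  also have "\<dots> = tensor2 (pushforward G \<phi>) Q"
    unfolding tensor_map_def lin_ext_def by (intro ext sum.cong refl) (auto simp: f'\<phi>)
  also have "\<dots> = pushforward GG (\<lambda>(a, b). (\<phi> a, \<phi> b)) Q"
    by (rule tensor_map_pushforward [OF fg(1,1)])
  finally have F': "triangular F'"
    using triangular_pushforward [OF \<phi> Q] by simp
  have gauge: "F' \<star>\<^sub>2 coproduct G a = tensor a a \<star>\<^sub>2 F"
  proof -
    have "F' \<star>\<^sub>2 coproduct G a = t \<star>\<^sub>2 inv\<^bsub>kG2\<^esub> p \<star>\<^sub>2 (t' \<star>\<^sub>2 t) \<star>\<^sub>2 (p \<star>\<^sub>2 F)"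
      unfolding F'_def \<Delta>a' using tC pC pU FC by (simp add: G2.A.m_assoc)
    also have "\<dots> = t \<star>\<^sub>2 (inv\<^bsub>kG2\<^esub> p \<star>\<^sub>2 p) \<star>\<^sub>2 F"
      unfolding tt' using tC pC pU FC by (simp add: G2.A.m_assoc del: G2.A.Units_l_inv)
    finally show ?thesis using tC pU by (simp add: t_def)
  qed
  obtain S \<beta> where data: "normal_form_data G \<phi> S \<beta>" and F'_eq: "F' = form_twist S \<beta>"
    using triangular_eq_form_twist [OF F' odd \<phi>] by blast
  have "gauge_transformation G a f F (induced_automorphism G \<phi>) F'"
    unfolding gauge_transformation_def induced_automorphism_eq
    using a gauge gauge_transformation_counit [OF FC counit triangular_carrier [OF F'] triangular_counit(1) [OF F'] a gauge]
    by (simp add: f'\<phi> [symmetric] f'_def)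
  then have "gauge_isomorphic G f F (induced_automorphism G \<phi>) F'"
    unfolding gauge_isomorphic_def using tw induced_automorphism_twisted [OF \<phi> F'] by blast
  with data show ?thesis unfolding F'_eq by blast
qed

theorem normal_form_unique:
  fixes f :: "('a \<Rightarrow> 'k::field_char_0) \<Rightarrow> 'a \<Rightarrow> 'k"
  assumes odd: "odd (Coset.order G)"
    and d1: "normal_form_data G \<phi> S \<beta>" and d2: "normal_form_data G \<phi>' S' \<beta>'"
    and g1: "gauge_isomorphic G f F (induced_automorphism G \<phi>) (form_twist S \<beta>)"
    and g2: "gauge_isomorphic G f F (induced_automorphism G \<phi>') (form_twist S' \<beta>')"
  shows "S' = S \<and> (\<forall>s\<in>S. \<forall>t\<in>S. \<beta>' s t = \<beta> s t) \<and>
    (\<exists>g\<in>carrier G. \<forall>x\<in>carrier G. \<phi>' x = g \<otimes> \<phi> x \<otimes> inv g)"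
proof -
  define F1 where "F1 = form_twist S \<beta>"
  define F2 where "F2 = form_twist S' \<beta>'"
  from g1 obtain a1 where a1: "a1 \<in> Units (GA G)"
    and f1: "\<And>x. x \<in> carrier (GA G) \<Longrightarrow> pushforward G \<phi> x = a1 \<star> f x \<star> inv\<^bsub>GA G\<^esub> a1"
    and e1: "F1 \<star>\<^sub>2 coproduct G a1 = tensor a1 a1 \<star>\<^sub>2 F"
    and tw: "f \<in> alg_hom G G" "F \<in> Units kG2" and U1: "F1 \<in> Units kG2"
    by (auto simp: gauge_isomorphic_def gauge_transformation_def induced_automorphism_eq F1_def
        twisted_automorphism_iff)
  from g2 obtain a2 where a2: "a2 \<in> Units (GA G)"
    and f2: "\<And>x. x \<in> carrier (GA G) \<Longrightarrow> pushforward G \<phi>' x = a2 \<star> f x \<star> inv\<^bsub>GA G\<^esub> a2"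
    and e2: "F2 \<star>\<^sub>2 coproduct G a2 = tensor a2 a2 \<star>\<^sub>2 F" and U2: "F2 \<in> Units kG2"
    by (auto simp: gauge_isomorphic_def gauge_transformation_def induced_automorphism_eq F2_def
        twisted_automorphism_iff)
  define b where "b = inv\<^bsub>GA G\<^esub> a1"
  \<comment> \<open>The composite gauge transformation from the first normal form through (f, F) to
    the second.\<close>
  define c where "c = a2 \<star> b"
  have C: "a1 \<in> carrier (GA G)" "a2 \<in> carrier (GA G)" "b \<in> carrier (GA G)" "F \<in> carrier kG2"
    "F1 \<in> carrier kG2" "F2 \<in> carrier kG2"
    using a1 a2 tw U1 U2 by (auto simp: b_def)
  have bU: "b \<in> Units (GA G)" using a1 by (simp add: b_def)
  have cU: "c \<in> Units (GA G)" using a2 bU by (simp add: c_def)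
  have cC: "c \<in> carrier (GA G)" by (rule A.Units_closed [OF cU])
  have ba: "b \<star> a1 = \<one>\<^bsub>GA G\<^esub>" "a1 \<star> b = \<one>\<^bsub>GA G\<^esub>" using a1 by (simp_all add: b_def)
  have tb: "tensor b b \<star>\<^sub>2 tensor a1 a1 = \<one>\<^bsub>kG2\<^esub>"
    by (simp add: tensor_mult [OF fg(1,1)] ba tensor_one)
  have \<Delta>b: "coproduct G a1 \<star>\<^sub>2 coproduct G b = \<one>\<^bsub>kG2\<^esub>"
    using C by (simp add: leg_mult [symmetric] ba)
  have tc: "tensor c c = tensor a2 a2 \<star>\<^sub>2 tensor b b"
    by (simp add: c_def tensor_mult [OF fg(1,1)])
  have gauge: "F2 \<star>\<^sub>2 coproduct G c = tensor c c \<star>\<^sub>2 F1"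
  proof -
    have "tensor c c \<star>\<^sub>2 F1 = tensor a2 a2 \<star>\<^sub>2 tensor b b \<star>\<^sub>2 (F1 \<star>\<^sub>2 coproduct G a1) \<star>\<^sub>2 coproduct G b"
      unfolding tc using C by (simp add: G2.A.m_assoc \<Delta>b)
    also have "\<dots> = tensor a2 a2 \<star>\<^sub>2 (tensor b b \<star>\<^sub>2 tensor a1 a1) \<star>\<^sub>2 F \<star>\<^sub>2 coproduct G b"
      unfolding e1 using C by (simp add: G2.A.m_assoc)
    also have "\<dots> = F2 \<star>\<^sub>2 coproduct G a2 \<star>\<^sub>2 coproduct G b"
      unfolding tb e2 using C by simp
    also have "\<dots> = F2 \<star>\<^sub>2 coproduct G c"
      unfolding c_def using C by (simp add: leg_mult G2.A.m_assoc)
    finally show ?thesis ..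
  qed
  have "coproduct G c = tensor c c"
    by (rule gauge_grouplike [OF odd U1 _ _ U2 _ _ cC gauge])
       (use normal_form_flip [OF d1] normal_form_pow_order [OF d1] normal_form_flip [OF d2]
         normal_form_pow_order [OF d2] U1 U2 in \<open>auto simp: F1_def F2_def\<close>)
  moreover have "c \<noteq> (\<lambda>_. 0)"
  proof
    assume "c = (\<lambda>_. 0)"
    then have "\<one>\<^bsub>GA G\<^esub> = (\<lambda>_. 0 :: 'k)"
      using A.Units_r_inv [OF cU] smult_mult_left [of 0 "\<lambda>_. 0" "inv\<^bsub>GA G\<^esub> c"] by simp
    then show False by (simp add: group_algebra_one basis_elem_nonzero)
  qed
  ultimately obtain g where g: "g \<in> carrier G" and c: "c = basis_elem g"
    using grouplike_basis [OF cC] by blast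
  let ?g = "basis_elem (g, g) :: 'a \<times> 'a \<Rightarrow> 'k"
  \<comment> \<open>For c = g the gauge equation reads F2 (g \<otimes> g) = (g \<otimes> g) F1, and
    F1 commutes with g \<otimes> g by invariance of its form.\<close>
  have "F2 \<star>\<^sub>2 ?g = F1 \<star>\<^sub>2 ?g"
    using gauge normal_form_commutes [OF d1 g] g by (simp add: c leg_basis tensor_basis F1_def)
  then have "F2 \<star>\<^sub>2 (?g \<star>\<^sub>2 basis_elem (inv g, inv g)) = F1 \<star>\<^sub>2 (?g \<star>\<^sub>2 basis_elem (inv g, inv g))"
    using g C by (simp add: G2.A.m_assoc [symmetric])
  moreover have "?g \<star>\<^sub>2 basis_elem (inv g, inv g) = \<one>\<^bsub>kG2\<^esub>"
    using g by (simp add: G2.basis_mult_basis group_algebra_one)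
  ultimately have F12: "F2 = F1" using C by simp
  have "\<phi>' x = g \<otimes> \<phi> x \<otimes> inv g" if x: "x \<in> carrier G" for x
  proof -
    have \<phi>x: "\<phi> x \<in> carrier G" using d1 x by (auto simp: normal_form_data_def iso_def hom_def)
    have fx: "f (basis_elem x) \<in> carrier (GA G)" using x by (simp add: alg_hom_closed [OF tw(1)])
    let ?x = "f (basis_elem x)"
    have "basis_elem (\<phi>' x) \<star> c = a2 \<star> ?x \<star> inv\<^bsub>GA G\<^esub> a2 \<star> (a2 \<star> b)"
      using f2 [of "basis_elem x"] x by (simp add: pushforward_basis [OF fg(1)] c_def)
    also have "\<dots> = a2 \<star> ?x \<star> (inv\<^bsub>GA G\<^esub> a2 \<star> a2) \<star> b"
      using C fx a2 by (simp add: A.m_assoc del: A.Units_l_inv)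
    also have "\<dots> = a2 \<star> (b \<star> a1) \<star> ?x \<star> b"
      unfolding ba using C fx a2 by simp
    also have "\<dots> = c \<star> (a1 \<star> ?x \<star> b)"
      unfolding c_def using C fx by (simp add: A.m_assoc)
    also have "a1 \<star> ?x \<star> b = basis_elem (\<phi> x)"
      using f1 [of "basis_elem x"] x by (simp add: pushforward_basis [OF fg(1)] b_def)
    finally have "basis_elem (\<phi>' x) \<star> c = c \<star> basis_elem (\<phi> x)" .
    moreover have "\<phi>' x \<in> carrier G" using d2 x by (auto simp: normal_form_data_def iso_def hom_def)
    ultimately have "\<phi>' x \<otimes> g = g \<otimes> \<phi> x" "\<phi>' x \<in> carrier G"
      using g \<phi>x by (simp_all add: c basis_mult_basis)
    then show ?thesis using g \<phi>x by (metis inv_solve_right m_closed)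
  qed
  then show ?thesis
    using g form_twist_eqD [OF d1 d2] F12 by (auto simp: F1_def F2_def)
qed

end

theorem proposition3p1:
  fixes G :: "('a, 'm) monoid_scheme"
    and f :: "('a \<Rightarrow> 'k::{alg_closed_field, field_char_0}) \<Rightarrow> 'a \<Rightarrow> 'k"
    and F :: "'a \<times> 'a \<Rightarrow> 'k"
  assumes "group G" and "finite (carrier G)" and "odd (Coset.order G)"
    and "twisted_automorphism G f F"
  shows "\<exists>\<phi> S \<beta>.
    normal_form_data G \<phi> S \<beta> \<and>
    gauge_isomorphic G f F (induced_automorphism G \<phi>) (form_twist S \<beta>) \<and>
    (\<forall>\<phi>' S' \<beta>'.
       normal_form_data G \<phi>' S' \<beta>' \<and>
       gauge_isomorphic G f F (induced_automorphism G \<phi>') (form_twist S' \<beta>') \<longrightarrow>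
       S' = S \<and> (\<forall>s\<in>S. \<forall>t\<in>S. \<beta>' s t = \<beta> s t) \<and>
       (\<exists>g\<in>carrier G. \<forall>x\<in>carrier G. \<phi>' x = g \<otimes>\<^bsub>G\<^esub> \<phi> x \<otimes>\<^bsub>G\<^esub> inv\<^bsub>G\<^esub> g))"
proof -
  interpret finite_group G
    by (rule finite_group.intro [OF assms(1)]) (rule finite_group_axioms.intro [OF assms(2)])
  interpret finite_group_powers G by (rule finite_group_powers)
  obtain \<phi> S \<beta> where 1: "normal_form_data G \<phi> S \<beta>"
    "gauge_isomorphic G f F (induced_automorphism G \<phi>) (form_twist S \<beta>)"
    using normal_form_exists [OF assms(3,4)] by blast
  then show ?thesis
    using normal_form_unique [OF assms(3)] by blast
qed

end
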